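(* Let $\mathcal G$ be a Gerstenhaber algebra and $\mathcal H=\underline\bigotimes^+(\mathcal G[1])$. On $S^+(\mathcal H[1])$ consider the coproduct $\Delta$ and the cobracket $\kappa$ defined in the context, and put $\tau_{12}=\tau\otimes id$, $\tau_{23}=id\otimes\tau$, where $\tau$ is the graded flip. Then: (i) (graded coJacobi identity) $\big(id^{\otimes3}+\tau_{12}\circ\tau_{23}+\tau_{23}\circ\tau_{12}\big)\circ(\kappa\otimes id)\circ\kappa=0$; (ii) (graded coLeibniz identity) $(id\otimes\Delta)\circ\kappa=(\kappa\otimes id)\circ\Delta+\tau_{12}\circ(id\otimes\kappa)\circ\Delta$.
   Context: Vector spaces are $\mathbb Z$-graded over a field of characteristic $0$. A Gerstenhaber algebra is a graded vector space $\mathcal G$ with a graded commutative associative product of degree $0$ and a bracket of degree $-1$ making $\mathcal G[1]$ a graded Lie algebra and acting by graded derivations of the product (only the graded vector space structure enters here). $V[1]$ is $V$ with degrees lowered by $1$. Koszul rule: exchanging adjacent elements of degrees $x,y$ costs $(-1)^{xy}$; $\varepsilon\binom{\dots}{\dots}$ denotes the resulting sign of a permutation of graded elements; $(f\otimes g)(u\otimes v)=(-1)^{|g||u|}f(u)\otimes g(v)$; $\tau(u\otimes v)=(-1)^{|u||v|}v\otimes u$. For $\alpha_i\in\mathcal G[1]$ of degree $a_i$: $Bat(p,q)$ is the set of permutations $\sigma$ of $\{1,\dots,p+q\}$ with $\sigma(1)<\dots<\sigma(p)$, $\sigma(p+1)<\dots<\sigma(p+q)$; $bat_{p,q}(\alpha_1\otimes\dots\otimes\alpha_p,\alpha_{p+1}\otimes\dots\otimes\alpha_{p+q})=\sum_{\sigma\in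 Bat(p,q)}\varepsilon\binom{a_1\dots a_{p+q}}{a_{\sigma^{-1}(1)}\dots a_{\sigma^{-1}(p+q)}}\alpha_{\sigma^{-1}(1)}\otimes\dots\otimes\alpha_{\sigma^{-1}(p+q)}$. $\underline\bigotimes^n(\mathcal G[1])$ is the quotient of $(\mathcal G[1])^{\otimes n}$ by the sum of the images of $bat_{p,n-p}$ ($0<p<n$), with classes written $\alpha_1\underline\otimes\dots\underline\otimes\alpha_n$; $\mathcal H=\bigoplus_{n\ge1}\underline\bigotimes^n(\mathcal G[1])$. In $\mathcal H[1]$ the element $X=\alpha_1\underline\otimes\dots\underline\otimes\alpha_p$ has degree $x=a_1+\dots+a_p-1$. $S^+(\mathcal H[1])$ is the graded symmetric algebra without unit; its product is denoted by a dot, and $X_I=X_{i_1}\cdot\ldots\cdot X_{i_k}$ for $I=\{i_1<\dots<i_k\}$, with degree $x_I$ ($X_\emptyset$ is omitted). $$\Delta(X_1\cdot\ldots\cdot X_n)=\sum_{I\sqcup J=\{1,\dots,n\},\ I,J\ne\emptyset}\varepsilon\binom{x_1\dots x_n}{x_I\ x_J}X_I\otimes X_J.$$ Writing $X_s=\alpha_1\underline\otimes\dots\underline\otimes\alpha_p$, the sum "over $U_s\underline\otimes V_s=X_s$" means the sum over $0<j<p$ with $U_s=\alpha_1\underline\otimes\dots\underline\otimes\alpha_j$, $V_s=\alpha_{j+1}\underline\otimes\dots\underline\otimes\alpha_p$, of degrees $u_s=a_1+\dots+a_j-1$, $v_s=a_{j+1}+\dots+a_p-1$ in $\mathcal H[1]$.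 Then $$\begin{aligned}\kappa(X_1\cdot\ldots\cdot X_n)=\sum_{\substack{1\le s\le n\\ I\sqcup J=\{1,\dots,n\}\setminus\{s\}}}(-1)^{\sum_{i<s}x_i}\sum_{U_s\underline\otimes V_s=X_s}(-1)^{u_s+1}\Big(&\varepsilon\tbinom{x_1\dots u_s v_s\dots x_n}{x_I\,u_s\,v_s\,x_J}X_I\cdot U_s\otimes V_s\cdot X_J\\&+\varepsilon\tbinom{x_1\dots u_s v_s\dots x_n}{x_I\,v_s\,u_s\,x_J}X_I\cdot V_s\otimes U_s\cdot X_J\Big),\end{aligned}$$ where $I$ or $J$ may be empty and in the signs $x_s$ is replaced by the pair $u_s,v_s$ in the initial order. $\kappa$ is well defined, of degree $1$. *)

theory Defs
  imports
    Complex_Main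
    "HOL-Library.Poly_Mapping"
    "HOL-Library.Set_Algebras"
    "HOL-Library.FuncSet"
    "HOL-Combinatorics.Permutations"
begin

section \<open>Graded vector spaces\<close>

text \<open>
  A graded vector space is given by its homogeneous components and its scalar multiplication;
  addition is the one of the ambient type.  For the quotient spaces below the ambient type is a type
  of sets, whose elements are cosets, and addition is elementwise addition
  \<open>A + B = {a + b | a \<in> A, b \<in> B}\<close> of cosets.  (The \<open>0\<close> of that type is \<open>{0}\<close>, which is
  \<^emph>\<open>not\<close> the zero of the quotient; the latter is the coset \<open>cls V R 0\<close> below.)
\<close>

record ('k, 'v) gspace =
  gcomp :: "int \<Rightarrow> 'v set"
  scl :: "'k \<Rightarrow> 'v \<Rightarrow> 'v"

text \<open>The underlying total space, i.e. the sum of all homogeneous components.\<close>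

inductive_set total :: "('k, 'v::plus) gspace \<Rightarrow> 'v set" for V where
  "x \<in> gcomp V d \<Longrightarrow> x \<in> total V"
| "x \<in> total V \<Longrightarrow> y \<in> total V \<Longrightarrow> x + y \<in> total V"

text \<open>\<open>V[1]\<close>: an element of degree \<open>d\<close> in \<open>V\<close> has degree \<open>d - 1\<close> in \<open>V[1]\<close>.\<close>

definition shift :: "('k, 'v) gspace \<Rightarrow> ('k, 'v) gspace" where
  "shift V = V\<lparr>gcomp := (\<lambda>d. gcomp V (d + 1))\<rparr>"

locale graded_vector_space = vector_space "scl V"
  for V :: "('k::field, 'v::ab_group_add) gspace" +
  assumes subspace_gcomp: "subspace (gcomp V d)"
    and decomposition: "\<exists>!f. (\<forall>d. f d \<in> gcomp V d) \<and> finite {d. f d \<noteq> 0} \<and> x = (\<Sum>d | f d \<noteq> 0. f d)"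

locale gerstenhaber_algebra = graded_vector_space G
  for G :: "('k::field_char_0, 'g::ab_group_add) gspace" +
  fixes mult :: "'g \<Rightarrow> 'g \<Rightarrow> 'g"
    and bracket :: "'g \<Rightarrow> 'g \<Rightarrow> 'g"
  assumes mult_linear: "Vector_Spaces.linear (scl G) (scl G) (mult x)"
      "Vector_Spaces.linear (scl G) (scl G) (\<lambda>x. mult x y)"
    and mult_degree: "x \<in> gcomp G a \<Longrightarrow> y \<in> gcomp G b \<Longrightarrow> mult x y \<in> gcomp G (a + b)"
    and mult_assoc: "mult (mult x y) z = mult x (mult y z)"
    and mult_comm: "x \<in> gcomp G a \<Longrightarrow> y \<in> gcomp G b \<Longrightarrow>
      mult x y = scl G ((-1) powi (a * b)) (mult y x)"
    and bracket_linear: "Vector_Spaces.linear (scl G) (scl G) (bracket x)"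
      "Vector_Spaces.linear (scl G) (scl G) (\<lambda>x. bracket x y)"
    and bracket_degree: "x \<in> gcomp G a \<Longrightarrow> y \<in> gcomp G b \<Longrightarrow> bracket x y \<in> gcomp G (a + b - 1)"
    and bracket_antisym: "x \<in> gcomp G a \<Longrightarrow> y \<in> gcomp G b \<Longrightarrow>
      bracket x y = - scl G ((-1) powi ((a - 1) * (b - 1))) (bracket y x)"
    and bracket_jacobi: "x \<in> gcomp G a \<Longrightarrow> y \<in> gcomp G b \<Longrightarrow>
      bracket x (bracket y z) =
        bracket (bracket x y) z + scl G ((-1) powi ((a - 1) * (b - 1))) (bracket y (bracket x z))"
    and bracket_leibniz: "x \<in> gcomp G a \<Longrightarrow> y \<in> gcomp G b \<Longrightarrow>
      bracket x (mult y z) =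
        mult (bracket x y) z + scl G ((-1) powi ((a - 1) * b)) (mult y (bracket x z))"

section \<open>Linear maps defined on a spanning family\<close>

definition glinear ::
  "('k, 'v::plus) gspace \<Rightarrow> ('k, 'w::plus) gspace \<Rightarrow> ('v \<Rightarrow> 'w) \<Rightarrow> bool" where
  "glinear V W f \<longleftrightarrow>
     (\<forall>x \<in> total V. f x \<in> total W) \<and>
     (\<forall>x \<in> total V. \<forall>y \<in> total V. f (x + y) = f x + f y) \<and>
     (\<forall>c. \<forall>x \<in> total V. f (scl V c x) = scl W c (f x))"

text \<open>The linear map \<open>V \<rightarrow> W\<close> that sends \<open>x\<close> to \<open>y\<close> for every \<open>(x, y) \<in> \<Gamma>\<close>.\<close>

definition linear_extension ::
  "('k, 'v::plus) gspace \<Rightarrow> ('k, 'w::plus) gspace \<Rightarrow> ('v \<times> 'w) set \<Rightarrow> 'v \<Rightarrow> 'w" where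
  "linear_extension V W \<Gamma> =
     (THE f. f \<in> extensional (total V) \<and> glinear V W f \<and> (\<forall>(x, y) \<in> \<Gamma>. f x = y))"

section \<open>Koszul signs\<close>

text \<open>
  The sign of rearranging elements of degrees \<open>ds\<close> (positions counted from \<open>0\<close>) into the order
  \<open>ds ! (p ! 0), ds ! (p ! 1), \<dots>\<close>: every pair whose order is reversed has to be exchanged once.
\<close>

definition koszul :: "int list \<Rightarrow> nat list \<Rightarrow> 'k::field" where
  "koszul ds p =
     (\<Prod>(k, l) \<in> {(k, l). k < l \<and> l < length p \<and> p ! l < p ! k}. (-1) powi (ds ! (p ! k) * ds ! (p ! l)))"

section \<open>Quotients of the tensor algebra\<close>

definition pscale :: "'k::field \<Rightarrow> ('x \<Rightarrow>\<^sub>0 'k) \<Rightarrow> ('x \<Rightarrow>\<^sub>0 'k)" where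
  "pscale c = Poly_Mapping.map ((*) c)"

global_interpretation free: vector_space pscale
proof
  have lk: "Poly_Mapping.lookup (pscale c p) k = c * Poly_Mapping.lookup p k" for c :: 'a and p :: "'b \<Rightarrow>\<^sub>0 'a" and k
    by (simp add: pscale_def map.rep_eq when_def)
  fix a b :: 'a and x y :: "'b \<Rightarrow>\<^sub>0 'a"
  show "pscale a (x + y) = pscale a x + pscale a y"
    by (rule poly_mapping_eqI) (simp add: lk lookup_add algebra_simps)
  show "pscale (a + b) x = pscale a x + pscale b x"
    by (rule poly_mapping_eqI) (simp add: lk lookup_add algebra_simps)
  show "pscale a (pscale b x) = pscale (a * b) x"
    by (rule poly_mapping_eqI) (simp add: lk)
  show "pscale 1 x = x"
    by (rule poly_mapping_eqI) (simp add: lk)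
qed

text \<open>
  A word \<open>[(d\<^sub>1, v\<^sub>1), \<dots>, (d\<^sub>n, v\<^sub>n)]\<close> stands for the tensor \<open>v\<^sub>1 \<otimes> \<dots> \<otimes> v\<^sub>n\<close> of homogeneous elements
  \<open>v\<^sub>i\<close> of degree \<open>d\<^sub>i\<close>; carrying the degrees along makes them unambiguous also for \<open>v\<^sub>i = 0\<close>.
\<close>

definition words :: "('k, 'v) gspace \<Rightarrow> (int \<times> 'v) list set" where
  "words V = {w. \<forall>(d, v) \<in> set w. v \<in> gcomp V d}"

definition wdeg :: "(int \<times> 'v) list \<Rightarrow> int" where
  "wdeg w = sum_list (map fst w)"

type_synonym ('k, 'v) tensor = "((int \<times> 'v) list \<Rightarrow>\<^sub>0 'k) set"

definition multilin_rels :: "('k::field, 'v::plus) gspace \<Rightarrow> ((int \<times> 'v) list \<Rightarrow>\<^sub>0 'k) set" where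
  "multilin_rels V =
     {Poly_Mapping.single (u @ (d, x + y) # w) 1
        - Poly_Mapping.single (u @ (d, x) # w) 1 - Poly_Mapping.single (u @ (d, y) # w) 1
      | u w d x y. u \<in> words V \<and> w \<in> words V \<and> x \<in> gcomp V d \<and> y \<in> gcomp V d} \<union>
     {Poly_Mapping.single (u @ (d, scl V c x) # w) 1 - Poly_Mapping.single (u @ (d, x) # w) c
      | u w d x c. u \<in> words V \<and> w \<in> words V \<and> x \<in> gcomp V d}"

definition rel_space ::
  "('k::field, 'v::plus) gspace \<Rightarrow> ((int \<times> 'v) list \<Rightarrow>\<^sub>0 'k) set \<Rightarrow> ((int \<times> 'v) list \<Rightarrow>\<^sub>0 'k) set" where
  "rel_space V R = free.span (multilin_rels V \<union> R)"

definition cls ::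
  "('k::field, 'v::plus) gspace \<Rightarrow> ((int \<times> 'v) list \<Rightarrow>\<^sub>0 'k) set \<Rightarrow> ((int \<times> 'v) list \<Rightarrow>\<^sub>0 'k) \<Rightarrow> ('k, 'v) tensor" where
  "cls V R p = p +o rel_space V R"

text \<open>
  The quotient of \<open>\<Oplus>\<^bsub>n \<in> L\<^esub> V\<^bsup>\<otimes>n\<^esup>\<close> by the span of \<open>R\<close>.  (The term \<open>rel_space V R\<close> in the scalar
  multiplication only matters for the scalar \<open>0\<close>.)
\<close>

definition tensor_quotient ::
  "('k::field, 'v::plus) gspace \<Rightarrow> ((int \<times> 'v) list \<Rightarrow>\<^sub>0 'k) set \<Rightarrow> nat set \<Rightarrow> ('k, ('k, 'v) tensor) gspace" where
  "tensor_quotient V R L =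
     \<lparr>gcomp = (\<lambda>d. cls V R ` free.span
                {Poly_Mapping.single w 1 | w. w \<in> words V \<and> length w \<in> L \<and> wdeg w = d}),
      scl = (\<lambda>c A. pscale c ` A + rel_space V R)\<rparr>"

abbreviation tensor_power ::
  "('k::field, 'v::plus) gspace \<Rightarrow> nat \<Rightarrow> ('k, ('k, 'v) tensor) gspace" where
  "tensor_power V n \<equiv> tensor_quotient V {} {n}"

abbreviation tensor_cls ::
  "('k::field, 'v::plus) gspace \<Rightarrow> (int \<times> 'v) list \<Rightarrow> ('k, 'v) tensor" where
  "tensor_cls V w \<equiv> cls V {} (Poly_Mapping.single w 1)"

section \<open>Maps between tensor powers\<close>

text \<open>
  The product \<open>V\<^bsup>\<otimes>m\<^esup> \<times> V\<^bsup>\<otimes>n\<^esup> \<rightarrow> V\<^bsup>\<otimes>(m+n)\<^esup>\<close>, \<open>(s, t) \<mapsto> s \<otimes> t\<close>, which is induced by concatenation.  It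
  identifies \<open>(V \<otimes> V) \<otimes> V\<close> and \<open>V \<otimes> (V \<otimes> V)\<close> with \<open>V\<^bsup>\<otimes>3\<^esup>\<close>.
\<close>

definition concat_free :: "('a list \<Rightarrow>\<^sub>0 'k::field) \<Rightarrow> ('a list \<Rightarrow>\<^sub>0 'k) \<Rightarrow> ('a list \<Rightarrow>\<^sub>0 'k)" where
  "concat_free p q =
     (\<Sum>u \<in> Poly_Mapping.keys p. \<Sum>w \<in> Poly_Mapping.keys q.
        Poly_Mapping.single (u @ w) (Poly_Mapping.lookup p u * Poly_Mapping.lookup q w))"

definition tensor_mult ::
  "('k::field, 'v::plus) gspace \<Rightarrow> ('k, 'v) tensor \<Rightarrow> ('k, 'v) tensor \<Rightarrow> ('k, 'v) tensor" where
  "tensor_mult V A B = {concat_free p q | p q. p \<in> A \<and> q \<in> B} + rel_space V {}"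

text \<open>\<open>f \<otimes> id\<close> and \<open>id \<otimes> g\<close> for \<open>f, g : V \<rightarrow> V \<otimes> V\<close>, where \<open>g\<close> has degree \<open>e\<close>
  (so that \<open>(id \<otimes> g)(u \<otimes> v) = (-1)\<^bsup>e|u|\<^esup> u \<otimes> g v\<close>).\<close>

definition tensor_id ::
  "('k::field, 'v::plus) gspace \<Rightarrow> ('v \<Rightarrow> ('k, 'v) tensor) \<Rightarrow> ('k, 'v) tensor \<Rightarrow> ('k, 'v) tensor" where
  "tensor_id V f = linear_extension (tensor_power V 2) (tensor_power V 3)
     {(tensor_cls V [(a, u), (b, v)], tensor_mult V (f u) (tensor_cls V [(b, v)]))
      | a u b v. u \<in> gcomp V a \<and> v \<in> gcomp V b}"

definition id_tensor ::
  "('k::field, 'v::plus) gspace \<Rightarrow> int \<Rightarrow> ('v \<Rightarrow> ('k, 'v) tensor) \<Rightarrow> ('k, 'v) tensor \<Rightarrow> ('k, 'v) tensor" where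
  "id_tensor V e g = linear_extension (tensor_power V 2) (tensor_power V 3)
     {(tensor_cls V [(a, u), (b, v)],
       scl (tensor_power V 3) ((-1) powi (e * a)) (tensor_mult V (tensor_cls V [(a, u)]) (g v)))
      | a u b v. u \<in> gcomp V a \<and> v \<in> gcomp V b}"

definition tau12 ::
  "('k::field, 'v::plus) gspace \<Rightarrow> ('k, 'v) tensor \<Rightarrow> ('k, 'v) tensor" where
  "tau12 V = linear_extension (tensor_power V 3) (tensor_power V 3)
     {(tensor_cls V [(a, u), (b, v), (c, w)],
       scl (tensor_power V 3) ((-1) powi (a * b)) (tensor_cls V [(b, v), (a, u), (c, w)]))
      | a u b v c w. u \<in> gcomp V a \<and> v \<in> gcomp V b \<and> w \<in> gcomp V c}"

definition tau23 ::
  "('k::field, 'v::plus) gspace \<Rightarrow> ('k, 'v) tensor \<Rightarrow> ('k, 'v) tensor" where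
  "tau23 V = linear_extension (tensor_power V 3) (tensor_power V 3)
     {(tensor_cls V [(a, u), (b, v), (c, w)],
       scl (tensor_power V 3) ((-1) powi (b * c)) (tensor_cls V [(a, u), (c, w), (b, v)]))
      | a u b v c w. u \<in> gcomp V a \<and> v \<in> gcomp V b \<and> w \<in> gcomp V c}"

section \<open>The graded symmetric algebra without unit\<close>

definition comm_rels :: "('k::field, 'v) gspace \<Rightarrow> ((int \<times> 'v) list \<Rightarrow>\<^sub>0 'k) set" where
  "comm_rels V =
     {Poly_Mapping.single (u @ [(a, x), (b, y)] @ w) 1
        - Poly_Mapping.single (u @ [(b, y), (a, x)] @ w) ((-1) powi (a * b))
      | u w a x b y. u \<in> words V \<and> w \<in> words V \<and> x \<in> gcomp V a \<and> y \<in> gcomp V b}"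

definition graded_sym :: "('k::field, 'v::plus) gspace \<Rightarrow> ('k, ('k, 'v) tensor) gspace" where
  "graded_sym V = tensor_quotient V (comm_rels V) {1..}"

section \<open>The quotient by shuffles\<close>

text \<open>Permutations act on \<open>{0, \<dots>, p+q-1}\<close> instead of \<open>{1, \<dots>, p+q}\<close>.\<close>

definition Bat :: "nat \<Rightarrow> nat \<Rightarrow> (nat \<Rightarrow> nat) set" where
  "Bat p q = {\<sigma>. \<sigma> permutes {..<p + q} \<and> strict_mono_on {..<p} \<sigma> \<and> strict_mono_on {p..<p + q} \<sigma>}"

definition bat :: "nat \<Rightarrow> nat \<Rightarrow> (int \<times> 'v) list \<Rightarrow> ((int \<times> 'v) list \<Rightarrow>\<^sub>0 'k::field)" where
  "bat p q w =
     (\<Sum>\<sigma> \<in> Bat p q. Poly_Mapping.single (map (\<lambda>i. w ! (inv \<sigma> i)) [0..<p + q])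
                       (koszul (map fst w) (map (inv \<sigma>) [0..<p + q])))"

definition bat_rels :: "('k::field, 'v) gspace \<Rightarrow> ((int \<times> 'v) list \<Rightarrow>\<^sub>0 'k) set" where
  "bat_rels V = {bat p q w | p q w. 0 < p \<and> 0 < q \<and> w \<in> words V \<and> length w = p + q}"

text \<open>\<open>\<H>\<close> and \<open>S\<^sup>+(\<H>[1])\<close>.\<close>

definition HH :: "('k::field, 'g::plus) gspace \<Rightarrow> ('k, ('k, 'g) tensor) gspace" where
  "HH G = tensor_quotient (shift G) (bat_rels (shift G)) {1..}"

definition SH :: "('k::field, 'g::plus) gspace \<Rightarrow> ('k, ('k, ('k, 'g) tensor) tensor) gspace" where
  "SH G = graded_sym (shift (HH G))"

section \<open>The coproduct and the cobracket\<close>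

text \<open>
  A word \<open>w = [(a\<^sub>1, \<alpha>\<^sub>1), \<dots>, (a\<^sub>p, \<alpha>\<^sub>p)]\<close> over \<open>G[1]\<close> represents \<open>X = \<alpha>\<^sub>1 \<otimes> \<dots> \<otimes> \<alpha>\<^sub>p\<close> in \<open>\<H>[1]\<close>, of
  degree \<open>xdeg w\<close>; a list of such words represents the product \<open>X\<^sub>1 \<cdot> \<dots> \<cdot> X\<^sub>n\<close> in \<open>S\<^sup>+(\<H>[1])\<close>.
\<close>

definition xdeg :: "(int \<times> 'g) list \<Rightarrow> int" where
  "xdeg w = wdeg w - 1"

definition xcls :: "('k::field, 'g::plus) gspace \<Rightarrow> (int \<times> 'g) list \<Rightarrow> ('k, 'g) tensor" where
  "xcls G w = cls (shift G) (bat_rels (shift G)) (Poly_Mapping.single w 1)"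

definition monomials :: "('k, 'g) gspace \<Rightarrow> (int \<times> 'g) list list set" where
  "monomials G = {ws. ws \<noteq> [] \<and> (\<forall>w \<in> set ws. w \<noteq> [] \<and> w \<in> words (shift G))}"

definition mdeg :: "(int \<times> 'g) list list \<Rightarrow> int" where
  "mdeg ws = sum_list (map xdeg ws)"

definition mcls ::
  "('k::field, 'g::plus) gspace \<Rightarrow> (int \<times> 'g) list list \<Rightarrow> ('k, ('k, 'g) tensor) tensor" where
  "mcls G ws = cls (shift (HH G)) (comm_rels (shift (HH G)))
     (Poly_Mapping.single (map (\<lambda>w. (xdeg w, xcls G w)) ws) 1)"

text \<open>
  For lists of indices \<open>p = [i\<^sub>1, \<dots>, i\<^sub>k]\<close> and \<open>q = [j\<^sub>1, \<dots>, j\<^sub>l]\<close>, the tensor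
  \<open>X\<^bsub>i\<^sub>1\<^esub> \<cdot> \<dots> \<cdot> X\<^bsub>i\<^sub>k\<^esub> \<otimes> X\<^bsub>j\<^sub>1\<^esub> \<cdot> \<dots> \<cdot> X\<^bsub>j\<^sub>l\<^esub>\<close> times the Koszul sign of bringing the factors of
  \<open>ws = [X\<^sub>0, X\<^sub>1, \<dots>]\<close> into this order, times \<open>c\<close>.
\<close>

definition split_term ::
  "('k::field, 'g::plus) gspace \<Rightarrow> (int \<times> 'g) list list \<Rightarrow> 'k \<Rightarrow> nat list \<Rightarrow> nat list \<Rightarrow>
     ((int \<times> ('k, ('k, 'g) tensor) tensor) list \<Rightarrow>\<^sub>0 'k)" where
  "split_term G ws c p q =
     (let P = map ((!) ws) p; Q = map ((!) ws) q
      in Poly_Mapping.single [(mdeg P, mcls G P), (mdeg Q, mcls G Q)] (c * koszul (map xdeg ws) (p @ q)))"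

definition coproduct_sum ::
  "('k::field, 'g::plus) gspace \<Rightarrow> (int \<times> 'g) list list \<Rightarrow>
     ((int \<times> ('k, ('k, 'g) tensor) tensor) list \<Rightarrow>\<^sub>0 'k)" where
  "coproduct_sum G ws =
     (\<Sum>I \<in> {I. I \<subseteq> {..<length ws} \<and> I \<noteq> {} \<and> {..<length ws} - I \<noteq> {}}.
        split_term G ws 1 (sorted_list_of_set I) (sorted_list_of_set ({..<length ws} - I)))"

text \<open>
  In the cobracket, \<open>ys\<close> is the list \<open>X\<^sub>0, \<dots>, X\<^bsub>s-1\<^esub>, U\<^sub>s, V\<^sub>s, X\<^bsub>s+1\<^esub>, \<dots>, X\<^bsub>n-1\<^esub>\<close>, in which \<open>U\<^sub>s\<close> has
  index \<open>s\<close> and \<open>V\<^sub>s\<close> has index \<open>s + 1\<close>; the sets \<open>I\<close>, \<open>J\<close> of the sum refer to the indices in \<open>ys\<close>.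
\<close>

definition cobracket_sum ::
  "('k::field, 'g::plus) gspace \<Rightarrow> (int \<times> 'g) list list \<Rightarrow>
     ((int \<times> ('k, ('k, 'g) tensor) tensor) list \<Rightarrow>\<^sub>0 'k)" where
  "cobracket_sum G ws =
     (\<Sum>s < length ws. \<Sum>j \<in> {0<..<length (ws ! s)}.
        let U = take j (ws ! s); V = drop j (ws ! s);
            ys = take s ws @ [U, V] @ drop (Suc s) ws;
            N = {..<length ys} - {s, Suc s};
            c = (-1) powi (\<Sum>i < s. xdeg (ws ! i)) * (-1) powi (xdeg U + 1)
        in \<Sum>I \<in> Pow N.
             split_term G ys c (sorted_list_of_set I @ [s]) (Suc s # sorted_list_of_set (N - I))
           + split_term G ys c (sorted_list_of_set I @ [Suc s]) (s # sorted_list_of_set (N - I)))"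

definition coproduct ::
  "('k::field, 'g::plus) gspace \<Rightarrow> ('k, ('k, 'g) tensor) tensor \<Rightarrow> ('k, ('k, ('k, 'g) tensor) tensor) tensor" where
  "coproduct G = linear_extension (SH G) (tensor_power (SH G) 2)
     {(mcls G ws, cls (SH G) {} (coproduct_sum G ws)) | ws. ws \<in> monomials G}"

definition cobracket ::
  "('k::field, 'g::plus) gspace \<Rightarrow> ('k, ('k, 'g) tensor) tensor \<Rightarrow> ('k, ('k, ('k, 'g) tensor) tensor) tensor" where
  "cobracket G = linear_extension (SH G) (tensor_power (SH G) 2)
     {(mcls G ws, cls (SH G) {} (cobracket_sum G ws)) | ws. ws \<in> monomials G}"

end

theory Submission
  imports Defs
begin

text \<open>
  Represent \<open>S(\<H>[1]) \<otimes> \<dots> \<otimes> S(\<H>[1])\<close> as a quotient of a free algebra whose letters are words over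
  \<open>\<G>[1]\<close> labelled by a tensor factor.  There \<open>\<Delta>\<close> is the algebra homomorphism that sends a letter \<open>X\<close> to
  \<open>X \<otimes> 1 + 1 \<otimes> X\<close>, \<open>\<kappa>\<close> is the odd derivation along it with \<open>\<kappa>(X) = \<Sum> (-1)\<^bsup>u+1\<^esup> (U \<otimes> V + V \<otimes> U)\<close>,
  and the flips relabel letters.  Both identities then hold exactly.  In (ii) both sides are derivations along the same
  homomorphism with the same values on letters.  In (i) the cyclic sum is again determined by its values on letters,
  where the terms cancel in pairs by coassociativity of deconcatenation and the oddness of \<open>\<kappa>\<close>.  Koszul signs
  appear only when letters are sorted into their tensor factors.  The operations preserve the ideal of relations: they
  respect graded commutativity by the derivation rule, and \<open>\<kappa>\<close> maps a shuffle of \<open>u\<close> and \<open>v\<close> to relations, as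
  deconcatenation is multiplicative for the shuffle product, and the only terms without a proper shuffle, \<open>u \<otimes> v\<close>
  and \<open>v \<otimes> u\<close>, cancel after symmetrization.
\<close>

section \<open>Free modules\<close>

text \<open>The obstacle is that every map of the statement is a \<open>THE\<close> on nested
  quotients: a letter in a tensor power of \<open>SH G\<close> is a class of words whose letters are
  again classes of words. Hence each map is shown to be induced by a linear map of free modules that
  preserves the relations. Existence of the linear extension follows from this, uniqueness from the
  fact that the prescribed elements span modulo the relations. The free algebra has a unit and S^+
  has none, so in the free algebra \<Delta> and \<kappa> acquire terms with an empty tensor factor.
  The map \<open>nu\<close> back to tensor powers discards them. This is compatible with composition
  because no operation turns a word that \<open>nu\<close> discards into one with all factors
  filled; this is checked separately for each operation. The recurring off-by-one is
  \<open>xdeg w = wdeg w - 1\<close>: the two pieces of a cut have total degree one less than the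
  whole. This makes \<kappa> odd, and it supplies the minus signs behind the cancellations in the
  coJacobi identity and in the shuffle relations.\<close>

abbreviation sing :: "'x \<Rightarrow> 'x \<Rightarrow>\<^sub>0 'k::field" where
  "sing x \<equiv> Poly_Mapping.single x 1"

global_interpretation free2: vector_space_pair
    "pscale :: 'k::field \<Rightarrow> ('x \<Rightarrow>\<^sub>0 'k) \<Rightarrow> _" "pscale :: 'k \<Rightarrow> ('y \<Rightarrow>\<^sub>0 'k) \<Rightarrow> _"
  ..

abbreviation plinear :: "(('x \<Rightarrow>\<^sub>0 'k::field) \<Rightarrow> ('y \<Rightarrow>\<^sub>0 'k)) \<Rightarrow> bool" where
  "plinear \<equiv> Vector_Spaces.linear pscale pscale"

lemma plinearI:
  assumes "\<And>p q. F (p + q) = F p + F q" "\<And>c p. F (pscale c p) = pscale c (F p)"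
  shows "plinear F"
  using assms by unfold_locales

lemmas plinear_add = free2.linear_add and plinear_scale = free2.linear_scale
  and plinear_0 = free2.linear_0 and plinear_diff = free2.linear_diff and plinear_sum = free2.linear_sum
  and plinear_neg = free2.linear_neg

lemma lookup_pscale: "Poly_Mapping.lookup (pscale c p) x = c * Poly_Mapping.lookup p x"
  by (simp add: pscale_def map.rep_eq when_def)

lemma pscale_single [simp]: "pscale c (Poly_Mapping.single x a) = Poly_Mapping.single x (c * a)"
  by (simp add: pscale_def)

lemma single_pscale: "Poly_Mapping.single x c = pscale c (sing x)"
  by simp

lemma poly_mapping_induct [case_names single add]:
  assumes "\<And>x c. P (Poly_Mapping.single x c)" "\<And>p q. P p \<Longrightarrow> P q \<Longrightarrow> P (p + q)"
  shows "P (p :: 'x \<Rightarrow>\<^sub>0 'k::field)"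
proof (induction p rule: update_induct)
  case const
  \<comment> \<open>The zero function is a single with coefficient 0, at any index.\<close>
  from assms(1)[of undefined 0] show ?case by simp
next
  case (update p x c)
  have "Poly_Mapping.update x c p = Poly_Mapping.single x c + p"
    using update(1) by (intro poly_mapping_eqI) (auto simp: lookup_update lookup_add lookup_single in_keys_iff)
  then show ?case using assms(2)[OF assms(1) update(3)] by simp
qed

lemma plinear_eqI:
  assumes "plinear F" "plinear H" "\<And>x. F (sing x) = H (sing x)"
  shows "F p = H p"
proof (induction p rule: poly_mapping_induct)
  case (single x c)
  show ?case unfolding single_pscale[of x c] by (simp only: assms plinear_scale)
next
  case (add p q)
  then show ?case by (simp add: assms plinear_add)
qed

definition lext :: "('x \<Rightarrow> ('y \<Rightarrow>\<^sub>0 'k)) \<Rightarrow> ('x \<Rightarrow>\<^sub>0 'k) \<Rightarrow> ('y \<Rightarrow>\<^sub>0 'k::field)" where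
  "lext f p = (\<Sum>x\<in>Poly_Mapping.keys p. pscale (Poly_Mapping.lookup p x) (f x))"

text \<open>Keys may cancel in \<open>p + q\<close>, so linearity is checked on one finite set that
  contains all the supports.\<close>

lemma lext_superset:
  assumes "finite A" "Poly_Mapping.keys p \<subseteq> A"
  shows "lext f p = (\<Sum>x\<in>A. pscale (Poly_Mapping.lookup p x) (f x))"
  unfolding lext_def
  by (rule sum.mono_neutral_left) (use assms in \<open>auto simp: in_keys_iff free.scale_zero_left\<close>)

lemma plinear_lext: "plinear (lext (f :: 'x \<Rightarrow> ('y \<Rightarrow>\<^sub>0 'k::field)))"
proof (rule plinearI)
  fix p q :: "'x \<Rightarrow>\<^sub>0 'k" and c :: 'k
  let ?A = "Poly_Mapping.keys p \<union> Poly_Mapping.keys q"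
  show "lext f (p + q) = lext f p + lext f q"
    by (subst (1 2 3) lext_superset[of ?A])
      (use Poly_Mapping.keys_add[of p q] in \<open>auto simp: lookup_add free.scale_left_distrib sum.distrib\<close>)
  show "lext f (pscale c p) = pscale c (lext f p)"
    by (subst (1 2) lext_superset[of ?A])
      (auto simp: lookup_pscale free.scale_sum_right in_keys_iff)
qed

lemmas lext_add = plinear_add[OF plinear_lext] and lext_scale = plinear_scale[OF plinear_lext]
  and lext_0 [simp] = plinear_0[OF plinear_lext] and lext_diff = plinear_diff[OF plinear_lext]
  and lext_sum = plinear_sum[OF plinear_lext]

lemma lext_single [simp]: "lext f (Poly_Mapping.single x c) = pscale c (f x)"
  by (cases "c = 0") (simp_all add: lext_def)

lemma plinear_lext_eq: "plinear F \<Longrightarrow> F p = lext (\<lambda>x. F (sing x)) p"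
  by (rule plinear_eqI) (auto intro: plinear_lext)

lemma plinear_compose: "plinear F \<Longrightarrow> plinear H \<Longrightarrow> plinear (\<lambda>p. F (H p))"
  by (rule plinearI) (simp_all add: plinear_add plinear_scale)

lemma plinear_plus: "plinear F \<Longrightarrow> plinear H \<Longrightarrow> plinear (\<lambda>p. F p + H p)"
  by (rule plinearI) (simp_all add: plinear_add plinear_scale algebra_simps free.scale_right_distrib)

lemma plinear_minus: "plinear F \<Longrightarrow> plinear H \<Longrightarrow> plinear (\<lambda>p. F p - H p)"
  by (rule plinearI) (simp_all add: plinear_add plinear_scale algebra_simps free.scale_right_diff_distrib)

lemma plinear_id: "plinear (\<lambda>p. p)"
  by (rule plinearI) simp_all

lemma plinear_pscale: "plinear F \<Longrightarrow> plinear (\<lambda>p. pscale c (F p))"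
  by (rule plinearI) (simp_all add: plinear_add plinear_scale free.scale_right_distrib mult.commute)

lemma plinear_span:
  assumes "plinear F" "free.subspace T" "\<And>x. x \<in> S \<Longrightarrow> F x \<in> T" "p \<in> free.span S"
  shows "F p \<in> T"
  using assms(4)
proof (induction rule: free.span_induct_alt)
  case base
  then show ?case using assms(1,2) by (simp add: plinear_0 free.subspace_0)
next
  case (step c x y)
  then show ?case using assms by (simp add: plinear_add plinear_scale free.subspace_add free.subspace_scale)
qed

lemma lext_in_subspace:
  assumes "free.subspace T" "\<And>x. f x \<in> T"
  shows "lext f p \<in> T"
  unfolding lext_def by (intro free.subspace_sum free.subspace_scale assms)

section \<open>Signs\<close>

text \<open>Valued in any unital ring, so that a sign can be a scalar of the field as well as an
  element of the free algebra.\<close>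

definition sg :: "int \<Rightarrow> 'r::ring_1" where
  "sg n = (if even n then 1 else -1)"

lemma sg_add: "sg (m + n) = sg m * sg n"
  by (simp add: sg_def)

lemma sg_0 [simp]: "sg 0 = 1"
  by (simp add: sg_def)

lemma sg_power_int: "(-1) powi n = (sg n :: 'k::field)"
  by (simp add: sg_def power_int_minus_left)

lemma sg_sq_left [simp]: "sg n * (sg n * x) = x"
  by (simp add: sg_def)

section \<open>Free algebras\<close>

text \<open>Finitely supported functions on an additive monoid carry a convolution product. With
  concatenation as addition, those on words form the free associative algebra.\<close>

instantiation list :: (type) monoid_add
begin

definition "0 = []"
definition "xs + ys = xs @ ys"

instance by standard (simp_all add: zero_list_def plus_list_def)

end

lemma sing_mult: "Poly_Mapping.single u a * Poly_Mapping.single w b = Poly_Mapping.single (u @ w) (a * b)"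
  by (simp add: mult_single plus_list_def)

lemma one_eq_sing: "(1 :: 'x list \<Rightarrow>\<^sub>0 'k::field) = sing []"
  by (simp flip: single_one add: zero_list_def)

lemma sing_Cons: "sing (x # w) = sing [x] * (sing w :: 'x list \<Rightarrow>\<^sub>0 'k::field)"
  by (simp add: sing_mult)

lemma pscale_mult: "pscale c p = Poly_Mapping.single 0 c * p"
  unfolding pscale_def by (rule mult_map_scale_conv_mult)

lemma pscale_mult_left: "pscale c p * q = pscale c (p * q)"
  by (simp add: pscale_mult mult.assoc)

lemma pscale_mult_right: "p * pscale c q = pscale c (p * (q :: 'x list \<Rightarrow>\<^sub>0 'k::field))"
proof -
  have "Poly_Mapping.single [] c * p = p * Poly_Mapping.single [] c" for p :: "'x list \<Rightarrow>\<^sub>0 'k"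
    by (induction p rule: poly_mapping_induct) (simp_all add: sing_mult algebra_simps)
  from this[of p] show ?thesis by (simp add: pscale_mult zero_list_def flip: mult.assoc)
qed

lemma pscale_sg: "pscale (sg n) p = sg n * p"
  by (simp add: sg_def)

lemma plinear_mult_left: "plinear F \<Longrightarrow> plinear (\<lambda>p. F p * (q :: 'x list \<Rightarrow>\<^sub>0 'k::field))"
  by (rule plinearI) (simp_all add: plinear_add plinear_scale algebra_simps pscale_mult_left)

lemma plinear_mult_right: "plinear F \<Longrightarrow> plinear (\<lambda>p. (q :: 'x list \<Rightarrow>\<^sub>0 'k::field) * F p)"
  by (rule plinearI) (simp_all add: plinear_add plinear_scale algebra_simps pscale_mult_right)

lemma plinear_sg: "plinear F \<Longrightarrow> F (sg n * p) = sg n * F p"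
  by (simp add: plinear_scale flip: pscale_sg)

text \<open>Brings the product behind \<open>tensor_mult\<close> under the laws of rings.\<close>

lemma concat_free_eq: "concat_free p q = p * (q :: 'x list \<Rightarrow>\<^sub>0 'k::field)"
proof -
  have "concat_free p q = lext (\<lambda>u. lext (\<lambda>w. sing (u @ w)) q) p"
    by (simp add: concat_free_def lext_def free.scale_sum_right)
  also have "\<dots> = p * q"
  proof (induction p rule: poly_mapping_induct)
    case (single u c)
    show ?case
      by (induction q rule: poly_mapping_induct) (simp_all add: sing_mult lext_add algebra_simps free.scale_right_distrib)
  qed (simp add: lext_add algebra_simps)
  finally show ?thesis .
qed

subsection \<open>Two-sided ideals\<close>

text \<open>Words as cofactors suffice, because they span the free algebra.\<close>

definition ideal :: "('x list \<Rightarrow>\<^sub>0 'k::field) set \<Rightarrow> ('x list \<Rightarrow>\<^sub>0 'k) set" where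
  "ideal S = free.span {sing u * r * sing w | u r w. r \<in> S}"

lemma subspace_ideal: "free.subspace (ideal S)"
  unfolding ideal_def by (rule free.subspace_span)

lemma ideal_0 [simp]: "0 \<in> ideal S"
  by (simp add: free.subspace_0 subspace_ideal)

lemma ideal_add: "p \<in> ideal S \<Longrightarrow> q \<in> ideal S \<Longrightarrow> p + q \<in> ideal S"
  by (simp add: free.subspace_add subspace_ideal)

lemma ideal_scale: "p \<in> ideal S \<Longrightarrow> pscale c p \<in> ideal S"
  by (simp add: free.subspace_scale subspace_ideal)

lemma ideal_base: "r \<in> S \<Longrightarrow> r \<in> ideal S"
  unfolding ideal_def by (rule free.span_base) (force intro: exI[of _ "[]"] simp flip: one_eq_sing)

lemma ideal_mult_right:
  assumes "p \<in> ideal S" shows "p * q \<in> ideal S"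
proof (induction q rule: poly_mapping_induct)
  case (single w c)
  have "p * sing w \<in> ideal S"
  proof (rule plinear_span[OF plinear_mult_left[OF plinear_id] subspace_ideal _ assms[unfolded ideal_def]])
    fix x assume "x \<in> {sing u * r * sing w | u r w. r \<in> S}"
    then obtain u r v where "x = sing u * r * sing v" "r \<in> S" by blast
    then show "x * sing w \<in> ideal S"
      unfolding ideal_def
      by (intro free.span_base) (auto simp: mult.assoc sing_mult)
  qed
  from ideal_scale[OF this, of c] show ?case by (simp add: single_pscale[of w c] pscale_mult_right del: pscale_single)
qed (simp add: algebra_simps ideal_add)

lemma ideal_mult_left:
  assumes "p \<in> ideal S" shows "q * p \<in> ideal S"
proof (induction q rule: poly_mapping_induct)
  case (single w c)
  have "sing w * p \<in> ideal S"
  proof (rule plinear_span[OF plinear_mult_right[OF plinear_id] subspace_ideal _ assms[unfolded ideal_def]])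
    fix x assume "x \<in> {sing u * r * sing w | u r w. r \<in> S}"
    then obtain u r v where "x = sing u * r * sing v" "r \<in> S" by blast
    then show "sing w * x \<in> ideal S"
      unfolding ideal_def
      by (intro free.span_base) (auto simp: sing_mult simp flip: mult.assoc)
  qed
  from ideal_scale[OF this, of c] show ?case by (simp add: single_pscale[of w c] pscale_mult_left del: pscale_single)
qed (simp add: algebra_simps ideal_add)

subsection \<open>Algebra homomorphisms and odd derivations\<close>

definition hom :: "('x \<Rightarrow> ('y list \<Rightarrow>\<^sub>0 'k::field)) \<Rightarrow> ('x list \<Rightarrow>\<^sub>0 'k) \<Rightarrow> ('y list \<Rightarrow>\<^sub>0 'k)" where
  "hom d = lext (\<lambda>w. prod_list (map d w))"

lemma plinear_hom: "plinear (hom d)"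
  unfolding hom_def by (rule plinear_lext)

lemmas hom_add = plinear_add[OF plinear_hom] and hom_scale = plinear_scale[OF plinear_hom]
  and hom_0 [simp] = plinear_0[OF plinear_hom] and hom_diff = plinear_diff[OF plinear_hom]
  and hom_sum = plinear_sum[OF plinear_hom] and hom_sg = plinear_sg[OF plinear_hom]

lemma hom_single: "hom d (Poly_Mapping.single w c) = pscale c (prod_list (map d w))"
  by (simp add: hom_def)

lemma hom_sing: "hom d (sing w) = prod_list (map d w)"
  by (simp add: hom_single)

lemma hom_letter [simp]: "hom d (sing [x]) = d x"
  by (simp add: hom_sing)

lemma hom_mult: "hom d (p * q) = hom d p * hom d q"
proof (induction p rule: poly_mapping_induct)
  case (single u a)
  show ?case
  proof (induction q rule: poly_mapping_induct)
    case (single w b)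
    show ?case by (simp add: sing_mult hom_single pscale_mult_left pscale_mult_right)
  qed (simp add: distrib_left hom_add)
qed (simp add: algebra_simps hom_add)

lemma hom_1 [simp]: "hom d 1 = 1"
  by (simp add: one_eq_sing hom_sing)

lemma hom_neg: "hom d (- p) = - hom d p"
  by (rule plinear_neg[OF plinear_hom])

lemma hom_of_sg [simp]: "hom d (sg n) = sg n"
  by (simp add: sg_def hom_neg)

lemma hom_hom: "hom d (hom e p) = hom (\<lambda>x. hom d (e x)) p"
proof (rule plinear_eqI[OF plinear_compose[OF plinear_hom plinear_hom] plinear_hom])
  fix w
  show "hom d (hom e (sing w)) = hom (\<lambda>x. hom d (e x)) (sing w)"
    by (induction w) (simp_all add: hom_sing hom_mult)
qed

lemma hom_ideal:
  assumes "\<And>r. r \<in> S \<Longrightarrow> hom d r \<in> ideal T" "p \<in> ideal S"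
  shows "hom d p \<in> ideal T"
  by (rule plinear_span[OF plinear_hom subspace_ideal _ assms(2)[unfolded ideal_def]])
    (auto simp: hom_mult assms(1) ideal_mult_left ideal_mult_right)

text \<open>Telescoping: the letters are replaced one at a time, and each replacement leaves a
  factor in the ideal.\<close>

lemma hom_cong_ideal:
  assumes "\<And>x. x \<in> set w \<Longrightarrow> d x - e x \<in> ideal T"
  shows "hom d (sing w) - hom e (sing w) \<in> ideal T"
  using assms
proof (induction w)
  case Nil
  then show ?case by (simp add: hom_sing)
next
  case (Cons x w)
  have "hom d (sing (x # w)) - hom e (sing (x # w))
    = (d x - e x) * hom d (sing w) + e x * (hom d (sing w) - hom e (sing w))"
    by (simp add: hom_sing algebra_simps)
  then show ?case using Cons by (simp add: ideal_add ideal_mult_left ideal_mult_right)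
qed

text \<open>\<open>der deg k d\<close> is an odd derivation along the homomorphism \<open>hom d\<close>.\<close>

fun derw :: "('x \<Rightarrow> int) \<Rightarrow> ('x \<Rightarrow> ('y list \<Rightarrow>\<^sub>0 'k::field)) \<Rightarrow> ('x \<Rightarrow> ('y list \<Rightarrow>\<^sub>0 'k)) \<Rightarrow> 'x list \<Rightarrow> ('y list \<Rightarrow>\<^sub>0 'k)" where
  "derw deg k d [] = 0"
| "derw deg k d (x # w) = k x * hom d (sing w) + sg (deg x) * d x * derw deg k d w"

definition der :: "('x \<Rightarrow> int) \<Rightarrow> ('x \<Rightarrow> ('y list \<Rightarrow>\<^sub>0 'k::field)) \<Rightarrow> ('x \<Rightarrow> ('y list \<Rightarrow>\<^sub>0 'k)) \<Rightarrow> ('x list \<Rightarrow>\<^sub>0 'k) \<Rightarrow> ('y list \<Rightarrow>\<^sub>0 'k)" where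
  "der deg k d = lext (derw deg k d)"

text \<open>\<open>hom (parity deg)\<close> is the grading involution: it multiplies a word by -1 to
  the power of its total degree.\<close>

definition parity :: "('x \<Rightarrow> int) \<Rightarrow> 'x \<Rightarrow> ('x list \<Rightarrow>\<^sub>0 'k::field)" where
  "parity deg x = sg (deg x) * sing [x]"

lemma plinear_der: "plinear (der deg k d)"
  unfolding der_def by (rule plinear_lext)

lemmas der_add = plinear_add[OF plinear_der] and der_scale = plinear_scale[OF plinear_der]
  and der_0 [simp] = plinear_0[OF plinear_der] and der_diff = plinear_diff[OF plinear_der]
  and der_sum = plinear_sum[OF plinear_der] and der_sg = plinear_sg[OF plinear_der]

lemma der_single: "der deg k d (Poly_Mapping.single w c) = pscale c (derw deg k d w)"
  by (simp add: der_def)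

lemma der_sing: "der deg k d (sing w) = derw deg k d w"
  by (simp add: der_single)

lemma der_letter [simp]: "der deg k d (sing [x]) = k x"
  by (simp add: der_single hom_sing)

lemma der_1 [simp]: "der deg k d 1 = 0"
  by (simp add: der_sing one_eq_sing)

lemma der_of_sg [simp]: "der deg k d (sg n) = 0"
  using der_sg[of deg k d n 1] by simp

lemma hom_parity_sing: "hom d (hom (parity deg) (sing w)) = sg (\<Sum>x\<leftarrow>w. deg x) * hom d (sing w)"
  by (induction w) (simp_all add: hom_sing hom_mult parity_def hom_neg sg_def)

lemma derw_append:
  "derw deg k d (u @ w) = derw deg k d u * hom d (sing w) + hom d (hom (parity deg) (sing u)) * derw deg k d w"
proof (induction u)
  case Nil
  then show ?case by (simp flip: one_eq_sing)
next
  case (Cons x u)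
  then show ?case
    by (simp add: hom_sing hom_mult parity_def hom_sg algebra_simps)
qed

text \<open>Expressing the Leibniz sign by the grading involution gives a rule for arbitrary
  \<open>p\<close>, not only for homogeneous ones.\<close>

lemma der_mult:
  "der deg k d (p * q) = der deg k d p * hom d q + hom d (hom (parity deg) p) * der deg k d q"
proof (induction p rule: poly_mapping_induct)
  case (single u a)
  show ?case
  proof (induction q rule: poly_mapping_induct)
    case (single w b)
    have "der deg k d (Poly_Mapping.single u a * Poly_Mapping.single w b) = pscale (a * b) (derw deg k d (u @ w))"
      by (simp add: sing_mult der_single)
    then show ?case
      unfolding derw_append
      by (simp add: single_pscale[of u a] single_pscale[of w b] der_scale hom_scale der_sing pscale_mult_left
          pscale_mult_right free.scale_right_distrib mult.commute del: pscale_single)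
  qed (simp add: algebra_simps der_add hom_add)
qed (simp add: algebra_simps der_add hom_add)

text \<open>In the Leibniz rule for \<open>u * r * w\<close> the relation \<open>r\<close> also
  occurs under the grading involution; the third hypothesis takes care of that term.\<close>

lemma der_ideal:
  assumes "\<And>r. r \<in> S \<Longrightarrow> der deg k d r \<in> ideal T" "\<And>r. r \<in> S \<Longrightarrow> hom d r \<in> ideal T"
    and "\<And>r. r \<in> S \<Longrightarrow> hom (parity deg) r \<in> ideal S" "p \<in> ideal S"
  shows "der deg k d p \<in> ideal T"
proof (rule plinear_span[OF plinear_der subspace_ideal _ assms(4)[unfolded ideal_def]])
  fix x assume "x \<in> {sing u * r * sing w | u r w. r \<in> S}"
  then obtain u r w where x: "x = sing u * r * sing w" "r \<in> S" by blast
  have "hom d (hom (parity deg) r) \<in> ideal T"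
    by (rule hom_ideal[OF assms(2) assms(3)]) (use x in auto)
  have "der deg k d (sing u * r) \<in> ideal T" "hom d (hom (parity deg) (sing u * r)) \<in> ideal T"
    using x assms(1,2) \<open>hom d (hom (parity deg) r) \<in> ideal T\<close>
    by (auto simp: der_mult hom_mult intro!: ideal_add intro: ideal_mult_left)
  then show "der deg k d x \<in> ideal T"
    unfolding x(1) der_mult[of _ _ _ _ "sing w"] by (intro ideal_add ideal_mult_right)
qed

text \<open>Together with \<open>der_hom\<close>: derivations along homomorphisms stay such when
  composed with homomorphisms on either side, so identities between composites reduce to
  letters.\<close>

lemma hom_der: "hom e (der deg k d p) = der deg (\<lambda>x. hom e (k x)) (\<lambda>x. hom e (d x)) p"
proof (rule plinear_eqI[OF plinear_compose[OF plinear_hom plinear_der] plinear_der])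
  fix w
  show "hom e (der deg k d (sing w)) = der deg (\<lambda>x. hom e (k x)) (\<lambda>x. hom e (d x)) (sing w)"
    by (induction w) (simp_all add: hom_hom der_sing hom_mult hom_add hom_sg mult.assoc)
qed

text \<open>The hypothesis makes the sign for passing \<open>e x\<close> equal to the sign for
  passing the letter \<open>x\<close>.\<close>

lemma der_hom:
  assumes "\<And>x. hom d (hom (parity deg') (e x)) = sg (deg x) * hom d (e x)"
  shows "der deg' k d (hom e p) = der deg (\<lambda>x. der deg' k d (e x)) (\<lambda>x. hom d (e x)) p"
proof (rule plinear_eqI[OF plinear_compose[OF plinear_der plinear_hom] plinear_der])
  fix w
  show "der deg' k d (hom e (sing w)) = der deg (\<lambda>x. der deg' k d (e x)) (\<lambda>x. hom d (e x)) (sing w)"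
    by (induction w) (simp_all add: hom_sing der_sing der_mult assms flip: hom_hom)
qed

lemma der_add_left: "der deg (\<lambda>x. k x + k' x) d p = der deg k d p + der deg k' d p"
proof (rule plinear_eqI[OF plinear_der plinear_plus[OF plinear_der plinear_der]])
  fix w
  show "der deg (\<lambda>x. k x + k' x) d (sing w) = der deg k d (sing w) + der deg k' d (sing w)"
    by (induction w) (simp_all add: der_sing algebra_simps)
qed

section \<open>Quotients of tensor algebras\<close>

lemma subspace_rel_space: "free.subspace (rel_space V R)"
  unfolding rel_space_def by (rule free.subspace_span)

lemma rel_space_base: "r \<in> multilin_rels V \<union> R \<Longrightarrow> r \<in> rel_space V R"
  unfolding rel_space_def by (rule free.span_base)

lemmas rel_space_0 [simp] = free.subspace_0[OF subspace_rel_space]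
  and rel_space_add = free.subspace_add[OF subspace_rel_space]
  and rel_space_diff = free.subspace_diff[OF subspace_rel_space]
  and rel_space_neg = free.subspace_neg[OF subspace_rel_space]
  and rel_space_scale = free.subspace_scale[OF subspace_rel_space]
  and rel_space_sum = free.subspace_sum[OF subspace_rel_space]

lemma rel_space_sg: "p \<in> rel_space V R \<Longrightarrow> sg n * p \<in> rel_space V R"
  by (simp add: rel_space_scale flip: pscale_sg)

lemma rel_space_minus_commute: "p - q \<in> rel_space V R \<Longrightarrow> q - p \<in> rel_space V R"
  using rel_space_neg by fastforce

lemma rel_space_trans: "p - q \<in> rel_space V R \<Longrightarrow> q - r \<in> rel_space V R \<Longrightarrow> p - r \<in> rel_space V R"
  using rel_space_add by fastforce

lemma cls_eqI: "p - q \<in> rel_space V R \<Longrightarrow> cls V R p = cls V R q"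
proof -
  have "cls V R p \<subseteq> cls V R q" if "p - q \<in> rel_space V R" for p q
  proof
    fix x assume "x \<in> cls V R p"
    then obtain s where s: "s \<in> rel_space V R" "x = p + s"
      by (auto simp: cls_def elt_set_plus_def)
    then have "(p - q) + s \<in> rel_space V R" "x = q + ((p - q) + s)"
      using that by (auto intro: rel_space_add)
    then show "x \<in> cls V R q"
      unfolding cls_def elt_set_plus_def by blast
  qed
  then show "p - q \<in> rel_space V R \<Longrightarrow> cls V R p = cls V R q"
    by (meson rel_space_minus_commute subset_antisym)
qed

lemma cls_self: "p \<in> cls V R p"
  unfolding cls_def elt_set_plus_def by (auto intro: bexI[of _ 0])

lemma cls_eq_iff: "cls V R p = cls V R q \<longleftrightarrow> p - q \<in> rel_space V R"
proof
  assume "cls V R p = cls V R q"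
  then have "p \<in> cls V R q" using cls_self by metis
  then show "p - q \<in> rel_space V R" by (auto simp: cls_def elt_set_plus_def)
qed (rule cls_eqI)

lemma rel_space_plus_self: "rel_space V R + rel_space V R = rel_space V R"
  unfolding set_plus_def
  by (auto intro: rel_space_add) (metis add.right_neutral rel_space_0)

lemma cls_add: "cls V R p + cls V R q = cls V R (p + q)"
proof -
  have "cls V R p + cls V R q = (p + q) +o (rel_space V R + rel_space V R)"
    by (simp add: cls_def set_plus_rearrange)
  then show ?thesis by (simp add: rel_space_plus_self cls_def)
qed

text \<open>An operation applied elementwise to a coset may fill only part of the resulting coset,
  as scaling by 0 does; adding the relation space completes it.\<close>

lemma image_plus_eq_cls:
  assumes "A \<subseteq> cls V R p" "A \<noteq> {}"
  shows "A + rel_space V R = cls V R p"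
proof
  show "A + rel_space V R \<subseteq> cls V R p"
  proof
    fix x assume "x \<in> A + rel_space V R"
    then obtain a t where a: "a \<in> A" "t \<in> rel_space V R" "x = a + t" unfolding set_plus_def by blast
    have "a \<in> cls V R p" using a assms by blast
    then obtain s where "s \<in> rel_space V R" "a = p + s"
      by (auto simp: cls_def elt_set_plus_def)
    then have "x = p + (s + t)" "s + t \<in> rel_space V R" using a by (auto simp: add.assoc intro: rel_space_add)
    then show "x \<in> cls V R p" unfolding cls_def elt_set_plus_def by blast
  qed
  obtain a where a: "a \<in> A" using assms by blast
  then obtain s where s: "s \<in> rel_space V R" "a = p + s"
    using assms by (auto simp: cls_def elt_set_plus_def)
  show "cls V R p \<subseteq> A + rel_space V R"
  proof
    fix x assume "x \<in> cls V R p"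
    then obtain t where t: "t \<in> rel_space V R" "x = p + t"
      by (auto simp: cls_def elt_set_plus_def)
    then have "x = a + (t - s)" "t - s \<in> rel_space V R" using s by (auto intro: rel_space_diff)
    then show "x \<in> A + rel_space V R" using a unfolding set_plus_def by blast
  qed
qed

lemma cls_pscale: "pscale c ` cls V R p + rel_space V R = cls V R (pscale c p)"
proof (rule image_plus_eq_cls)
  show "pscale c ` cls V R p \<subseteq> cls V R (pscale c p)"
    by (auto simp: cls_def elt_set_plus_def free.scale_right_distrib intro: rel_space_scale)
  show "pscale c ` cls V R p \<noteq> {}" using cls_self by blast
qed

lemma scl_shift [simp]: "scl (shift V) = scl V"
  by (simp add: shift_def)

lemma gcomp_shift: "gcomp (shift V) d = gcomp V (d + 1)"
  by (simp add: shift_def)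

lemma scl_tensor_quotient [simp]: "scl (tensor_quotient V R L) c (cls V R p) = cls V R (pscale c p)"
  by (simp add: tensor_quotient_def cls_pscale)

lemma words_Nil [simp]: "[] \<in> words V"
  and words_Cons [simp]: "(d, v) # w \<in> words V \<longleftrightarrow> v \<in> gcomp V d \<and> w \<in> words V"
  and words_append [simp]: "u @ w \<in> words V \<longleftrightarrow> u \<in> words V \<and> w \<in> words V"
  by (auto simp: words_def)

lemma words_mset: "mset u = mset w \<Longrightarrow> u \<in> words V \<longleftrightarrow> w \<in> words V"
  unfolding words_def using mset_eq_setD by blast

lemma wdeg_simps [simp]: "wdeg [] = 0" "wdeg (x # w) = fst x + wdeg w" "wdeg (u @ w) = wdeg u + wdeg w"
  by (simp_all add: wdeg_def)

text \<open>The admissible representatives: their classes form the total space of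
  \<open>tensor_quotient V R L\<close>, and those of \<open>wspand V L d\<close> its component of
  degree \<open>d\<close>.\<close>

definition wspan :: "('k::field, 'v) gspace \<Rightarrow> nat set \<Rightarrow> ((int \<times> 'v) list \<Rightarrow>\<^sub>0 'k) set" where
  "wspan V L = free.span {sing w | w. w \<in> words V \<and> length w \<in> L}"

definition wspand :: "('k::field, 'v) gspace \<Rightarrow> nat set \<Rightarrow> int \<Rightarrow> ((int \<times> 'v) list \<Rightarrow>\<^sub>0 'k) set" where
  "wspand V L d = free.span {sing w | w. w \<in> words V \<and> length w \<in> L \<and> wdeg w = d}"

lemma subspace_wspan: "free.subspace (wspan V L)"
  unfolding wspan_def by (rule free.subspace_span)

lemma subspace_wspand: "free.subspace (wspand V L d)"
  unfolding wspand_def by (rule free.subspace_span)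

lemma wspan_base: "w \<in> words V \<Longrightarrow> length w \<in> L \<Longrightarrow> sing w \<in> wspan V L"
  unfolding wspan_def by (rule free.span_base) blast

lemma wspand_base: "w \<in> words V \<Longrightarrow> length w \<in> L \<Longrightarrow> sing w \<in> wspand V L (wdeg w)"
  unfolding wspand_def by (rule free.span_base) blast

lemma plinear_wspan:
  assumes "plinear F" "free.subspace T" "\<And>w. w \<in> words V \<Longrightarrow> length w \<in> L \<Longrightarrow> F (sing w) \<in> T" "p \<in> wspan V L"
  shows "F p \<in> T"
  by (rule plinear_span[OF assms(1,2) _ assms(4)[unfolded wspan_def]]) (use assms(3) in blast)

lemma wspan_single: "w \<in> words V \<Longrightarrow> length w \<in> L \<Longrightarrow> Poly_Mapping.single w c \<in> wspan V L"
  unfolding single_pscale[of w c] by (intro free.subspace_scale subspace_wspan wspan_base)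

lemma wspand_single: "w \<in> words V \<Longrightarrow> length w \<in> L \<Longrightarrow> wdeg w = d \<Longrightarrow> Poly_Mapping.single w c \<in> wspand V L d"
  unfolding single_pscale[of w c] by (intro free.subspace_scale subspace_wspand) (auto intro: wspand_base)

lemma wspand_subset: "wspand V L d \<subseteq> wspan V L"
  unfolding wspan_def wspand_def by (rule free.span_mono) blast

lemma wspan_mono: "L \<subseteq> L' \<Longrightarrow> wspan V L \<subseteq> wspan V L'"
  unfolding wspan_def by (rule free.span_mono) blast

lemma gcomp_tensor_quotient: "gcomp (tensor_quotient V R L) d = cls V R ` wspand V L d"
  by (simp add: tensor_quotient_def wspand_def)

lemma total_tensor_quotient: "total (tensor_quotient V R L) = cls V R ` wspan V L" (is "?T = _")
proof
  show "?T \<subseteq> cls V R ` wspan V L"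
  proof
    fix x assume "x \<in> ?T"
    then show "x \<in> cls V R ` wspan V L"
    proof induction
      case (1 x d)
      then show ?case using wspand_subset by (fastforce simp: gcomp_tensor_quotient)
    next
      case (2 x y)
      then show ?case using free.subspace_add[OF subspace_wspan] by (fastforce simp: cls_add)
    qed
  qed
  have "p \<in> wspan V L \<Longrightarrow> cls V R p \<in> ?T" for p
    unfolding wspan_def
  proof (induction rule: free.span_induct_alt)
    case base
    show ?case
      \<comment> \<open>The zero class lies in every component; degree 0 is an arbitrary
        choice.\<close>
      by (rule total.intros(1)[of _ _ 0])
        (simp add: gcomp_tensor_quotient free.subspace_0 subspace_wspand)
  next
    case (step c x y)
    then obtain w where w: "w \<in> words V" "length w \<in> L" "x = sing w" by blast
    have "cls V R (pscale c x) \<in> ?T"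
      by (rule total.intros(1)[of _ _ "wdeg w"])
        (use w in \<open>auto simp: gcomp_tensor_quotient intro: wspand_single\<close>)
    then show ?case using step.IH total.intros(2) by (fastforce simp flip: cls_add)
  qed
  then show "cls V R ` wspan V L \<subseteq> ?T" by blast
qed

subsection \<open>Linear extensions\<close>

text \<open>Turns the \<open>THE\<close> into a computation rule. A linear map of representatives
  that preserves relations descends to classes, and any other candidate agrees with it because the
  elements \<open>g i\<close> span modulo relations.\<close>

lemma linear_extension_cls:
  fixes g :: "'i \<Rightarrow> ((int \<times> 'v::plus) list \<Rightarrow>\<^sub>0 'k::field)" and h :: "'i \<Rightarrow> ((int \<times> 'w::plus) list \<Rightarrow>\<^sub>0 'k)"
  assumes F: "plinear F"
    and F_rel: "\<And>p. p \<in> rel_space V R \<Longrightarrow> F p \<in> rel_space W R'"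
    and F_span: "\<And>p. p \<in> wspan V L \<Longrightarrow> F p \<in> wspan W L'"
    and g: "\<And>i. i \<in> I \<Longrightarrow> g i \<in> wspan V L"
    and gh: "\<And>i. i \<in> I \<Longrightarrow> F (g i) - h i \<in> rel_space W R'"
    and gen: "\<And>p. p \<in> wspan V L \<Longrightarrow> \<exists>q \<in> free.span (g ` I). p - q \<in> rel_space V R"
    and \<Gamma>: "\<Gamma> = (\<lambda>i. (cls V R (g i), cls W R' (h i))) ` I"
  shows "p \<in> wspan V L \<Longrightarrow>
      linear_extension (tensor_quotient V R L) (tensor_quotient W R' L') \<Gamma> (cls V R p) = cls W R' (F p)"
    and "glinear (tensor_quotient V R L) (tensor_quotient W R' L')
      (linear_extension (tensor_quotient V R L) (tensor_quotient W R' L') \<Gamma>)"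
proof -
  let ?V = "tensor_quotient V R L" and ?W = "tensor_quotient W R' L'"
  \<comment> \<open>The value is read off an arbitrary admissible representative, which is harmless
    by \<open>F_rel\<close>; the restriction is what \<open>extensional\<close> demands.\<close>
  define f where "f = restrict (\<lambda>x. cls W R' (F (SOME p. p \<in> wspan V L \<and> x = cls V R p))) (total ?V)"
  have f: "f (cls V R p) = cls W R' (F p)" if "p \<in> wspan V L" for p
  proof -
    define q where "q = (SOME q. q \<in> wspan V L \<and> cls V R p = cls V R q)"
    have "q \<in> wspan V L \<and> cls V R p = cls V R q"
      unfolding q_def by (rule someI[of _ p]) (use that in auto)
    then have "F (q - p) \<in> rel_space W R'" by (metis F_rel cls_eq_iff)
    then have "cls W R' (F q) = cls W R' (F p)" by (simp add: cls_eq_iff plinear_diff[OF F])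
    then show ?thesis using that unfolding f_def q_def by (simp add: total_tensor_quotient)
  qed
  have lin: "glinear ?V ?W f"
    unfolding glinear_def total_tensor_quotient
    by (auto simp: f cls_add F_span plinear_add[OF F] plinear_scale[OF F]
        free.subspace_add[OF subspace_wspan] free.subspace_scale[OF subspace_wspan])
  have gamma: "\<forall>(x, y) \<in> \<Gamma>. f x = y"
    using g gh by (auto simp: \<Gamma> f cls_eq_iff)
  have uniq: "f' = f" if f': "f' \<in> extensional (total ?V)" "glinear ?V ?W f'" "\<forall>(x, y) \<in> \<Gamma>. f' x = y" for f'
  proof -
    have lin_f': "f' (x + y) = f' x + f' y" "f' (scl ?V c x) = scl ?W c (f' x)" "f' x \<in> total ?W"
      if "x \<in> total ?V" "y \<in> total ?V" for x y c
      using f'(2) that unfolding glinear_def by auto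
    have on_gen: "q \<in> wspan V L \<and> f' (cls V R q) = cls W R' (F q)" if "q \<in> free.span (g ` I)" for q
      using that
    proof (induction rule: free.span_induct_alt)
      case base
      have z: "0 \<in> wspan V L" by (simp add: free.subspace_0 subspace_wspan)
      then have tot: "cls V R 0 \<in> total ?V" by (auto simp: total_tensor_quotient)
      then obtain r where r: "f' (cls V R 0) = cls W R' r"
        using lin_f'(3) by (fastforce simp: total_tensor_quotient)
      \<comment> \<open>The zero class is the relation space and not the \<open>0\<close> of the
        type of sets, so its image is found by scaling with 0.\<close>
      have "f' (cls V R 0) = f' (scl ?V 0 (cls V R 0))" by simp
      also have "\<dots> = cls W R' 0"
        using lin_f'(2)[OF tot tot, of 0] by (simp add: r)
      finally show ?case using z by (simp add: plinear_0[OF F])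
    next
      case (step c x y)
      then obtain i where i: "i \<in> I" "x = g i" by blast
      have x: "x \<in> wspan V L" using i g by simp
      have "f' (cls V R x) = f (cls V R x)"
        using f'(3) gamma i by (fastforce simp: \<Gamma>)
      then have fx: "f' (cls V R x) = cls W R' (F x)" using f x by simp
      have tot: "cls V R x \<in> total ?V" "cls V R y \<in> total ?V"
        "cls V R (pscale c x) \<in> total ?V"
        using x step.IH by (auto simp: total_tensor_quotient free.subspace_scale[OF subspace_wspan])
      have "f' (cls V R (pscale c x + y)) = f' (scl ?V c (cls V R x) + cls V R y)"
        by (simp add: cls_add)
      also have "\<dots> = cls W R' (F (pscale c x + y))"
        using tot fx step.IH lin_f'(2)[OF tot(1,1)] lin_f'(1)[OF tot(3,2)]
        by (simp add: cls_add plinear_add[OF F] plinear_scale[OF F])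
      finally show ?case
        using x step.IH by (simp add: free.subspace_add[OF subspace_wspan] free.subspace_scale[OF subspace_wspan])
    qed
    show ?thesis
    proof (rule extensionalityI[OF f'(1)])
      show "f \<in> extensional (total ?V)" by (simp add: f_def)
      fix x assume "x \<in> total ?V"
      then obtain p where p: "p \<in> wspan V L" "x = cls V R p" by (auto simp: total_tensor_quotient)
      obtain q where q: "q \<in> free.span (g ` I)" "p - q \<in> rel_space V R" using gen p by blast
      then show "f' x = f x" using on_gen[OF q(1)] p by (metis cls_eq_iff f)
    qed
  qed
  have eq: "linear_extension ?V ?W \<Gamma> = f"
    unfolding linear_extension_def
    by (rule the_equality) (use lin gamma uniq in \<open>auto simp: f_def\<close>)
  show "p \<in> wspan V L \<Longrightarrow> linear_extension ?V ?W \<Gamma> (cls V R p) = cls W R' (F p)"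
    by (simp add: eq f)
  show "glinear ?V ?W (linear_extension ?V ?W \<Gamma>)" by (simp add: eq lin)
qed

subsection \<open>Relations\<close>

text \<open>The closure properties that can be stated for quotients as well, whose ambient type of
  cosets is not a group.\<close>

definition gclosed :: "('k::field, 'v::plus) gspace \<Rightarrow> bool" where
  "gclosed V \<longleftrightarrow> (\<forall>d. \<forall>x \<in> gcomp V d. (\<forall>y \<in> gcomp V d. x + y \<in> gcomp V d) \<and> (\<forall>c. scl V c x \<in> gcomp V d))"

lemma gclosedD:
  assumes "gclosed V" "x \<in> gcomp V d"
  shows "y \<in> gcomp V d \<Longrightarrow> x + y \<in> gcomp V d" "scl V c x \<in> gcomp V d"
  using assms by (auto simp: gclosed_def)

lemma gclosed_tensor_quotient: "gclosed (tensor_quotient V R L)"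
  by (auto simp: gclosed_def gcomp_tensor_quotient cls_add
      intro!: imageI free.subspace_add[OF subspace_wspand] free.subspace_scale[OF subspace_wspand])

lemma gclosed_shift: "gclosed V \<Longrightarrow> gclosed (shift V)"
  by (auto simp: gclosed_def gcomp_shift)

lemma multilin_rels_cases [consumes 1, case_names add scale]:
  assumes "r \<in> multilin_rels V"
  obtains u w d x y where "r = sing (u @ (d, x + y) # w) - sing (u @ (d, x) # w) - sing (u @ (d, y) # w)"
      "u \<in> words V" "w \<in> words V" "x \<in> gcomp V d" "y \<in> gcomp V d"
  | u w d x c where "r = sing (u @ (d, scl V c x) # w) - pscale c (sing (u @ (d, x) # w))"
      "u \<in> words V" "w \<in> words V" "x \<in> gcomp V d"
  using assms unfolding multilin_rels_def by (auto; blast)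

lemma multilin_add:
  "u \<in> words V \<Longrightarrow> w \<in> words V \<Longrightarrow> x \<in> gcomp V d \<Longrightarrow> y \<in> gcomp V d \<Longrightarrow>
    sing (u @ (d, x + y) # w) - sing (u @ (d, x) # w) - sing (u @ (d, y) # w) \<in> multilin_rels V"
  unfolding multilin_rels_def by blast

lemma multilin_scale:
  "u \<in> words V \<Longrightarrow> w \<in> words V \<Longrightarrow> x \<in> gcomp V d \<Longrightarrow>
    sing (u @ (d, scl V c x) # w) - pscale c (sing (u @ (d, x) # w)) \<in> multilin_rels V"
  unfolding multilin_rels_def by simp blast

lemma multilin_rels_mult:
  assumes "r \<in> multilin_rels V" "u \<in> words V" "w \<in> words V"
  shows "sing u * r * sing w \<in> multilin_rels V"
  using assms(1)
proof (cases rule: multilin_rels_cases)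
  case (add u' w' d x y)
  then show ?thesis
    using multilin_add[of "u @ u'" V "w' @ w" x d y] assms
    by (simp add: left_diff_distrib right_diff_distrib sing_mult)
next
  case (scale u' w' d x c)
  then show ?thesis
    using multilin_scale[of "u @ u'" V "w' @ w" x d c] assms
    by (simp add: left_diff_distrib right_diff_distrib sing_mult)
qed

lemma comm_relI:
  "u \<in> words V \<Longrightarrow> w \<in> words V \<Longrightarrow> x \<in> gcomp V a \<Longrightarrow> y \<in> gcomp V b \<Longrightarrow>
    sing (u @ [(a, x), (b, y)] @ w) - Poly_Mapping.single (u @ [(b, y), (a, x)] @ w) ((-1) powi (a * b)) \<in> comm_rels V"
  unfolding comm_rels_def by blast

lemma comm_rels_mult:
  assumes "r \<in> comm_rels V" "u \<in> words V" "w \<in> words V"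
  shows "sing u * r * sing w \<in> comm_rels V"
proof -
  obtain u' w' a x b y where r: "r = sing (u' @ [(a, x), (b, y)] @ w')
        - Poly_Mapping.single (u' @ [(b, y), (a, x)] @ w') ((-1) powi (a * b))"
      "u' \<in> words V" "w' \<in> words V" "x \<in> gcomp V a" "y \<in> gcomp V b"
    using assms(1) unfolding comm_rels_def by blast
  have "sing u * r * sing w = sing ((u @ u') @ [(a, x), (b, y)] @ (w' @ w))
        - Poly_Mapping.single ((u @ u') @ [(b, y), (a, x)] @ (w' @ w)) ((-1) powi (a * b))"
    by (simp add: r left_diff_distrib right_diff_distrib sing_mult)
  then show ?thesis
    using comm_relI[of "u @ u'" V "w' @ w" x a y b] r assms by simp
qed

text \<open>Relations are imposed only in contexts from \<open>words V\<close>, so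
  \<open>rel_space\<close> need not be an ideal of the whole free algebra. Under this condition it
  absorbs products with elements of \<open>wspan\<close>.\<close>

definition word_stable where
  "word_stable V R \<longleftrightarrow> (\<forall>r\<in>R. \<forall>u\<in>words V. \<forall>w\<in>words V. sing u * r * sing w \<in> R)"

lemma word_stable_empty: "word_stable V {}"
  by (simp add: word_stable_def)

lemma word_stable_comm_rels: "word_stable V (comm_rels V)"
  by (simp add: word_stable_def comm_rels_mult)

lemma rel_space_mult_words:
  assumes "word_stable V R" "p \<in> rel_space V R" "u \<in> words V" "w \<in> words V"
  shows "sing u * p * sing w \<in> rel_space V R"
proof (rule plinear_span[OF plinear_mult_left[OF plinear_mult_right[OF plinear_id]] subspace_rel_space
    _ assms(2)[unfolded rel_space_def]])
  fix r assume "r \<in> multilin_rels V \<union> R"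
  then show "sing u * r * sing w \<in> rel_space V R"
    using assms multilin_rels_mult unfolding word_stable_def by (blast intro: rel_space_base)
qed

lemma rel_space_mult_left:
  assumes "word_stable V R" "p \<in> rel_space V R" "q \<in> wspan V L"
  shows "q * p \<in> rel_space V R"
proof (rule plinear_wspan[OF plinear_mult_left[OF plinear_id] subspace_rel_space _ assms(3)])
  fix w assume "w \<in> words V"
  then show "sing w * p \<in> rel_space V R"
    using rel_space_mult_words[OF assms(1,2) _ words_Nil] by (auto simp flip: one_eq_sing)
qed

lemma rel_space_mult_right:
  assumes "word_stable V R" "p \<in> rel_space V R" "q \<in> wspan V L"
  shows "p * q \<in> rel_space V R"
proof (rule plinear_wspan[OF plinear_mult_right[OF plinear_id] subspace_rel_space _ assms(3)])
  fix w assume "w \<in> words V"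
  then show "p * sing w \<in> rel_space V R"
    using rel_space_mult_words[OF assms(1,2) words_Nil] by (auto simp flip: one_eq_sing)
qed

lemma wspan_mult:
  assumes "p \<in> wspan V L" "q \<in> wspan V L'" "\<And>m n. m \<in> L \<Longrightarrow> n \<in> L' \<Longrightarrow> m + n \<in> M"
  shows "p * q \<in> wspan V M"
proof (rule plinear_wspan[OF plinear_mult_left[OF plinear_id] subspace_wspan _ assms(1)])
  fix u assume u: "u \<in> words V" "length u \<in> L"
  show "sing u * q \<in> wspan V M"
    by (rule plinear_wspan[OF plinear_mult_right[OF plinear_id] subspace_wspan _ assms(2)])
      (use u assms(3) in \<open>auto simp: sing_mult intro!: wspan_base\<close>)
qed

text \<open>For products of cosets: the error terms of the factors are thereby admissible cofactors
  themselves.\<close>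

lemma rel_space_empty_subset_wspan:
  assumes "gclosed V" "p \<in> rel_space V {}" shows "p \<in> wspan V UNIV"
proof (rule plinear_span[OF plinear_id subspace_wspan _ assms(2)[unfolded rel_space_def]])
  fix r assume "r \<in> multilin_rels V \<union> {}"
  then have "r \<in> multilin_rels V" by simp
  then show "r \<in> wspan V UNIV"
    by (cases rule: multilin_rels_cases)
      (auto intro!: free.subspace_diff[OF subspace_wspan] wspan_single simp: gclosedD[OF assms(1)])
qed

lemma tensor_mult_cls:
  assumes "gclosed V" "p \<in> wspan V L" "q \<in> wspan V L'"
  shows "tensor_mult V (cls V {} p) (cls V {} q) = cls V {} (p * q)"
  unfolding tensor_mult_def
proof (rule image_plus_eq_cls)
  show "{concat_free p' q' |p' q'. p' \<in> cls V {} p \<and> q' \<in> cls V {} q} \<subseteq> cls V {} (p * q)"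
  proof clarify
    fix p' q' assume "p' \<in> cls V {} p" "q' \<in> cls V {} q"
    then obtain s t where st: "s \<in> rel_space V {}" "p' = p + s" "t \<in> rel_space V {}" "q' = q + t"
      by (auto simp: cls_def elt_set_plus_def)
    have "s * q \<in> rel_space V {}" "p * t \<in> rel_space V {}" "s * t \<in> rel_space V {}"
      using st assms rel_space_empty_subset_wspan[OF assms(1)]
      by (auto intro: rel_space_mult_left rel_space_mult_right word_stable_empty)
    then have "s * q + p * t + s * t \<in> rel_space V {}" by (intro rel_space_add)
    moreover have "concat_free p' q' = p * q + (s * q + p * t + s * t)"
      by (simp add: concat_free_eq st algebra_simps)
    ultimately show "concat_free p' q' \<in> cls V {} (p * q)"
      unfolding cls_def elt_set_plus_def by blast
  qed
qed (use cls_self in blast)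

text \<open>The word containing the letter \<open>(d, h p)\<close> depends linearly on
  \<open>p\<close> only modulo the multilinearity relations. Hence agreement with a linear
  \<open>F\<close> on a spanning set extends to the span modulo relations.\<close>

lemma single_linear_letter:
  assumes "plinear F" "u \<in> words V" "w \<in> words V"
    and F: "\<And>b. b \<in> B \<Longrightarrow> F b - sing (u @ (d, h b) # w) \<in> rel_space V R"
    and h: "\<And>p. p \<in> free.span B \<Longrightarrow> h p \<in> gcomp V d"
    and h_add: "\<And>p q. h (p + q) = h p + h q"
    and h_scale: "\<And>c p. p \<in> free.span B \<Longrightarrow> h (pscale c p) = scl V c (h p)"
    and "p \<in> free.span B"
  shows "F p - sing (u @ (d, h p) # w) \<in> rel_space V R"
proof -
  have "p \<in> free.span B \<and> F p - sing (u @ (d, h p) # w) \<in> rel_space V R"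
    using assms(8)
  proof (induction rule: free.span_induct_alt)
  case base
  \<comment> \<open>A letter of the form \<open>scl V 0 x\<close> makes the whole word a
    relation.\<close>
  have "h 0 = scl V 0 (h 0)" using h_scale[of 0 0] by (simp add: free.span_zero)
  then have "sing (u @ (d, h 0) # w) \<in> multilin_rels V"
    using multilin_scale[OF assms(2,3) h[OF free.span_zero], of 0] by simp
  then show ?case by (simp add: plinear_0[OF assms(1)] rel_space_neg rel_space_base free.span_zero)
next
  case (step c x y)
  note s = free.span_base[OF step.hyps(1)]
  have "F (pscale c x + y) - sing (u @ (d, h (pscale c x + y)) # w)
    = pscale c (F x - sing (u @ (d, h x) # w)) + (F y - sing (u @ (d, h y) # w))
      - (sing (u @ (d, scl V c (h x)) # w) - pscale c (sing (u @ (d, h x) # w)))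
      - (sing (u @ (d, scl V c (h x) + h y) # w) - sing (u @ (d, scl V c (h x)) # w) - sing (u @ (d, h y) # w))"
    using s by (simp add: plinear_add[OF assms(1)] plinear_scale[OF assms(1)] h_add h_scale
        free.scale_right_diff_distrib del: pscale_single)
  moreover have "pscale c (F x - sing (u @ (d, h x) # w)) \<in> rel_space V R"
    by (intro rel_space_scale F step.hyps)
  moreover have "sing (u @ (d, scl V c (h x)) # w) - pscale c (sing (u @ (d, h x) # w)) \<in> rel_space V R"
    by (intro rel_space_base UnI1 multilin_scale assms h s)
  moreover have "scl V c (h x) \<in> gcomp V d" using h[OF free.span_scale[OF s]] h_scale[OF s] by metis
  then have "sing (u @ (d, scl V c (h x) + h y) # w) - sing (u @ (d, scl V c (h x)) # w) - sing (u @ (d, h y) # w) \<in> rel_space V R"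
    by (intro rel_space_base UnI1 multilin_add assms h conjunct1[OF step.IH])
  ultimately show ?case
    using step.IH s by (simp only: rel_space_add rel_space_diff free.span_add free.span_scale)
  qed
  then show ?thesis ..
qed

lemma sing_zero_letter:
  assumes "u \<in> words V" "w \<in> words V" "x \<in> gcomp V d"
  shows "sing (u @ (d, scl V 0 x) # w) \<in> rel_space V R"
  using multilin_scale[OF assms, of 0] by (simp add: rel_space_base)

section \<open>The identities in the free algebra\<close>

text \<open>
  A letter \<open>(i, w)\<close> stands for the element of \<open>\<H>[1]\<close> represented by \<open>w\<close>, placed in the \<open>i\<close>-th tensor factor
  of \<open>S(\<H>[1]) \<otimes> \<dots> \<otimes> S(\<H>[1])\<close>.  As letters of different factors may be interleaved arbitrarily, the
  operations below preserve the order of the letters, and no Koszul sign occurs.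
\<close>

type_synonym 'g slotted = "nat \<times> (int \<times> 'g) list"

definition lt :: "nat \<Rightarrow> (int \<times> 'g) list \<Rightarrow> ('g slotted list \<Rightarrow>\<^sub>0 'k::field)" where
  "lt i w = sing [(i, w)]"

definition ldeg :: "'g slotted \<Rightarrow> int" where
  "ldeg x = xdeg (snd x)"

text \<open>The value of \<kappa> on a letter, with the two pieces put into factors \<open>i\<close>
  and \<open>j\<close>. The unshifted degree \<open>wdeg\<close> of the left piece is the exponent u
  + 1.\<close>

definition cobr :: "nat \<Rightarrow> nat \<Rightarrow> (int \<times> 'g) list \<Rightarrow> ('g slotted list \<Rightarrow>\<^sub>0 'k::field)" where
  "cobr i j w = (\<Sum>m\<in>{0<..<length w}. sg (wdeg (take m w)) *
     (lt i (take m w) * lt j (drop m w) + lt j (take m w) * lt i (drop m w)))"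

text \<open>Operations are encoded by tables. \<open>E i\<close> lists the factors into which a
  letter of factor \<open>i\<close> is copied, the empty list killing it; the table \<open>K\<close>
  of \<open>klt\<close> lists the pairs of factors into which it is cut.\<close>

definition dlt :: "(nat \<Rightarrow> nat list) \<Rightarrow> 'g slotted \<Rightarrow> ('g slotted list \<Rightarrow>\<^sub>0 'k::field)" where
  "dlt E x = (\<Sum>j\<leftarrow>E (fst x). lt j (snd x))"

definition klt :: "(nat \<Rightarrow> (nat \<times> nat) list) \<Rightarrow> 'g slotted \<Rightarrow> ('g slotted list \<Rightarrow>\<^sub>0 'k::field)" where
  "klt K x = (\<Sum>(i, j)\<leftarrow>K (fst x). cobr i j (snd x))"

abbreviation "sder K E \<equiv> der ldeg (klt K) (dlt E)"
abbreviation "shom E \<equiv> hom (dlt E)"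

text \<open>The tables with index l describe \<kappa> \<otimes> id, where factor 1 has to become
  factor 2. Those with index r describe id \<otimes> \<kappa>, and \<open>E\<^sub>r\<close> alone
  describes id \<otimes> \<Delta>.\<close>

abbreviation (input) "E\<^sub>\<Delta> \<equiv> (\<lambda>i::nat. if i = 0 then [0, 1] else [])"
abbreviation (input) "K\<^sub>\<kappa> \<equiv> (\<lambda>i::nat. if i = 0 then [(0, 1)] else [])"
abbreviation (input) "E\<^sub>l \<equiv> (\<lambda>i::nat. if i = 0 then [0, 1] else if i = 1 then [2] else [])"
abbreviation (input) "K\<^sub>l \<equiv> (\<lambda>i::nat. if i = 0 then [(0, 1)] else [])"
abbreviation (input) "E\<^sub>r \<equiv> (\<lambda>i::nat. if i = 0 then [0] else if i = 1 then [1, 2] else [])"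
abbreviation (input) "K\<^sub>r \<equiv> (\<lambda>i::nat. if i = 1 then [(1, 2)] else [])"
abbreviation (input) "T12 \<equiv> (\<lambda>i::nat. if i = 0 then [1] else if i = 1 then [0] else if i = 2 then [2] else [])"
abbreviation (input) "T23 \<equiv> (\<lambda>i::nat. if i = 0 then [0] else if i = 1 then [2] else if i = 2 then [1] else [])"

lemma shom_lt [simp]: "shom E (lt i w) = (\<Sum>j\<leftarrow>E i. lt j w)"
  by (simp add: lt_def dlt_def)

lemma hom_parity_lt [simp]: "hom (parity ldeg) (lt i w) = sg (xdeg w) * lt i w"
  by (simp add: lt_def parity_def ldeg_def)

lemma sder_lt [simp]: "sder K E (lt i w) = (\<Sum>(p, q)\<leftarrow>K i. cobr p q w)"
  by (simp add: lt_def klt_def)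

lemma cobr_commute: "cobr i j w = cobr j i w"
  by (simp add: cobr_def add.commute)

lemma hom_sum_list: "hom d (\<Sum>x\<leftarrow>xs. f x) = (\<Sum>x\<leftarrow>xs. hom d (f x))"
  by (induction xs) (simp_all add: hom_add)

text \<open>The two pieces lose the shift by one twice, the whole word only once.\<close>

lemma xdeg_take_drop: "sg (xdeg (take m w)) * sg (xdeg (drop m w)) = (- sg (xdeg w) :: 'r::ring_1)"
proof -
  have "xdeg w = wdeg (take m w) + wdeg (drop m w) - 1"
    by (metis append_take_drop_id wdeg_simps(3) xdeg_def)
  then show ?thesis by (simp add: xdeg_def sg_def)
qed

lemma lt_sg: "lt i w * (sg n * p) = sg n * (lt i w * p)"
  by (simp add: sg_def)

lemma hom_parity_cobr:
  fixes w :: "(int \<times> 'b) list"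
  shows "(hom (parity ldeg) (cobr i j w) :: 'b slotted list \<Rightarrow>\<^sub>0 'a::field) = - sg (xdeg w) * cobr i j w"
proof -
  have *: "hom (parity ldeg) (lt i (take m w) * lt j (drop m w)) = - sg (xdeg w) * (lt i (take m w) * lt j (drop m w))" for i j m
  proof -
    have "hom (parity ldeg) (lt i (take m w) * lt j (drop m w))
        = (sg (xdeg (take m w)) * sg (xdeg (drop m w))) * (lt i (take m w) * lt j (drop m w))"
      by (simp add: hom_mult mult.assoc lt_sg)
    then show ?thesis by (simp only: xdeg_take_drop)
  qed
  have "sg m * (- sg n * x + - sg n * y) = - sg n * (sg m * (x + y))" for m n and x y :: "'b slotted list \<Rightarrow>\<^sub>0 'a"
    by (simp add: sg_def)
  then show ?thesis
    unfolding cobr_def hom_sum hom_mult[of _ "sg _"] hom_of_sg hom_add * by (simp only: sum_distrib_left)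
qed

lemma hom_parity_dlt: "hom (parity ldeg) (dlt E x) = sg (ldeg x) * dlt E x"
  by (simp add: dlt_def hom_sum_list sum_list_const_mult ldeg_def)

lemma hom_parity_dlt': "hom d (hom (parity ldeg) (dlt E x)) = sg (ldeg x) * hom d (dlt E x)"
  by (simp add: hom_parity_dlt hom_sg)

lemma hom_parity_klt: "hom (parity ldeg) (klt K x) = - sg (ldeg x) * klt K x"
  by (simp add: klt_def hom_sum_list case_prod_beta hom_parity_cobr ldeg_def flip: sum_list_const_mult)

lemmas sder_shom = der_hom[OF hom_parity_dlt']

text \<open>Relabelling and copying act on each piece separately, hence commute with
  cutting.\<close>

lemma shom_cobr: "shom E (cobr i j w) = (\<Sum>p\<leftarrow>E i. \<Sum>q\<leftarrow>E j. cobr p q w)"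
proof -
  have sum_swap: "(\<Sum>x\<leftarrow>xs. sum (f x) A) = (\<Sum>a\<in>A. \<Sum>x\<leftarrow>xs. f x a)" for xs and A and f :: "_ \<Rightarrow> _ \<Rightarrow> 'c slotted list \<Rightarrow>\<^sub>0 'd::field"
    by (induction xs) (simp_all add: sum.distrib)
  have sum_prod: "(\<Sum>x\<leftarrow>xs. f x) * (\<Sum>y\<leftarrow>ys. g y) = (\<Sum>x\<leftarrow>xs. \<Sum>y\<leftarrow>ys. f x * g y)"
    for xs ys and f g :: "_ \<Rightarrow> 'c slotted list \<Rightarrow>\<^sub>0 'd::field"
    by (simp add: sum_list_mult_const sum_list_const_mult)
  have sum_comm: "(\<Sum>y\<leftarrow>ys. \<Sum>x\<leftarrow>xs. g x y) = (\<Sum>x\<leftarrow>xs. \<Sum>y\<leftarrow>ys. g x y)"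
    for xs ys and g :: "_ \<Rightarrow> _ \<Rightarrow> 'c slotted list \<Rightarrow>\<^sub>0 'd::field"
    by (induction xs) (simp_all add: sum_list_addf)
  have "shom E (cobr i j w) = (\<Sum>m\<in>{0<..<length w}. sg (wdeg (take m w)) *
      ((\<Sum>p\<leftarrow>E i. \<Sum>q\<leftarrow>E j. lt p (take m w) * lt q (drop m w)) + (\<Sum>q\<leftarrow>E j. \<Sum>p\<leftarrow>E i. lt q (take m w) * lt p (drop m w))))"
    unfolding cobr_def hom_sum hom_mult hom_of_sg hom_add shom_lt sum_prod ..
  also have "\<dots> = (\<Sum>m\<in>{0<..<length w}. \<Sum>p\<leftarrow>E i. \<Sum>q\<leftarrow>E j. sg (wdeg (take m w)) *
      (lt p (take m w) * lt q (drop m w) + lt q (take m w) * lt p (drop m w)))"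
    unfolding sum_comm[of "\<lambda>p q. lt q (take _ w) * lt p (drop _ w)" "E i" "E j"]
    by (simp add: sum_list_addf sum_list_const_mult)
  finally show ?thesis by (simp add: cobr_def sum_swap)
qed

abbreviation (input) "E\<^sub>3 \<equiv> (\<lambda>i::nat. if i = 0 then [0, 1, 2] else [])"
abbreviation (input) "K\<^sub>3 p q \<equiv> (\<lambda>i::nat. if i = 0 then [(p, q)] else [])"

text \<open>Both sides are derivations along the threefold diagonal \<open>E\<^sub>3\<close>. On a
  letter each of them is the cobracket in factors 0, 1 plus that in factors 0, 2; on the right the
  latter arises from factors 1, 2 by the flip.\<close>

lemma coLeibniz_free:
  "shom E\<^sub>r (sder K\<^sub>\<kappa> E\<^sub>\<Delta> p) =
    sder K\<^sub>l E\<^sub>l (shom E\<^sub>\<Delta> p) + shom T12 (sder K\<^sub>r E\<^sub>r (shom E\<^sub>\<Delta> p))"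
proof -
  have l: "(\<lambda>x. shom E\<^sub>r (dlt E\<^sub>\<Delta> x)) = dlt E\<^sub>3" and l': "(\<lambda>x. shom E\<^sub>l (dlt E\<^sub>\<Delta> x)) = dlt E\<^sub>3"
    and l'': "(\<lambda>x. shom T12 (dlt E\<^sub>3 x)) = dlt E\<^sub>3"
    by (auto simp: dlt_def fun_eq_iff hom_add algebra_simps)
  have k: "(\<lambda>x. shom E\<^sub>r (klt K\<^sub>\<kappa> x)) = (\<lambda>x. klt (K\<^sub>3 0 1) x + klt (K\<^sub>3 0 2) x)"
    by (auto simp: klt_def fun_eq_iff shom_cobr)
  have k': "(\<lambda>x. sder K\<^sub>l E\<^sub>l (dlt E\<^sub>\<Delta> x)) = klt (K\<^sub>3 0 1)" "(\<lambda>x. sder K\<^sub>r E\<^sub>r (dlt E\<^sub>\<Delta> x)) = klt (K\<^sub>3 1 2)"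
    by (auto simp: klt_def dlt_def fun_eq_iff der_add)
  have k'': "(\<lambda>x. shom T12 (klt (K\<^sub>3 1 2) x)) = klt (K\<^sub>3 0 2)"
    by (auto simp: klt_def fun_eq_iff shom_cobr)
  show ?thesis
    by (simp only: hom_der sder_shom l l' l'' k k' k'' der_add_left)
qed

text \<open>Cutting twice leaves three pieces. The terms with plus cut the left piece again, those
  with minus the right piece; in the latter the uncut left piece stands in factor 2.\<close>

lemma ksplit3:
  fixes w :: "(int \<times> 'g) list"
  shows "(sder K\<^sub>l E\<^sub>l (klt K\<^sub>\<kappa> (0, w)) :: 'g slotted list \<Rightarrow>\<^sub>0 'k::field) =
    (\<Sum>b\<in>{0<..<length w}. \<Sum>a\<in>{0<..<b}. sg (wdeg (drop a (take b w))) *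
      (lt 0 (take a w) * lt 1 (drop a (take b w)) * lt 2 (drop b w)
       + lt 1 (take a w) * lt 0 (drop a (take b w)) * lt 2 (drop b w)
       - lt 2 (take a w) * lt 0 (drop a (take b w)) * lt 1 (drop b w)
       - lt 2 (take a w) * lt 1 (drop a (take b w)) * lt 0 (drop b w)))"
  (is "_ = (\<Sum>b\<in>?I. \<Sum>a\<in>?J b. ?s a b * (?f 0 1 2 a b + ?f 1 0 2 a b - ?f 2 0 1 a b - ?f 2 1 0 a b))")
proof -
  have 1: "sg (wdeg (take b w)) * (cobr 0 1 (take b w) * lt 2 (drop b w))
      = (\<Sum>a\<in>?J b. ?s a b * (?f 0 1 2 a b + ?f 1 0 2 a b))" if "b \<in> ?I" for b
  proof -
    \<comment> \<open>The prefix \<open>take a w\<close> is counted in both signs, so only the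
      degree of the middle piece survives.\<close>
    have "sg (wdeg (take b w)) * (sg (wdeg (take a w)) * x) = ?s a b * x" if "a \<in> ?J b"
      for a and x :: "'g slotted list \<Rightarrow>\<^sub>0 'k"
    proof -
      have "take b w = take a w @ drop a (take b w)"
        using that by (metis append_take_drop_id greaterThanLessThan_iff less_imp_le min.absorb1 take_take)
      then have "wdeg (take b w) = wdeg (take a w) + wdeg (drop a (take b w))" by (metis wdeg_simps(3))
      then show ?thesis by (simp add: sg_def)
    qed
    note * = this
    have *: "sg (wdeg (take b w)) * (sg (wdeg (take a (take b w))) * x) = ?s a b * x" if "a \<in> ?J b"
      for a and x :: "'g slotted list \<Rightarrow>\<^sub>0 'k"
      using that *[OF that] by (simp add: min_absorb1)
    have "length (take b w) = b" using that by auto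
    then have "sg (wdeg (take b w)) * (cobr 0 1 (take b w) * lt 2 (drop b w))
      = (\<Sum>a\<in>?J b. sg (wdeg (take b w)) * (sg (wdeg (take a (take b w))) *
          ((lt 0 (take a (take b w)) * lt 1 (drop a (take b w)) + lt 1 (take a (take b w)) * lt 0 (drop a (take b w))) * lt 2 (drop b w))))"
      by (simp only: cobr_def sum_distrib_left sum_distrib_right mult.assoc)
    also have "\<dots> = (\<Sum>a\<in>?J b. ?s a b * (?f 0 1 2 a b + ?f 1 0 2 a b))"
      by (rule sum.cong[OF refl], simp only: *) (auto simp: distrib_right mult.assoc min_absorb1)
    finally show ?thesis .
  qed
  \<comment> \<open>The sign of the first cut is the unshifted degree of the left piece, the sign
    for passing that piece its shifted degree; together they give -1.\<close>
  have 2: "sg (wdeg (take a w)) * (sg (xdeg (take a w)) * (lt 2 (take a w) * cobr 0 1 (drop a w)))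
      = - (\<Sum>b\<in>{a<..<length w}. ?s a b * (?f 2 0 1 a b + ?f 2 1 0 a b))" for a
  proof -
    have "cobr 0 1 (drop a w) = (\<Sum>b\<in>{a<..<length w}. ?s a b *
        (lt 0 (drop a (take b w)) * lt 1 (drop b w) + lt 1 (drop a (take b w)) * lt 0 (drop b w)) :: 'g slotted list \<Rightarrow>\<^sub>0 'k)"
      unfolding cobr_def
      by (rule sum.reindex_bij_witness[of _ "\<lambda>b. b - a" "\<lambda>m. m + a"])
        (auto simp: drop_take add.commute)
    moreover have "sg (wdeg (take a w)) * (sg (xdeg (take a w)) * x) = - x" for x :: "'g slotted list \<Rightarrow>\<^sub>0 'k"
      by (simp add: sg_def xdeg_def)
    ultimately have "sg (wdeg (take a w)) * (sg (xdeg (take a w)) * (lt 2 (take a w) * cobr 0 1 (drop a w)))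
      = - (lt 2 (take a w) * (\<Sum>b\<in>{a<..<length w}. ?s a b *
        (lt 0 (drop a (take b w)) * lt 1 (drop b w) + lt 1 (drop a (take b w)) * lt 0 (drop b w))))"
      by simp
    then show ?thesis
      by (simp only: sum_distrib_left lt_sg distrib_left mult.assoc)
  qed
  have "sder K\<^sub>l E\<^sub>l (klt K\<^sub>\<kappa> (0, w)) =
    (\<Sum>b\<in>?I. sg (wdeg (take b w)) * (cobr 0 1 (take b w) * lt 2 (drop b w)))
    + (\<Sum>a\<in>?I. sg (wdeg (take a w)) * (sg (xdeg (take a w)) * (lt 2 (take a w) * cobr 0 1 (drop a w))))"
    by (simp add: klt_def cobr_def[of 0 "Suc 0" w] der_sum der_add der_mult hom_mult distrib_left sum.distrib mult.assoc)
  also have "(\<Sum>b\<in>?I. sg (wdeg (take b w)) * (cobr 0 1 (take b w) * lt 2 (drop b w)))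
    = (\<Sum>b\<in>?I. \<Sum>a\<in>?J b. ?s a b * (?f 0 1 2 a b + ?f 1 0 2 a b))"
    by (rule sum.cong[OF refl 1])
  also have "(\<Sum>a\<in>?I. sg (wdeg (take a w)) * (sg (xdeg (take a w)) * (lt 2 (take a w) * cobr 0 1 (drop a w))))
    = - (\<Sum>a\<in>?I. \<Sum>b\<in>{a<..<length w}. ?s a b * (?f 2 0 1 a b + ?f 2 1 0 a b))"
    by (simp only: 2 sum_negf)
  \<comment> \<open>Coassociativity of deconcatenation: both iterated cuts are indexed by the pairs
    of positions a < b.\<close>
  also have "(\<Sum>a\<in>?I. \<Sum>b\<in>{a<..<length w}. ?s a b * (?f 2 0 1 a b + ?f 2 1 0 a b))
    = (\<Sum>b\<in>?I. \<Sum>a\<in>?J b. ?s a b * (?f 2 0 1 a b + ?f 2 1 0 a b))"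
    by (simp add: sum.Sigma, rule sum.reindex_bij_witness[of _ "\<lambda>(b, a). (a, b)" "\<lambda>(b, a). (a, b)"]) auto
  finally have "sder K\<^sub>l E\<^sub>l (klt K\<^sub>\<kappa> (0, w)) =
    (\<Sum>b\<in>?I. \<Sum>a\<in>?J b. ?s a b * (?f 0 1 2 a b + ?f 1 0 2 a b) - ?s a b * (?f 2 0 1 a b + ?f 2 1 0 a b))"
    by (simp only: sum_subtractf add_uminus_conv_diff)
  then show ?thesis by (simp only: right_diff_distrib[symmetric] diff_diff_eq)
qed

section \<open>The cyclic sum of the iterated cobracket\<close>

abbreviation (input) "R1 \<equiv> (\<lambda>i::nat. if i = 0 then [1] else if i = 1 then [2] else if i = 2 then [0] else [])"
abbreviation (input) "R2 \<equiv> (\<lambda>i::nat. if i = 0 then [2] else if i = 1 then [0] else if i = 2 then [1] else [])"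

lemma T12_T23: "shom T12 (shom T23 p) = shom R1 p" "shom T23 (shom T12 p) = shom R2 p"
proof -
  have *: "(\<lambda>x. shom T12 (dlt T23 x)) = dlt R1" "(\<lambda>x. shom T23 (dlt T12 x)) = dlt R2"
    by (auto simp: dlt_def fun_eq_iff)
  show "shom T12 (shom T23 p) = shom R1 p" "shom T23 (shom T12 p) = shom R2 p"
    by (simp_all only: hom_hom *)
qed

text \<open>The iterated cobracket is not a derivation, since applying \<kappa> twice to a product
  gives mixed terms. Its cyclic sum is one along \<open>E\<^sub>3\<close>, because the mixed terms
  cancel under rotation.\<close>

lemma coJacobi_free:
  fixes p :: "'g slotted list \<Rightarrow>\<^sub>0 'k::field"
  defines "Q \<equiv> \<lambda>p :: 'g slotted list \<Rightarrow>\<^sub>0 'k. sder K\<^sub>l E\<^sub>l (sder K\<^sub>\<kappa> E\<^sub>\<Delta> p)"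
  shows "Q p + shom T12 (shom T23 (Q p)) + shom T23 (shom T12 (Q p)) = 0"
proof -
  define X :: "nat \<Rightarrow> nat \<Rightarrow> ('g slotted list \<Rightarrow>\<^sub>0 'k) \<Rightarrow> ('g slotted list \<Rightarrow>\<^sub>0 'k)"
    where "X p q = sder (K\<^sub>3 p q) E\<^sub>3" for p q
  let ?q = "\<lambda>x. sder K\<^sub>l E\<^sub>l (klt K\<^sub>\<kappa> x)" and ?D = "shom E\<^sub>3" and ?k = "\<lambda>p q. klt (K\<^sub>3 p q)"
  have d: "(\<lambda>x. shom E\<^sub>l (dlt E\<^sub>\<Delta> x)) = dlt E\<^sub>3" "(\<lambda>x. shom R1 (dlt E\<^sub>3 x)) = dlt E\<^sub>3"
    "(\<lambda>x. shom R2 (dlt E\<^sub>3 x)) = dlt E\<^sub>3"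
    by (auto simp: dlt_def fun_eq_iff hom_add algebra_simps)
  have k: "(\<lambda>x. shom E\<^sub>l (klt K\<^sub>\<kappa> x)) = (\<lambda>x. ?k 0 2 x + ?k 1 2 x)"
    by (auto simp: klt_def fun_eq_iff shom_cobr)
  have k': "(\<lambda>x. sder K\<^sub>l E\<^sub>l (dlt E\<^sub>\<Delta> x)) = ?k 0 1"
    by (auto simp: klt_def dlt_def fun_eq_iff der_add)
  \<comment> \<open>A rotation permutes the three pairs of factors; where it reverses the order
    within a pair, the symmetry of \<open>cobr\<close> is used.\<close>
  have R1: "(\<lambda>x. shom R1 (?k 0 1 x)) = ?k 1 2" "(\<lambda>x. shom R1 (?k 0 2 x)) = ?k 0 1" "(\<lambda>x. shom R1 (?k 1 2 x)) = ?k 0 2"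
    and R2: "(\<lambda>x. shom R2 (?k 0 1 x)) = ?k 0 2" "(\<lambda>x. shom R2 (?k 0 2 x)) = ?k 1 2" "(\<lambda>x. shom R2 (?k 1 2 x)) = ?k 0 1"
    by (auto simp: klt_def fun_eq_iff shom_cobr cobr_commute[of "Suc 0" 0] cobr_commute[of 2])
  note R1' = R1[THEN fun_cong] and R2' = R2[THEN fun_cong] and d' = d[THEN fun_cong]
  have RX: "shom R1 (X 0 1 p) = X 1 2 p" "shom R1 (X 0 2 p) = X 0 1 p" "shom R1 (X 1 2 p) = X 0 2 p"
    "shom R2 (X 0 1 p) = X 0 2 p" "shom R2 (X 0 2 p) = X 1 2 p" "shom R2 (X 1 2 p) = X 0 1 p" for p
    unfolding X_def by (simp_all only: hom_der R1 R2 d)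
  have RD: "shom R1 (?D p) = ?D p" "shom R2 (?D p) = ?D p" for p
    by (simp_all only: hom_hom d)
  \<comment> \<open>Each of the six distributions of the three pieces over the factors occurs twice
    in the cyclic sum, with opposite signs.\<close>
  have q0: "(?q x :: 'g slotted list \<Rightarrow>\<^sub>0 'k) + shom R1 (?q x) + shom R2 (?q x) = 0" for x
  proof (cases "fst x = 0")
    case True
    then obtain w where w: "x = (0, w)" by (cases x) auto
    show ?thesis
      unfolding w ksplit3
      by (simp add: hom_sum hom_sg hom_add hom_diff hom_mult flip: sum.distrib distrib_left)
  qed (simp add: klt_def)
  define J where "J p = Q p + shom R1 (Q p) + shom R2 (Q p)" for p
  \<comment> \<open>In the mixed terms one cobracket acts on \<open>x\<close> and the other on
    \<open>L\<close>. When the outer one has to pass the already cut letter, the oddness of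
    \<open>klt\<close> yields the extra minus sign.\<close>
  have Q_Cons: "Q (sing (x # L)) = ?q x * ?D (sing L) + sg (ldeg x) * (?k 0 1 x * (X 0 2 (sing L) + X 1 2 (sing L)))
      - sg (ldeg x) * ((?k 0 2 x + ?k 1 2 x) * X 0 1 (sing L)) + dlt E\<^sub>3 x * Q (sing L)" for x L
  proof -
    have "sder K\<^sub>\<kappa> E\<^sub>\<Delta> (sing (x # L)) = klt K\<^sub>\<kappa> x * shom E\<^sub>\<Delta> (sing L) + sg (ldeg x) * (dlt E\<^sub>\<Delta> x * sder K\<^sub>\<kappa> E\<^sub>\<Delta> (sing L))"
      by (simp add: der_sing mult.assoc)
    then have "Q (sing (x # L)) = sder K\<^sub>l E\<^sub>l (klt K\<^sub>\<kappa> x * shom E\<^sub>\<Delta> (sing L) + sg (ldeg x) * (dlt E\<^sub>\<Delta> x * sder K\<^sub>\<kappa> E\<^sub>\<Delta> (sing L)))"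
      unfolding Q_def by (rule arg_cong)
    also have "\<dots> = ?q x * shom E\<^sub>l (shom E\<^sub>\<Delta> (sing L))
        + shom E\<^sub>l (hom (parity ldeg) (klt K\<^sub>\<kappa> x)) * sder K\<^sub>l E\<^sub>l (shom E\<^sub>\<Delta> (sing L))
        + sg (ldeg x) * (?k 0 1 x * shom E\<^sub>l (sder K\<^sub>\<kappa> E\<^sub>\<Delta> (sing L)) + sg (ldeg x) * dlt E\<^sub>3 x * Q (sing L))"
      unfolding Q_def by (simp only: der_add der_mult der_of_sg hom_of_sg mult_zero_left add_0_left
          hom_parity_dlt' k'[THEN fun_cong] d'(1))
    also have "shom E\<^sub>l (hom (parity ldeg) (klt K\<^sub>\<kappa> x)) = - sg (ldeg x) * (?k 0 2 x + ?k 1 2 x)"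
      unfolding hom_parity_klt by (simp only: hom_mult hom_neg hom_of_sg k[THEN fun_cong])
    also have "sder K\<^sub>l E\<^sub>l (shom E\<^sub>\<Delta> (sing L)) = X 0 1 (sing L)"
      unfolding X_def by (simp only: sder_shom k' d)
    also have "shom E\<^sub>l (shom E\<^sub>\<Delta> (sing L)) = ?D (sing L)"
      by (simp only: hom_hom d)
    also have "shom E\<^sub>l (sder K\<^sub>\<kappa> E\<^sub>\<Delta> (sing L)) = X 0 2 (sing L) + X 1 2 (sing L)"
      unfolding X_def by (simp only: hom_der k d der_add_left)
    finally show ?thesis by (simp add: algebra_simps)
  qed
  have "J (sing L) = 0" for L
  proof (induction L)
    case Nil
    then show ?case by (simp add: J_def Q_def der_sing)
  next
    case (Cons x L)
    \<comment> \<open>Each mixed product of cobrackets in two different pairs of factors appears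
      once with plus and once with minus among the three rotations.\<close>
    have "J (sing (x # L)) = (?q x + shom R1 (?q x) + shom R2 (?q x)) * ?D (sing L) + dlt E\<^sub>3 x * J (sing L)"
      unfolding J_def Q_Cons hom_add hom_diff hom_mult hom_of_sg R1' R2' d' RX RD
      by (simp add: algebra_simps)
    then show ?case using Cons q0 by simp
  qed
  moreover have Q: "plinear Q" unfolding Q_def by (rule plinear_compose[OF plinear_der plinear_der])
  have "plinear J"
    unfolding J_def[abs_def]
    by (rule plinear_plus[OF plinear_plus[OF Q plinear_compose[OF plinear_hom Q]] plinear_compose[OF plinear_hom Q]])
  moreover have "plinear (\<lambda>_ :: 'g slotted list \<Rightarrow>\<^sub>0 'k. 0 :: 'g slotted list \<Rightarrow>\<^sub>0 'k)"
    by (rule plinearI) simp_all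
  ultimately have "J p = 0" using plinear_eqI by blast
  then show ?thesis unfolding J_def T12_T23 .
qed

section \<open>The defining relations\<close>

lemma lext_comp: "plinear F \<Longrightarrow> lext (\<lambda>x. F (f x)) p = F (lext f p)"
  unfolding lext_def by (simp add: plinear_sum plinear_scale)

lemma lext_fun_add: "lext (\<lambda>x. f x + g x) p = lext f p + lext g p"
  by (simp add: lext_def free.scale_right_distrib sum.distrib)

lemma lext_fun_sum: "lext (\<lambda>x. \<Sum>i\<in>I. f i x) p = (\<Sum>i\<in>I. lext (f i) p)"
  by (simp add: lext_def free.scale_sum_right) (rule sum.swap)

lemma lext_fun_mult_left: "lext (\<lambda>x. a * f x) p = (a :: 'x list \<Rightarrow>\<^sub>0 'k::field) * lext f p"
  by (rule lext_comp[OF plinear_mult_right[OF plinear_id]])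

lemma lext_fun_mult_right: "lext (\<lambda>x. f x * a) p = lext f p * (a :: 'x list \<Rightarrow>\<^sub>0 'k::field)"
  by (rule lext_comp[OF plinear_mult_left[OF plinear_id]])

definition iota :: "nat \<Rightarrow> ((int \<times> 'g) list \<Rightarrow>\<^sub>0 'k) \<Rightarrow> ('g slotted list \<Rightarrow>\<^sub>0 'k::field)" where
  "iota i = lext (lt i)"

lemma iota_sing [simp]: "iota i (sing w) = lt i w"
  by (simp add: iota_def)

lemma plinear_iota: "plinear (iota i)"
  unfolding iota_def by (rule plinear_lext)

definition valid :: "('k, 'g) gspace \<Rightarrow> (int \<times> 'g) list \<Rightarrow> bool" where
  "valid G w \<longleftrightarrow> w \<noteq> [] \<and> w \<in> words (shift G)"

text \<open>
  Discarding the letters that do not represent elements of \<open>\<H>[1]\<close> allows to work in the free algebra on all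
  letters.
\<close>

definition xrels :: "('k::field, 'g::plus) gspace \<Rightarrow> ('g slotted list \<Rightarrow>\<^sub>0 'k) set" where
  "xrels G =
    {lt i u * lt j v - sg (xdeg u * xdeg v) * (lt j v * lt i u) | i j u v. True}
    \<union> {iota i r | i r. r \<in> multilin_rels (shift G) \<union> bat_rels (shift G)}
    \<union> {lt i w | i w. \<not> valid G w}"

definition rel_ideal :: "('k::field, 'g::plus) gspace \<Rightarrow> ('g slotted list \<Rightarrow>\<^sub>0 'k) set" where
  "rel_ideal G = ideal (xrels G)"

lemma subspace_rel_ideal: "free.subspace (rel_ideal G)"
  unfolding rel_ideal_def by (rule subspace_ideal)

lemmas rel_ideal_add = free.subspace_add[OF subspace_rel_ideal] and rel_ideal_diff = free.subspace_diff[OF subspace_rel_ideal]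
  and rel_ideal_neg = free.subspace_neg[OF subspace_rel_ideal] and rel_ideal_0 [simp] = free.subspace_0[OF subspace_rel_ideal]
  and rel_ideal_scale = free.subspace_scale[OF subspace_rel_ideal] and rel_ideal_sum = free.subspace_sum[OF subspace_rel_ideal]

lemma rel_ideal_mult_left: "p \<in> rel_ideal G \<Longrightarrow> q * p \<in> rel_ideal G"
  unfolding rel_ideal_def by (rule ideal_mult_left)

lemma rel_ideal_mult_right: "p \<in> rel_ideal G \<Longrightarrow> p * q \<in> rel_ideal G"
  unfolding rel_ideal_def by (rule ideal_mult_right)

lemma rel_ideal_comm: "lt i u * lt j v - sg (xdeg u * xdeg v) * (lt j v * lt i u) \<in> rel_ideal G"
  unfolding rel_ideal_def xrels_def by (rule ideal_base) blast

lemma rel_ideal_iota: "r \<in> multilin_rels (shift G) \<union> bat_rels (shift G) \<Longrightarrow> iota i r \<in> rel_ideal G"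
  unfolding rel_ideal_def xrels_def by (rule ideal_base) blast

lemma rel_ideal_invalid: "\<not> valid G w \<Longrightarrow> lt i w \<in> rel_ideal G"
  unfolding rel_ideal_def xrels_def by (rule ideal_base) blast

lemma rel_ideal_cases:
  assumes "r \<in> xrels G"
  obtains i j u v where "r = lt i u * lt j v - sg (xdeg u * xdeg v) * (lt j v * lt i u)"
  | i r' where "r = iota i r'" "r' \<in> multilin_rels (shift G) \<union> bat_rels (shift G)"
  | i w where "r = lt i w" "\<not> valid G w"
  using assms unfolding xrels_def by blast

section \<open>Graded commutation modulo the relations\<close>

definition supercomm :: "('k::field, 'g::plus) gspace \<Rightarrow> int \<Rightarrow> int \<Rightarrow> ('g slotted list \<Rightarrow>\<^sub>0 'k) \<Rightarrow> ('g slotted list \<Rightarrow>\<^sub>0 'k) \<Rightarrow> bool" where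
  "supercomm G m n p q \<longleftrightarrow> p * q - sg (m * n) * (q * p) \<in> rel_ideal G"

lemma supercomm_lt: "supercomm G (xdeg u) (xdeg v) (lt i u) (lt j v)"
  unfolding supercomm_def by (rule rel_ideal_comm)

lemma supercomm_sym: "supercomm G m n p q \<Longrightarrow> supercomm G n m q p"
proof -
  assume "supercomm G m n p q"
  then have "- (sg (m * n) * (p * q - sg (m * n) * (q * p))) \<in> rel_ideal G"
    unfolding supercomm_def by (intro rel_ideal_neg rel_ideal_mult_left)
  then show ?thesis by (simp add: supercomm_def right_diff_distrib mult.commute)
qed

lemma supercomm_0: "supercomm G m n 0 q" by (simp add: supercomm_def)

lemma supercomm_add: "supercomm G m n p q \<Longrightarrow> supercomm G m n p' q \<Longrightarrow> supercomm G m n (p + p') q"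
  unfolding supercomm_def by (drule (1) rel_ideal_add) (simp add: algebra_simps)

lemma supercomm_sg: "supercomm G m n p q \<Longrightarrow> supercomm G m n (sg k * p) q"
proof -
  assume "supercomm G m n p q"
  then have "sg k * (p * q - sg (m * n) * (q * p)) \<in> rel_ideal G" unfolding supercomm_def by (rule rel_ideal_mult_left)
  also have "sg k * (p * q - sg (m * n) * (q * p)) = sg k * p * q - sg (m * n) * (q * (sg k * p))"
    by (simp add: sg_def)
  finally show ?thesis by (simp add: supercomm_def)
qed

lemma supercomm_mult:
  assumes "supercomm G m n p q" "supercomm G m' n p' q" shows "supercomm G (m + m') n (p * p') q"
proof -
  have "p * (p' * q - sg (m' * n) * (q * p')) + sg (m' * n) * ((p * q - sg (m * n) * (q * p)) * p') \<in> rel_ideal G"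
    using assms unfolding supercomm_def by (intro rel_ideal_add rel_ideal_mult_left rel_ideal_mult_right)
  also have "p * (p' * q - sg (m' * n) * (q * p')) + sg (m' * n) * ((p * q - sg (m * n) * (q * p)) * p')
    = p * p' * q - sg ((m + m') * n) * (q * (p * p'))"
    by (simp add: sg_def algebra_simps)
  finally show ?thesis by (simp add: supercomm_def)
qed

lemma supercomm_sum: "(\<And>i. i \<in> I \<Longrightarrow> supercomm G m n (f i) q) \<Longrightarrow> supercomm G m n (sum f I) q"
  by (induction I rule: infinite_finite_induct) (simp_all add: supercomm_0 supercomm_add)

lemma supercomm_sum_list: "(\<And>i. i \<in> set xs \<Longrightarrow> supercomm G m n (f i) q) \<Longrightarrow> supercomm G m n (\<Sum>i\<leftarrow>xs. f i) q"
  by (induction xs) (simp_all add: supercomm_0 supercomm_add)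

text \<open>Both pieces of a cut commute with the letter, and their degrees add up to
  \<open>xdeg u - 1\<close>.\<close>

lemma supercomm_cobr: "supercomm G (xdeg u - 1) (xdeg v) (cobr i j u) (lt l v)"
proof -
  have *: "xdeg u - 1 = xdeg (take m u) + xdeg (drop m u)" for m
    by (simp add: xdeg_def) (metis append_take_drop_id wdeg_simps(3))
  have "supercomm G (xdeg u - 1) (xdeg v) (lt p (take m u) * lt q (drop m u)) (lt l v)" for p q m
    unfolding *[of m] by (intro supercomm_mult supercomm_lt)
  then show ?thesis unfolding cobr_def by (intro supercomm_sum supercomm_sg supercomm_add)
qed

text \<open>If a word is not over the given space, then one piece of any cut is not either; the
  empty word has no cuts at all.\<close>

lemma rel_ideal_cobr_invalid: "\<not> valid G w \<Longrightarrow> cobr i j w \<in> rel_ideal G"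
proof -
  assume w: "\<not> valid G w"
  have *: "lt p (take m w) * lt q (drop m w) \<in> rel_ideal G" if "m \<in> {0<..<length w}" for p q m
  proof -
    have "\<not> (take m w \<in> words (shift G) \<and> drop m w \<in> words (shift G))"
      using w that append_take_drop_id[of m w] words_append
      by (metis valid_def greaterThanLessThan_iff list.size(3) less_zeroE)
    then have "\<not> valid G (take m w) \<or> \<not> valid G (drop m w)" by (auto simp: valid_def)
    then show ?thesis
      using rel_ideal_invalid rel_ideal_mult_left rel_ideal_mult_right by blast
  qed
  show ?thesis
    unfolding cobr_def by (rule rel_ideal_sum, rule rel_ideal_mult_left) (simp add: rel_ideal_add *)
qed

subsection \<open>The multilinearity relations\<close>

definition lrels :: "('k::field, 'v::plus) gspace \<Rightarrow> int \<Rightarrow> ('v \<Rightarrow>\<^sub>0 'k) set" where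
  "lrels V d = {sing (x + y) - sing x - sing y | x y. x \<in> gcomp V d \<and> y \<in> gcomp V d}
    \<union> {sing (scl V c x) - pscale c (sing x) | x c. x \<in> gcomp V d}"

text \<open>Separates the varying letter from its surroundings, so that cutting the word acts on the
  context only.\<close>

definition ctx :: "(int \<times> 'v) list \<Rightarrow> int \<Rightarrow> (int \<times> 'v) list \<Rightarrow> ('v \<Rightarrow>\<^sub>0 'k) \<Rightarrow> ((int \<times> 'v) list \<Rightarrow>\<^sub>0 'k::field)" where
  "ctx u d w = lext (\<lambda>x. sing (u @ (d, x) # w))"

lemma multilin_rels_ctx:
  "r \<in> multilin_rels V \<longleftrightarrow> (\<exists>u d w z. r = ctx u d w z \<and> z \<in> lrels V d \<and> u \<in> words V \<and> w \<in> words V)"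
proof
  assume "r \<in> multilin_rels V"
  then show "\<exists>u d w z. r = ctx u d w z \<and> z \<in> lrels V d \<and> u \<in> words V \<and> w \<in> words V"
  proof (cases rule: multilin_rels_cases)
    case (add u w d x y)
    then have "r = ctx u d w (sing (x + y) - sing x - sing y)" "sing (x + y) - sing x - sing y \<in> lrels V d"
      unfolding lrels_def by (auto simp: ctx_def lext_diff)
    then show ?thesis using add by blast
  next
    case (scale u w d x c)
    then have "r = ctx u d w (sing (scl V c x) - pscale c (sing x))" "sing (scl V c x) - pscale c (sing x) \<in> lrels V d"
      unfolding lrels_def by (simp add: ctx_def lext_diff, blast)
    then show ?thesis using scale by blast
  qed
next
  assume "\<exists>u d w z. r = ctx u d w z \<and> z \<in> lrels V d \<and> u \<in> words V \<and> w \<in> words V"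
  then show "r \<in> multilin_rels V"
    unfolding lrels_def
    by (auto simp: ctx_def lext_diff simp del: pscale_single)
      (auto simp: intro: multilin_add multilin_scale[simplified])
qed

text \<open>At every cut the varying letter lies in exactly one of the two pieces, and that piece
  carries the relation.\<close>

lemma rel_ideal_cobr_multilin:
  assumes "r \<in> multilin_rels (shift G)" shows "lext (cobr i j) r \<in> rel_ideal G"
proof -
  obtain u d w z where r: "r = ctx u d w z" "z \<in> lrels (shift G) d" "u \<in> words (shift G)" "w \<in> words (shift G)"
    using assms multilin_rels_ctx by blast
  let ?w = "\<lambda>x. u @ (d, x) # w"
  have lt: "lext (\<lambda>x. lt p (u' @ (d, x) # w')) z \<in> rel_ideal G"
    if "u' \<in> words (shift G)" "w' \<in> words (shift G)" for p u' w'
  proof -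
    have "iota p (ctx u' d w' z) \<in> rel_ideal G"
      using that r by (intro rel_ideal_iota) (auto simp: multilin_rels_ctx)
    then show ?thesis unfolding ctx_def by (simp flip: lext_comp[OF plinear_iota])
  qed
  have *: "lext (\<lambda>x. lt p (take m (?w x)) * lt q (drop m (?w x))) z \<in> rel_ideal G" for p q m
  proof (cases "m \<le> length u")
    case True
    moreover have "drop m u \<in> words (shift G)" using r(3) append_take_drop_id words_append by metis
    ultimately show ?thesis
      using lt[of "drop m u" w q] r by (simp add: lext_fun_mult_left rel_ideal_mult_left)
  next
    case False
    define m' where "m' = m - Suc (length u)"
    have m: "m = Suc (length u) + m'" using False by (simp add: m'_def)
    have "take m' w \<in> words (shift G)" using r(4) append_take_drop_id words_append by metis
    then show ?thesis
      using lt[of u "take m' w" p] r unfolding m by (simp add: lext_fun_mult_right rel_ideal_mult_right)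
  qed
  \<comment> \<open>The degree of a prefix involves \<open>d\<close> but not the vector of the
    varying letter, so an arbitrary vector may stand in for it.\<close>
  define D where "D m = wdeg (take m (?w undefined))" for m
  have wd: "wdeg (take m (?w x)) = D m" for m x
    unfolding D_def
    by (cases "m - length u") auto
  have "lext (cobr i j) r = lext (\<lambda>x. cobr i j (?w x)) z"
    unfolding r(1) ctx_def by (simp flip: lext_comp[OF plinear_lext])
  also have "\<dots> = (\<Sum>m\<in>{0<..<length u + Suc (length w)}. sg (D m) *
     (lext (\<lambda>x. lt i (take m (?w x)) * lt j (drop m (?w x))) z + lext (\<lambda>x. lt j (take m (?w x)) * lt i (drop m (?w x))) z))"
    unfolding cobr_def
    by (simp only: wd lext_fun_sum[symmetric] lext_fun_add[symmetric] lext_fun_mult_left[symmetric] length_append length_Cons)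
  also have "\<dots> \<in> rel_ideal G"
    by (intro rel_ideal_sum rel_ideal_mult_left rel_ideal_add *)
  finally show ?thesis .
qed

subsection \<open>Shuffles\<close>

text \<open>The signed shuffle product. Taking \<open>b\<close> first moves it past the whole of
  \<open>a # u\<close>, which is the sign of the second summand.\<close>

fun shuffle :: "(int \<times> 'g) list \<Rightarrow> (int \<times> 'g) list \<Rightarrow> ((int \<times> 'g) list \<Rightarrow>\<^sub>0 'k::field)" where
  "shuffle [] v = sing v"
| "shuffle (a # u) [] = sing (a # u)"
| "shuffle (a # u) (b # v) = sing [a] * shuffle u (b # v) + sg (fst b * wdeg (a # u)) * (sing [b] * shuffle (a # u) v)"

lemma shuffle_Nil2 [simp]: "shuffle u [] = sing u"
  by (cases u) simp_all

text \<open>In contrast to \<open>cobr\<close> the cuts at both ends are included; only this full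
  deconcatenation is multiplicative for shuffles.\<close>

definition deconc :: "('x list \<Rightarrow> 'x list \<Rightarrow> ('y list \<Rightarrow>\<^sub>0 'k)) \<Rightarrow> 'x list \<Rightarrow> ('y list \<Rightarrow>\<^sub>0 'k::field)" where
  "deconc f w = (\<Sum>m\<le>length w. f (take m w) (drop m w))"

definition bilext :: "('x list \<Rightarrow> 'x list \<Rightarrow> ('y list \<Rightarrow>\<^sub>0 'k)) \<Rightarrow> ('x list \<Rightarrow>\<^sub>0 'k) \<Rightarrow> ('x list \<Rightarrow>\<^sub>0 'k) \<Rightarrow> ('y list \<Rightarrow>\<^sub>0 'k::field)" where
  "bilext f p q = lext (\<lambda>x. lext (f x) q) p"

lemma deconc_Cons: "deconc f (a # w) = f [] (a # w) + deconc (\<lambda>x. f (a # x)) w"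
  by (simp add: deconc_def sum.atMost_Suc_shift del: sum.atMost_Suc)

lemma lext_prefix: "lext f (sing [a] * p) = lext (\<lambda>w. f (a # w)) p"
  by (induction p rule: poly_mapping_induct) (simp_all add: sing_mult lext_add distrib_left)

lemma lext_deconc_Cons: "lext (deconc f) (sing [a] * p) = lext (f []) (sing [a] * p) + lext (deconc (\<lambda>x. f (a # x))) p"
  by (simp add: lext_prefix deconc_Cons lext_fun_add)

lemma lext_sg: "lext f (sg n * p) = sg n * lext f p"
  by (rule plinear_sg[OF plinear_lext])

lemma bilext_sing [simp]: "bilext f (sing u) (sing v) = f u v"
  by (simp add: bilext_def)

lemma bilext_sing_left: "bilext f (sing u) q = lext (f u) q"
  by (simp add: bilext_def)

lemma bilext_add: "bilext f (p + p') q = bilext f p q + bilext f p' q"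
  by (simp add: bilext_def lext_add)

lemma bilext_neg: "bilext f (- p) q = - bilext f p q"
  by (simp add: bilext_def plinear_neg[OF plinear_lext])

lemma bilext_prefix: "bilext f (sing [a] * p) q = bilext (\<lambda>x. f (a # x)) p q"
  by (simp add: bilext_def lext_prefix)

text \<open>A prefix of a shuffle is a shuffle of prefixes, and the rest a shuffle of the
  remainders. The sign comes from moving the prefix of \<open>v\<close> past the remainder of
  \<open>u\<close>.\<close>

lemma deconc_shuffle:
  fixes f :: "(int \<times> 'g) list \<Rightarrow> (int \<times> 'g) list \<Rightarrow> ('y list \<Rightarrow>\<^sub>0 'k::field)"
  shows "lext (deconc f) (shuffle u v) = (\<Sum>m\<le>length u. \<Sum>n\<le>length v. sg (wdeg (drop m u) * wdeg (take n v)) *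
     bilext f (shuffle (take m u) (take n v)) (shuffle (drop m u) (drop n v)))"
proof (induction u v arbitrary: f rule: shuffle.induct)
  case (1 v)
  then show ?case by (simp add: deconc_def)
next
  case (2 a u)
  then show ?case by (simp add: deconc_def)
next
  case (3 a u b v)
  define A where "A f u v m n = sg (wdeg (drop m u) * wdeg (take n v)) *
     bilext f (shuffle (take m u) (take n v)) (shuffle (drop m u) (drop n v))" 
    for f :: "(int \<times> 'g) list \<Rightarrow> (int \<times> 'g) list \<Rightarrow> ('y list \<Rightarrow>\<^sub>0 'k)" and u v m n
  let ?u = "a # u" and ?v = "b # v" and ?fa = "\<lambda>x. f (a # x)" and ?fb = "\<lambda>x. f (b # x)"
  have A00: "A f ?u ?v 0 0 = lext (f []) (shuffle ?u ?v)"
    by (simp add: A_def bilext_sing_left)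
  have A0S: "A f ?u ?v 0 (Suc n) = sg (fst b * wdeg ?u) * A ?fb ?u v 0 n" for n
    by (auto simp: A_def bilext_sing_left sg_def distrib_left)
  have AS0: "A f ?u ?v (Suc m) 0 = A ?fa u ?v m 0" for m
    by (simp add: A_def bilext_sing_left)
  \<comment> \<open>With both prefixes nonempty, their shuffle starts either with \<open>a\<close>
    or with \<open>b\<close>; these are the two summands.\<close>
  have ASS: "A f ?u ?v (Suc m) (Suc n) = A ?fa u ?v m (Suc n) + sg (fst b * wdeg ?u) * A ?fb ?u v (Suc m) n" for m n
  proof -
    have "wdeg ?u = fst a + wdeg (take m u) + wdeg (drop m u)"
      using append_take_drop_id[of m u] wdeg_simps(3) by (metis add.assoc wdeg_simps(2))
    then show ?thesis
      by (auto simp: A_def bilext_add bilext_neg bilext_prefix sg_def)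
  qed
  have "lext (deconc f) (shuffle ?u ?v) = lext (f []) (shuffle ?u ?v) + lext (deconc ?fa) (shuffle u ?v) + sg (fst b * wdeg ?u) * lext (deconc ?fb) (shuffle ?u v)"
    by (simp add: lext_add lext_sg lext_deconc_Cons algebra_simps)
  also have "lext (deconc ?fa) (shuffle u ?v) = (\<Sum>m\<le>length u. \<Sum>n\<le>length ?v. A ?fa u ?v m n)"
    unfolding A_def by (rule 3)
  also have "\<dots> = (\<Sum>m\<le>length u. A ?fa u ?v m 0) + (\<Sum>m\<le>length u. \<Sum>n\<le>length v. A ?fa u ?v m (Suc n))"
    by (simp add: sum.atMost_Suc_shift sum.distrib del: sum.atMost_Suc)
  also have "lext (deconc ?fb) (shuffle ?u v) = (\<Sum>m\<le>length ?u. \<Sum>n\<le>length v. A ?fb ?u v m n)"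
    unfolding A_def by (rule 3)
  also have "\<dots> = (\<Sum>n\<le>length v. A ?fb ?u v 0 n) + (\<Sum>m\<le>length u. \<Sum>n\<le>length v. A ?fb ?u v (Suc m) n)"
    by (simp add: sum.atMost_Suc_shift del: sum.atMost_Suc)
  finally have "lext (deconc f) (shuffle ?u ?v) = (\<Sum>m\<le>length ?u. \<Sum>n\<le>length ?v. A f ?u ?v m n)"
    by (simp add: sum.atMost_Suc_shift A00 A0S AS0 ASS sum.distrib sum_distrib_left distrib_left del: sum.atMost_Suc shuffle.simps)
  then show ?case unfolding A_def .
qed

section \<open>The sum over Bat(p, q) as a shuffle product\<close>

lemma koszul_Cons:
  "koszul ds (y # r) = (\<Prod>z\<leftarrow>r. if z < y then sg (ds ! y * ds ! z) else 1) * (koszul ds r :: 'k::field)"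
proof -
  let ?S = "\<lambda>p :: nat list. {(k, l). k < l \<and> l < length p \<and> p ! l < p ! k}"
  let ?f = "\<lambda>p :: nat list. \<lambda>(k, l). (-1) powi (ds ! (p ! k) * ds ! (p ! l)) :: 'k"
  have fin: "finite (?S p)" for p :: "nat list"
    by (rule finite_subset[of _ "{..<length p} \<times> {..<length p}"]) auto
  let ?A = "(\<lambda>l. (0::nat, Suc l)) ` {l. l < length r \<and> r ! l < y}" and ?B = "(\<lambda>(k, l). (Suc k, Suc l)) ` ?S r"
  have S: "?S (y # r) = ?A \<union> ?B"
  proof (rule set_eqI)
    fix x :: "nat \<times> nat"
    show "x \<in> ?S (y # r) \<longleftrightarrow> x \<in> ?A \<union> ?B"
      by (cases x; cases "fst x"; cases "snd x") (auto simp: image_iff)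
  qed
  have "prod (?f (y # r)) (?S (y # r)) = prod (?f (y # r)) ?A * prod (?f (y # r)) ?B"
    unfolding S by (rule prod.union_disjoint) (use fin in auto)
  also have "prod (?f (y # r)) ?B = prod (?f r) (?S r)"
    by (subst prod.reindex) (auto simp: inj_on_def intro!: prod.cong)
  also have "prod (?f (y # r)) ?A = (\<Prod>l | l < length r \<and> r ! l < y. sg (ds ! y * ds ! (r ! l)))"
    by (subst prod.reindex) (auto simp: inj_on_def sg_power_int intro!: prod.cong)
  also have "\<dots> = (\<Prod>l<length r. if r ! l < y then sg (ds ! y * ds ! (r ! l)) else 1)"
    by (rule prod.mono_neutral_cong_left) auto
  also have "\<dots> = (\<Prod>z\<leftarrow>r. if z < y then sg (ds ! y * ds ! z) else 1)"
    by (simp add: prod.list_conv_set_nth atLeast0LessThan)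
  finally show ?thesis by (simp add: koszul_def)
qed

lemma koszul_Nil [simp]: "koszul ds [] = 1"
  by (simp add: koszul_def)

lemma prod_list_const_1 [simp]: "(\<Prod>z\<leftarrow>r. 1) = (1 :: 'r::monoid_mult)"
  by (induction r) simp_all

lemma koszul_sorted: "sorted r \<Longrightarrow> koszul ds r = 1"
proof (induction r)
  case (Cons y r)
  then have "(\<Prod>z\<leftarrow>r. if z < y then sg (ds ! y * ds ! z) else 1) = (\<Prod>z\<leftarrow>r. 1 :: 'a)"
    by (intro arg_cong[of _ _ prod_list] map_cong) auto
  then show ?case using Cons by (simp add: koszul_Cons)
qed simp

lemma prod_list_sg: "(\<Prod>z\<leftarrow>zs. sg (c * f z)) = (sg (c * (\<Sum>z\<leftarrow>zs. f z)) :: 'r::ring_1)"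
  by (induction zs) (simp_all add: distrib_left sg_add)

text \<open>All indices in \<open>xs\<close> are below those in \<open>ys\<close>. Starting with the
  head of \<open>xs\<close> thus creates no inversion, while starting with the head of
  \<open>ys\<close> creates one with each remaining index of \<open>xs\<close>, as in the recursion
  of \<open>shuffle\<close>.\<close>

lemma sum_shuffles:
  fixes w :: "(int \<times> 'g) list"
  assumes "sorted_wrt (<) xs" "sorted_wrt (<) ys" "\<And>x y. x \<in> set xs \<Longrightarrow> y \<in> set ys \<Longrightarrow> x < y"
    and "set xs \<union> set ys \<subseteq> {..<length w}"
  shows "(\<Sum>r\<in>shuffles xs ys. Poly_Mapping.single (map ((!) w) r) (koszul (map fst w) r))
    = (shuffle (map ((!) w) xs) (map ((!) w) ys) :: (int \<times> 'g) list \<Rightarrow>\<^sub>0 'k::field)"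
  using assms
proof (induction xs ys rule: shuffles.induct)
  case (1 ys)
  then show ?case by (simp add: koszul_sorted strict_sorted_imp_sorted)
next
  case (2 xs)
  then show ?case by (simp add: koszul_sorted strict_sorted_imp_sorted)
next
  case (3 x xs y ys)
  let ?w = "map ((!) w)" and ?K = "koszul (map fst w)"
  let ?f = "\<lambda>r. Poly_Mapping.single (?w r) (?K r) :: (int \<times> 'g) list \<Rightarrow>\<^sub>0 'k"
  have IH: "sum ?f (shuffles xs (y # ys)) = shuffle (?w xs) (?w (y # ys))"
    "sum ?f (shuffles (x # xs) ys) = shuffle (?w (x # xs)) (?w ys)"
    using 3 by auto
  have single: "Poly_Mapping.single (a # u) (sg n * c) = sg n * (sing [a] * Poly_Mapping.single u c)"
    for a :: "int \<times> 'g" and u n and c :: 'k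
    by (simp add: sg_def sing_mult single_uminus)
  have 1: "?f (x # r) = sing [w ! x] * ?f r" if "r \<in> shuffles xs (y # ys)" for r
  proof -
    have "z \<in> set r \<Longrightarrow> x < z" for z using 3(3-5) that set_shuffles[OF that] by force
    then have "(\<Prod>z\<leftarrow>r. if z < x then sg (map fst w ! x * map fst w ! z) else 1) = (\<Prod>z\<leftarrow>r. 1 :: 'k)"
      by (intro arg_cong[of _ _ prod_list] map_cong) (auto dest: less_asym)
    then have "?K (x # r) = (?K r :: 'k)" unfolding koszul_Cons by (simp only: prod_list_const_1 mult_1)
    then show ?thesis by (simp add: sing_mult)
  qed
  have 2: "?f (y # r) = sg (fst (w ! y) * wdeg (?w (x # xs))) * (sing [w ! y] * ?f r)" if "r \<in> shuffles (x # xs) ys" for r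
  proof -
    let ?g = "\<lambda>z. if z < y then sg (map fst w ! y * map fst w ! z) else 1 :: 'k"
    have "prod_list (map ?g r) = prod_mset (image_mset ?g (mset r))"
      unfolding mset_map[symmetric] prod_mset_prod_list ..
    also have "\<dots> = prod_list (map ?g (x # xs)) * prod_list (map ?g ys)"
      unfolding mset_shuffles[OF that] image_mset_union mset_map[symmetric] prod_mset.union prod_mset_prod_list ..
    also have "map ?g ys = map (\<lambda>_. 1) ys"
      using 3(4) by (auto dest: less_asym)
    also have "map ?g (x # xs) = map (\<lambda>z. sg (fst (w ! y) * fst (w ! z))) (x # xs)"
      using 3(5,6) by (intro map_cong) auto
    also have "prod_list \<dots> = sg (fst (w ! y) * wdeg (?w (x # xs)))"
      by (simp only: prod_list_sg wdeg_def map_map comp_def)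
    finally have "(?K (y # r) :: 'k) = sg (fst (w ! y) * wdeg (?w (x # xs))) * ?K r"
      by (simp add: koszul_Cons)
    then show ?thesis by (simp only: list.map single)
  qed
  have "x < y" using 3 by simp
  then have "sum ?f (shuffles (x # xs) (y # ys)) = sum ?f ((#) x ` shuffles xs (y # ys)) + sum ?f ((#) y ` shuffles (x # xs) ys)"
    by (simp only: shuffles.simps) (rule sum.union_disjoint; auto)
  also have "sum ?f ((#) x ` shuffles xs (y # ys)) = (\<Sum>r\<in>shuffles xs (y # ys). sing [w ! x] * ?f r)"
    by (simp only: sum.reindex[OF inj_on_Cons1] comp_def 1 cong: sum.cong)
  also have "sum ?f ((#) y ` shuffles (x # xs) ys) = (\<Sum>r\<in>shuffles (x # xs) ys. sg (fst (w ! y) * wdeg (?w (x # xs))) * (sing [w ! y] * ?f r))"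
    by (simp only: sum.reindex[OF inj_on_Cons1] comp_def 2 cong: sum.cong)
  finally show ?case
    using IH by (simp flip: sum_distrib_left)
qed

lemma sorted_wrt_filter_iff: "sorted_wrt R (filter P r) \<longleftrightarrow> sorted_wrt (\<lambda>x y. P x \<longrightarrow> P y \<longrightarrow> R x y) r"
  by (induction r) auto

text \<open>The list of values of the inverse of \<sigma> records which original position is read at
  each place. Monotonicity of \<sigma> on a block means that the positions of this block are read in
  increasing order.\<close>

lemma bij_betw_Bat_shuffles:
  "bij_betw (\<lambda>\<sigma>. map (inv \<sigma>) [0..<p + q]) (Bat p q) (shuffles [0..<p] [p..<p + q])"
proof -
  let ?n = "p + q"
  have inj: "inj_on (\<lambda>\<sigma>. map (inv \<sigma>) [0..<?n]) (Bat p q)"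
  proof (rule inj_onI)
    fix \<sigma> \<tau> assume st: "\<sigma> \<in> Bat p q" "\<tau> \<in> Bat p q" "map (inv \<sigma>) [0..<?n] = map (inv \<tau>) [0..<?n]"
    have p: "\<sigma> permutes {..<?n}" "\<tau> permutes {..<?n}" using st by (auto simp: Bat_def)
    have "inv \<sigma> i = inv \<tau> i" for i
    proof (cases "i < ?n")
      case True
      then show ?thesis using st(3) by auto
    next
      case False
      then show ?thesis using permutes_inv[OF p(1)] permutes_inv[OF p(2)] by (metis lessThan_iff permutes_not_in)
    qed
    then have "inv (inv \<sigma>) = inv (inv \<tau>)" by presburger
    then show "\<sigma> = \<tau>" using permutes_inv_inv p by metis
  qed
  have into: "map (inv \<sigma>) [0..<?n] \<in> shuffles [0..<p] [p..<?n]" if "\<sigma> \<in> Bat p q" for \<sigma>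
  proof -
    let ?r = "map (inv \<sigma>) [0..<?n]"
    have p: "\<sigma> permutes {..<?n}" and m: "strict_mono_on {..<p} \<sigma>" "strict_mono_on {p..<?n} \<sigma>"
      using that by (auto simp: Bat_def)
    have set: "set ?r = {..<?n}" using permutes_image[OF permutes_inv[OF p]] by (simp add: atLeast0LessThan)
    have s: "sorted_wrt (\<lambda>x y. \<sigma> x < \<sigma> y) ?r"
      by (simp add: sorted_wrt_map permutes_inverses[OF p])
    have less: "x < y" if "strict_mono_on A \<sigma>" "x \<in> A" "y \<in> A" "\<sigma> x < \<sigma> y" for x y A
      using that by (metis linorder_neqE_nat order.asym strict_mono_on_def)
    have n: "x < ?n" if "x \<in> set ?r" for x using set that by blast
    \<comment> \<open>The list is sorted by the values of \<sigma>, and \<sigma> reflects the order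
      within each block.\<close>
    have "sorted_wrt (<) (filter (\<lambda>x. x < p) ?r)"
      unfolding sorted_wrt_filter_iff by (rule sorted_wrt_mono_rel[OF _ s]) (blast intro: less[OF m(1)])
    moreover have "sorted_wrt (<) (filter (\<lambda>x. \<not> x < p) ?r)"
      unfolding sorted_wrt_filter_iff
    proof (rule sorted_wrt_mono_rel[OF _ s], intro impI)
      fix x y assume "x \<in> set ?r" "y \<in> set ?r" "\<sigma> x < \<sigma> y" "\<not> x < p" "\<not> y < p"
      then show "x < y" using n[of x] n[of y] less[OF m(2), of x y] by simp
    qed
    moreover have "set (filter (\<lambda>x. x < p) ?r) = set [0..<p]" "set (filter (\<lambda>x. \<not> x < p) ?r) = set [p..<?n]"
      using set by auto
    ultimately have "filter (\<lambda>x. x < p) ?r = [0..<p]" "filter (\<lambda>x. \<not> x < p) ?r = [p..<?n]"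
      by (simp_all add: strict_sorted_equal)
    then show ?thesis using partition_in_shuffles[of ?r "\<lambda>x. x < p"] by metis
  qed
  have onto: "\<exists>\<sigma>\<in>Bat p q. r = map (inv \<sigma>) [0..<?n]" if r: "r \<in> shuffles [0..<p] [p..<?n]" for r
  proof -
    have len: "length r = ?n" using length_shuffles[OF r] by simp
    have set: "set r = {..<?n}" using set_shuffles[OF r] by auto
    have dist: "distinct r" using len set by (simp add: card_distinct)
    \<comment> \<open>The shuffle read as a function, made a permutation by the identity outside its
      range; its inverse is the wanted element of \<open>Bat p q\<close>.\<close>
    define \<pi> where "\<pi> i = (if i < ?n then r ! i else i)" for i
    have "bij_betw ((!) r) {..<?n} {..<?n}"
      by (rule bij_betw_nth[OF dist]) (simp_all only: len set)
    then have "bij_betw \<pi> {..<?n} {..<?n}"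
      by (rule bij_betw_cong[THEN iffD1, rotated]) (simp add: \<pi>_def)
    then have p: "\<pi> permutes {..<?n}" by (rule bij_imp_permutes) (simp add: \<pi>_def)
    have f: "filter (\<lambda>x. x < p) r = [0..<p]" "filter (\<lambda>x. \<not> x < p) r = [p..<?n]"
      using filter_shuffles_disjoint1[OF _ r] by (simp_all add: ivl_disj_int)
    have mono: "strict_mono_on A (inv \<pi>)"
      if A: "A \<subseteq> {..<?n}" and P: "\<And>x. x \<in> A \<longleftrightarrow> x < ?n \<and> P x" "sorted_wrt (<) (filter P r)" for A P
    proof (rule strict_mono_onI)
      fix x y assume xy: "x \<in> A" "y \<in> A" "x < y"
      let ?i = "inv \<pi> x" and ?j = "inv \<pi> y"
      have "?i < ?n" "?j < ?n"
        using permutes_in_image[OF permutes_inv[OF p]] xy A by (auto simp: subset_iff)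
      then have i: "?i < ?n" "?j < ?n" "r ! ?i = x" "r ! ?j = y"
        using permutes_inverses(1)[OF p, of x] permutes_inverses(1)[OF p, of y] by (simp_all add: \<pi>_def)
      show "?i < ?j"
      proof (rule ccontr)
        assume "\<not> ?i < ?j"
        then have "?j < ?i" using i xy(3) by (metis linorder_neqE_nat order.irrefl)
        then have "P y \<longrightarrow> P x \<longrightarrow> y < x"
          using sorted_wrt_nth_less[OF sorted_wrt_filter_iff[THEN iffD1, OF P(2)], of ?j ?i] i len by simp
        then show False using P(1) xy by auto
      qed
    qed
    have "strict_mono_on {..<p} (inv \<pi>)" by (rule mono[where P = "\<lambda>x. x < p"]) (auto simp: f)
    moreover have "strict_mono_on {p..<?n} (inv \<pi>)" by (rule mono[where P = "\<lambda>x. \<not> x < p"]) (auto simp: f)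
    ultimately have "inv \<pi> \<in> Bat p q" using permutes_inv[OF p] by (simp add: Bat_def)
    moreover have "r = map (inv (inv \<pi>)) [0..<?n]"
      unfolding permutes_inv_inv[OF p] by (rule nth_equalityI) (simp_all add: len \<pi>_def)
    ultimately show ?thesis by blast
  qed
  show ?thesis
    unfolding bij_betw_def using inj into onto by blast
qed

lemma bat_eq_shuffle:
  assumes "length w = p + q" shows "bat p q w = shuffle (take p w) (drop p w)"
proof -
  have "bat p q w = (\<Sum>r\<in>shuffles [0..<p] [p..<p + q]. Poly_Mapping.single (map ((!) w) r) (koszul (map fst w) r))"
    unfolding bat_def
    by (subst sum.reindex_bij_betw[OF bij_betw_Bat_shuffles, symmetric]) (simp add: comp_def)
  also have "\<dots> = shuffle (map ((!) w) [0..<p]) (map ((!) w) [p..<p + q])"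
    by (rule sum_shuffles) (use assms in auto)
  also have "map ((!) w) [0..<p] = take p w"
    using assms by (intro nth_equalityI) auto
  also have "map ((!) w) [p..<p + q] = drop p w"
    using assms by (intro nth_equalityI) auto
  finally show ?thesis .
qed

text \<open>Only rearrangements of \<open>u @ v\<close> occur in a shuffle, so anything that depends
  on degrees alone may be treated as constant on it.\<close>

lemma lext_shuffle_cong:
  assumes "\<And>w. mset w = mset u + mset v \<Longrightarrow> f w = g w"
  shows "lext f (shuffle u v) = lext g (shuffle u v)"
  using assms
proof (induction u v arbitrary: f g rule: shuffle.induct)
  case (3 a u b v)
  have "lext (\<lambda>w. f (a # w)) (shuffle u (b # v)) = lext (\<lambda>w. g (a # w)) (shuffle u (b # v))"
    "lext (\<lambda>w. f (b # w)) (shuffle (a # u) v) = lext (\<lambda>w. g (b # w)) (shuffle (a # u) v)"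
    by (rule 3(1), rule 3(3), simp) (rule 3(2), rule 3(3), simp)
  then show ?case by (simp add: lext_add lext_scale lext_prefix flip: pscale_sg)
qed simp_all

lemma lext_sing_id: "lext sing p = p"
  using plinear_lext_eq[OF plinear_id] by metis

lemma shuffle_in_subspace:
  assumes "free.subspace T" "\<And>w. mset w = mset u + mset v \<Longrightarrow> sing w \<in> T"
  shows "shuffle u v \<in> T"
proof -
  have "shuffle u v = lext (\<lambda>w. if mset w = mset u + mset v then sing w else 0) (shuffle u v)"
    using lext_shuffle_cong[of u v sing "\<lambda>w. if mset w = mset u + mset v then sing w else 0"] by (simp add: lext_sing_id)
  also have "\<dots> \<in> T" by (rule lext_in_subspace) (use assms free.subspace_0 in auto)
  finally show ?thesis .
qed

lemma wdeg_mset: "mset w = mset u + mset v \<Longrightarrow> wdeg w = wdeg u + wdeg v"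
  unfolding wdeg_def by (metis map_append mset_append mset_map sum_list.append sum_mset_sum_list)

lemma bat_rels_shuffle:
  assumes "r \<in> bat_rels V"
  obtains u v where "r = shuffle u v" "u \<noteq> []" "v \<noteq> []" "u \<in> words V" "v \<in> words V"
proof -
  obtain p q w where r: "r = bat p q w" "0 < p" "0 < q" "w \<in> words V" "length w = p + q"
    using assms unfolding bat_rels_def by blast
  have "take p w \<noteq> []" "drop p w \<noteq> []" using r by auto
  moreover have "take p w \<in> words V" "drop p w \<in> words V" using r(4) append_take_drop_id words_append by metis+
  ultimately show ?thesis using that bat_eq_shuffle r by metis
qed

lemma shuffle_bat_rels:
  assumes "u \<noteq> []" "v \<noteq> []" "u \<in> words V" "v \<in> words V" shows "shuffle u v \<in> bat_rels V"
proof -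
  have "shuffle u v = bat (length u) (length v) (u @ v)" by (subst bat_eq_shuffle) simp_all
  then have "\<exists>p q w. shuffle u v = bat p q w \<and> 0 < p \<and> 0 < q \<and> w \<in> words V \<and> length w = p + q"
    by (intro exI[of _ "length u"] exI[of _ "length v"] exI[of _ "u @ v"]) (use assms in simp)
  then show ?thesis unfolding bat_rels_def by blast
qed

lemma rel_ideal_shuffle: "u \<noteq> [] \<Longrightarrow> v \<noteq> [] \<Longrightarrow> u \<in> words (shift G) \<Longrightarrow> v \<in> words (shift G) \<Longrightarrow> iota i (shuffle u v) \<in> rel_ideal G"
  by (rule rel_ideal_iota) (simp add: shuffle_bat_rels)

section \<open>Stability of the relations under the operations\<close>

lemma lext_cobr_deconc:
  "lext (cobr i j) p - lext (deconc (\<lambda>x y. sg (wdeg x) * (lt i x * lt j y + lt j x * lt i y))) p \<in> rel_ideal G"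
proof -
  have *: "cobr i j w - deconc (\<lambda>x y. sg (wdeg x) * (lt i x * lt j y + lt j x * lt i y)) w \<in> rel_ideal G" for w
  proof -
    let ?f = "\<lambda>m. sg (wdeg (take m w)) * (lt i (take m w) * lt j (drop m w) + lt j (take m w) * lt i (drop m w))"
    have e: "lt i [] \<in> rel_ideal G" "lt j [] \<in> rel_ideal G" by (auto intro!: rel_ideal_invalid simp: valid_def)
    have "{..length w} = {0<..<length w} \<union> {0, length w}" by auto
    then have "deconc (\<lambda>x y. sg (wdeg x) * (lt i x * lt j y + lt j x * lt i y)) w - cobr i j w = sum ?f {0, length w}"
      unfolding deconc_def cobr_def by (simp only:) (subst sum.union_disjoint; simp)
    also have "\<dots> \<in> rel_ideal G"
      by (rule rel_ideal_sum, rule rel_ideal_mult_left, rule rel_ideal_add) (auto simp: e rel_ideal_mult_left rel_ideal_mult_right)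
    finally show ?thesis using rel_ideal_neg by fastforce
  qed
  have "lext (\<lambda>w. cobr i j w - deconc (\<lambda>x y. sg (wdeg x) * (lt i x * lt j y + lt j x * lt i y)) w) p \<in> rel_ideal G"
    by (rule lext_in_subspace[OF subspace_rel_ideal]) (rule *)
  then show ?thesis by (simp add: lext_def free.scale_right_diff_distrib sum_subtractf)
qed

text \<open>All words of a shuffle have the same degree, so the sign leaves the sum.\<close>

lemma bilext_iota:
  "bilext (\<lambda>x y. sg (wdeg x) * (lt i x * lt j y + lt j x * lt i y)) (shuffle u v) q
    = sg (wdeg u + wdeg v) * (iota i (shuffle u v) * iota j q + iota j (shuffle u v) * iota i q)"
proof -
  have "bilext (\<lambda>x y. sg (wdeg x) * (lt i x * lt j y + lt j x * lt i y)) (shuffle u v) q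
    = lext (\<lambda>x. sg (wdeg u + wdeg v) * (lt i x * iota j q + lt j x * iota i q)) (shuffle u v)"
    unfolding bilext_def
    by (rule lext_shuffle_cong) (simp only: wdeg_mset lext_fun_mult_left lext_fun_add iota_def)
  then show ?thesis by (simp only: lext_fun_mult_left lext_fun_add lext_fun_mult_right iota_def)
qed

text \<open>The cobracket may be replaced by full deconcatenation, since the additional cuts contain
  an empty word. The latter splits a shuffle into products of two shuffles, to which the shuffle
  relations apply.\<close>

lemma rel_ideal_cobr_bat:
  fixes G :: "('k::field, 'g::plus) gspace"
  assumes "r \<in> bat_rels (shift G)" shows "lext (cobr i j) r \<in> rel_ideal G"
proof -
  obtain u v where r: "r = shuffle u v" "u \<noteq> []" "v \<noteq> []" "u \<in> words (shift G)" "v \<in> words (shift G)"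
    using assms by (rule bat_rels_shuffle)
  let ?f = "\<lambda>x y. sg (wdeg x) * (lt i x * lt j y + lt j x * lt i y)"
  define A :: "nat \<times> nat \<Rightarrow> ('g slotted list \<Rightarrow>\<^sub>0 'k)" where "A mn = (case mn of (m, n) \<Rightarrow> sg (wdeg (drop m u) * wdeg (take n v)) *
     bilext ?f (shuffle (take m u) (take n v)) (shuffle (drop m u) (drop n v)))" for mn
  have words: "take m u \<in> words (shift G)" "drop m u \<in> words (shift G)"
    "take m v \<in> words (shift G)" "drop m v \<in> words (shift G)" for m
    using r(4,5) append_take_drop_id words_append by metis+
  let ?I = "{..length u} \<times> {..length v}"
  \<comment> \<open>Away from the two exceptional index pairs, both prefixes or both remainders are
    nonempty, so one of the two shuffles is a relation.\<close>
  have A: "A mn \<in> rel_ideal G" if mn: "mn \<in> ?I - {(length u, 0), (0, length v)}" for mn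
  proof -
    obtain m n where mn': "mn = (m, n)" "m \<le> length u" "n \<le> length v" using mn by auto
    have "(0 < m \<and> 0 < n) \<or> (m < length u \<and> n < length v)"
      using mn mn' r(2,3) by auto
    then have "(\<forall>k. iota k (shuffle (take m u) (take n v)) \<in> rel_ideal G) \<or> (\<forall>k. iota k (shuffle (drop m u) (drop n v)) \<in> rel_ideal G)"
    proof
      assume "0 < m \<and> 0 < n"
      then have "iota k (shuffle (take m u) (take n v)) \<in> rel_ideal G" for k
        using r(2,3) words by (intro rel_ideal_shuffle) auto
      then show ?thesis by simp
    next
      assume "m < length u \<and> n < length v"
      then have "iota k (shuffle (drop m u) (drop n v)) \<in> rel_ideal G" for k
        using words by (intro rel_ideal_shuffle) auto
      then show ?thesis by simp
    qed
    then have "iota k (shuffle (take m u) (take n v)) * iota l (shuffle (drop m u) (drop n v)) \<in> rel_ideal G" for k l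
      using rel_ideal_mult_left rel_ideal_mult_right by blast
    then show ?thesis
      unfolding A_def mn'(1) bilext_iota prod.case by (simp add: rel_ideal_mult_left rel_ideal_add)
  qed
  have "lext (deconc ?f) r = (\<Sum>mn\<in>?I. A mn)"
    unfolding r(1) deconc_shuffle A_def by (simp add: sum.cartesian_product)
  also have "\<dots> = A (length u, 0) + A (0, length v) + (\<Sum>mn\<in>?I - {(length u, 0), (0, length v)}. A mn)"
    using r(2,3) by (subst sum.subset_diff[of "{(length u, 0), (0, length v)}"]) (auto simp: add.commute)
  finally have 1: "lext (deconc ?f) r = A (length u, 0) + A (0, length v) + (\<Sum>mn\<in>?I - {(length u, 0), (0, length v)}. A mn)" .
  have c: "lt k u * lt l v - sg (xdeg u * xdeg v) * (lt l v * lt k u) \<in> rel_ideal G" for k l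
    by (rule rel_ideal_comm)
  \<comment> \<open>The exponents \<open>wdeg u * wdeg v + wdeg v\<close> and
    \<open>xdeg u * xdeg v + wdeg u\<close> differ by an odd number. The resulting minus sign turns
    the two terms into graded commutators.\<close>
  have "A (length u, 0) + A (0, length v) =
    sg (wdeg u) * (lt i u * lt j v - sg (xdeg u * xdeg v) * (lt j v * lt i u))
    + sg (wdeg u) * (lt j u * lt i v - sg (xdeg u * xdeg v) * (lt i v * lt j u))"
    by (auto simp: A_def sg_def xdeg_def algebra_simps)
  also have "\<dots> \<in> rel_ideal G" by (intro rel_ideal_add rel_ideal_mult_left c)
  finally have "lext (deconc ?f) r \<in> rel_ideal G"
    unfolding 1 by (rule rel_ideal_add) (rule rel_ideal_sum, rule A)
  from rel_ideal_add[OF lext_cobr_deconc[of i j r] this] show ?thesis by simp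
qed

text \<open>Every defining relation is homogeneous for \<open>xdeg\<close>, so the grading
  involution merely multiplies it by a sign.\<close>

lemma rel_ideal_parity:
  assumes "r \<in> xrels G" shows "hom (parity ldeg) r \<in> rel_ideal G"
  using assms
proof (cases rule: rel_ideal_cases)
  case (1 i j u v)
  have "hom (parity ldeg) r = sg (xdeg u + xdeg v) * r"
    unfolding 1 by (simp add: hom_diff hom_mult sg_def hom_neg algebra_simps)
  moreover have "r \<in> rel_ideal G" unfolding 1 by (rule rel_ideal_comm)
  ultimately show ?thesis by (simp add: rel_ideal_mult_left)
next
  case (2 i r')
  from 2(2) have "\<exists>n. hom (parity ldeg) r = sg n * r"
  proof
    assume "r' \<in> multilin_rels (shift G)"
    then obtain u d w z where r': "r' = ctx u d w z" using multilin_rels_ctx by blast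
    have "hom (parity ldeg) r = lext (\<lambda>x. sg (wdeg u + d + wdeg w - 1) * lt i (u @ (d, x) # w)) z"
      unfolding 2(1) r' ctx_def
      by (simp add: xdeg_def algebra_simps flip: lext_comp[OF plinear_iota] lext_comp[OF plinear_hom])
    also have "\<dots> = sg (wdeg u + d + wdeg w - 1) * r"
      unfolding 2(1) r' ctx_def lext_fun_mult_left
      by (simp flip: lext_comp[OF plinear_iota])
    finally show ?thesis by blast
  next
    assume "r' \<in> bat_rels (shift G)"
    then obtain u v where r': "r' = shuffle u v" by (rule bat_rels_shuffle)
    have "hom (parity ldeg) r = lext (\<lambda>w. hom (parity ldeg) (lt i w)) (shuffle u v)"
      unfolding 2(1) r' iota_def by (rule lext_comp[OF plinear_hom, symmetric])
    also have "\<dots> = lext (\<lambda>w. sg (wdeg u + wdeg v - 1) * lt i w) (shuffle u v)"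
      by (rule lext_shuffle_cong) (simp add: xdeg_def wdeg_mset)
    also have "\<dots> = sg (wdeg u + wdeg v - 1) * r"
      unfolding 2(1) r' iota_def by (rule lext_fun_mult_left)
    finally show ?thesis by blast
  qed
  moreover have "r \<in> rel_ideal G" unfolding 2(1) using 2(2) by (rule rel_ideal_iota)
  ultimately show ?thesis by (auto simp: rel_ideal_mult_left)
next
  case (3 i w)
  then show ?thesis by (simp add: rel_ideal_mult_left rel_ideal_invalid)
qed

lemma rel_ideal_sum_list: "(\<And>i. i \<in> set xs \<Longrightarrow> f i \<in> rel_ideal G) \<Longrightarrow> (\<Sum>i\<leftarrow>xs. f i) \<in> rel_ideal G"
  by (induction xs) (simp_all add: rel_ideal_add)

lemma sum_list_lext: "lext (\<lambda>x. \<Sum>i\<leftarrow>is. f i x) p = (\<Sum>i\<leftarrow>is. lext (f i) p)"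
  by (induction "is") (simp_all add: lext_fun_add, simp add: lext_def)

lemma shom_xrels:
  assumes "r \<in> xrels G" shows "shom E r \<in> rel_ideal G"
  using assms
proof (cases rule: rel_ideal_cases)
  case (1 i j u v)
  have "supercomm G (xdeg u) (xdeg v) (\<Sum>k\<leftarrow>E i. lt k u) (\<Sum>k\<leftarrow>E j. lt k v)"
    by (intro supercomm_sum_list supercomm_lt[THEN supercomm_sym, THEN supercomm_sum_list, THEN supercomm_sym])
  then show ?thesis unfolding 1 by (simp add: supercomm_def hom_diff hom_mult)
next
  case (2 i r')
  have "shom E r = (\<Sum>k\<leftarrow>E i. iota k r')"
    unfolding 2 iota_def lext_comp[OF plinear_hom, symmetric] shom_lt by (rule sum_list_lext)
  then show ?thesis using 2(2) by (simp add: rel_ideal_sum_list rel_ideal_iota)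
next
  case (3 i w)
  then show ?thesis by (simp add: rel_ideal_sum_list rel_ideal_invalid)
qed

lemma shom_rel_ideal: "p \<in> rel_ideal G \<Longrightarrow> shom E p \<in> rel_ideal G"
  unfolding rel_ideal_def by (rule hom_ideal[where S = "xrels G"]) (auto simp flip: rel_ideal_def intro: shom_xrels)

lemma sder_xrels:
  assumes "r \<in> xrels G" shows "sder K E r \<in> rel_ideal G"
  using assms
proof (cases rule: rel_ideal_cases)
  case (1 i j u v)
  let ?k = "\<lambda>i w. \<Sum>(p, q)\<leftarrow>K i. cobr p q w" and ?d = "\<lambda>i w. \<Sum>k\<leftarrow>E i. lt k w"
  have supercomm: "supercomm G (xdeg u - 1) (xdeg v) (?k i u) (?d j v)" for i j u v
    unfolding case_prod_beta
    by (intro supercomm_sum_list supercomm_cobr[THEN supercomm_sym, THEN supercomm_sum_list, THEN supercomm_sym])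
  \<comment> \<open>An odd derivation sends a graded commutator to two graded commutators, in each
    of which one degree is lowered by one.\<close>
  have "sder K E r = (?k i u * ?d j v - sg ((xdeg u - 1) * xdeg v) * (?d j v * ?k i u))
    + sg (xdeg u) * (?d i u * ?k j v - sg (xdeg u * (xdeg v - 1)) * (?k j v * ?d i u))"
    unfolding 1 by (simp add: der_diff der_mult hom_mult) (simp add: sg_def)
  moreover have "?d i u * ?k j v - sg (xdeg u * (xdeg v - 1)) * (?k j v * ?d i u) \<in> rel_ideal G"
    using supercomm_sym[OF supercomm[of v u j i]] unfolding supercomm_def .
  ultimately show ?thesis
    using supercomm[of u v i j] unfolding supercomm_def by (simp only: rel_ideal_add rel_ideal_mult_left)
next
  case (2 i r')
  have "sder K E r = (\<Sum>(p, q)\<leftarrow>K i. lext (cobr p q) r')"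
    unfolding 2 iota_def lext_comp[OF plinear_der, symmetric] sder_lt case_prod_beta by (rule sum_list_lext)
  moreover have "lext (cobr p q) r' \<in> rel_ideal G" for p q using 2(2) rel_ideal_cobr_multilin rel_ideal_cobr_bat by blast
  ultimately show ?thesis by (simp add: case_prod_beta rel_ideal_sum_list)
next
  case (3 i w)
  then show ?thesis by (auto simp: case_prod_beta intro!: rel_ideal_sum_list rel_ideal_cobr_invalid)
qed

lemma sder_rel_ideal: "p \<in> rel_ideal G \<Longrightarrow> sder K E p \<in> rel_ideal G"
  unfolding rel_ideal_def
  by (rule der_ideal[where S = "xrels G"]) (auto simp flip: rel_ideal_def intro: sder_xrels shom_xrels rel_ideal_parity)

section \<open>From the free algebra to tensor powers\<close>

text \<open>A letter over \<open>HH1 G\<close> carries a degree, so relations have to be homogeneous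
  in order to be turned into letters.\<close>

lemma rel_homogeneous:
  assumes "gclosed V" "r \<in> multilin_rels V \<union> bat_rels V"
  shows "\<exists>e. r \<in> wspand V {1..} e"
  using assms(2)
proof
  assume "r \<in> multilin_rels V"
  then show ?thesis
  proof (cases rule: multilin_rels_cases)
    case (add u w d x y)
    then have "r \<in> wspand V {1..} (wdeg u + d + wdeg w)"
      unfolding add(1)
      by (intro free.subspace_diff[OF subspace_wspand] wspand_single) (auto simp: gclosedD[OF assms(1)])
    then show ?thesis ..
  next
    case (scale u w d x c)
    then have "r \<in> wspand V {1..} (wdeg u + d + wdeg w)"
      unfolding scale(1)
      by (intro free.subspace_diff[OF subspace_wspand] free.subspace_scale[OF subspace_wspand] wspand_single)
        (auto simp: gclosedD[OF assms(1)])
    then show ?thesis ..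
  qed
next
  assume "r \<in> bat_rels V"
  then obtain u v where r: "r = shuffle u v" "u \<noteq> []" "v \<noteq> []" "u \<in> words V" "v \<in> words V"
    by (rule bat_rels_shuffle)
  have "sing w \<in> wspand V {1..} (wdeg u + wdeg v)" if w: "mset w = mset u + mset v" for w
  proof (rule wspand_single)
    show "wdeg w = wdeg u + wdeg v" using w by (rule wdeg_mset)
    show "w \<in> words V" using words_mset[of w "u @ v" V] w r by simp
    have "length w = length u + length v" using w by (metis size_mset size_union)
    then show "length w \<in> {1..}" using r(2) by (cases u) auto
  qed
  then have "r \<in> wspand V {1..} (wdeg u + wdeg v)"
    unfolding r(1) by (intro shuffle_in_subspace subspace_wspand)
  then show ?thesis ..
qed

definition gw :: "('k::field, 'g::plus) gspace \<Rightarrow> (int \<times> 'g) list list \<Rightarrow> (int \<times> ('k, 'g) tensor) list" where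
  "gw G ws = map (\<lambda>w. (xdeg w, xcls G w)) ws"

definition gl :: "('k::field, 'g::plus) gspace \<Rightarrow> ((int \<times> 'g) list \<Rightarrow>\<^sub>0 'k) \<Rightarrow> ((int \<times> ('k, 'g) tensor) list \<Rightarrow>\<^sub>0 'k)" where
  "gl G = lext (\<lambda>w. sing [(xdeg w, xcls G w)])"

abbreviation "HH1 G \<equiv> shift (HH G)"
abbreviation "Crel G \<equiv> rel_space (HH1 G) (comm_rels (HH1 G))"
abbreviation "Srel G \<equiv> rel_space (SH G) {}"

lemma SH_eq: "SH G = tensor_quotient (HH1 G) (comm_rels (HH1 G)) {1..}"
  by (simp add: SH_def graded_sym_def)

lemma gclosed_HH1: "gclosed (HH1 G)"
  unfolding HH_def by (intro gclosed_shift gclosed_tensor_quotient)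

lemma gclosed_SH: "gclosed (SH G)"
  unfolding SH_eq by (rule gclosed_tensor_quotient)

lemma gw_simps [simp]: "gw G [] = []" "gw G (w # ws) = (xdeg w, xcls G w) # gw G ws" "gw G (us @ ws) = gw G us @ gw G ws"
  by (simp_all add: gw_def)

lemma length_gw [simp]: "length (gw G ws) = length ws"
  by (simp add: gw_def)

lemma mcls_gw: "mcls G ws = cls (HH1 G) (comm_rels (HH1 G)) (sing (gw G ws))"
  by (simp add: mcls_def gw_def)

lemma xcls_gcomp: "valid G w \<Longrightarrow> xcls G w \<in> gcomp (HH1 G) (xdeg w)"
  unfolding gcomp_shift HH_def gcomp_tensor_quotient xcls_def valid_def xdeg_def
  by (intro imageI wspand_single) (auto simp: Suc_le_eq)

lemma gw_words: "(\<forall>w\<in>set ws. valid G w) \<Longrightarrow> gw G ws \<in> words (HH1 G)"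
  by (induction ws) (auto simp: xcls_gcomp)

lemma wdeg_gw: "wdeg (gw G ws) = mdeg ws"
  by (induction ws) (auto simp: mdeg_def)

lemma mcls_gcomp: "(\<forall>w\<in>set ws. valid G w) \<Longrightarrow> ws \<noteq> [] \<Longrightarrow> mcls G ws \<in> gcomp (SH G) (mdeg ws)"
  unfolding SH_eq gcomp_tensor_quotient mcls_gw
  by (intro imageI wspand_single gw_words) (auto simp: wdeg_gw Suc_le_eq)

lemma plinear_gl: "plinear (gl G)"
  unfolding gl_def by (rule plinear_lext)

lemma gl_sing: "gl G (sing w) = sing [(xdeg w, xcls G w)]"
  by (simp add: gl_def)

lemma valid_generatorE:
  assumes "x \<in> {sing w |w. w \<in> words (shift G) \<and> length w \<in> {1..} \<and> wdeg w = e}"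
  obtains w where "x = sing w" "valid G w" "wdeg w = e"
proof -
  obtain w where w: "x = sing w" "w \<in> words (shift G)" "length w \<in> {1..}" "wdeg w = e" using assms by blast
  then have "valid G w" by (auto simp: valid_def)
  then show ?thesis using that w by blast
qed

text \<open>\<open>gl\<close> is linear by construction, whereas a letter made from a class is
  linear in that class only modulo multilinearity.\<close>

lemma gl_cls:
  assumes "p \<in> wspand (shift G) {1..} (d + 1)"
  shows "gl G p - sing [(d, cls (shift G) (bat_rels (shift G)) p)] \<in> rel_space (HH1 G) R"
proof -
  let ?c = "cls (shift G) (bat_rels (shift G))"
  have "gl G p - sing ([] @ (d, ?c p) # []) \<in> rel_space (HH1 G) R"
  proof (rule single_linear_letter[OF plinear_gl words_Nil words_Nil, where h = ?c])
    show "p \<in> free.span {sing w |w. w \<in> words (shift G) \<and> length w \<in> {1..} \<and> wdeg w = d + 1}"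
      using assms unfolding wspand_def .
    show "gl G b - sing ([] @ [(d, ?c b)]) \<in> rel_space (HH1 G) R"
      if "b \<in> {sing w |w. w \<in> words (shift G) \<and> length w \<in> {1..} \<and> wdeg w = d + 1}" for b
      using that by (auto simp: gl_sing xcls_def xdeg_def)
    show "?c p \<in> gcomp (HH1 G) d"
      if "p \<in> free.span {sing w |w. w \<in> words (shift G) \<and> length w \<in> {1..} \<and> wdeg w = d + 1}" for p
      using that unfolding gcomp_shift HH_def gcomp_tensor_quotient wspand_def by (rule imageI)
    show "?c (p + q) = ?c p + ?c q" for p q by (simp add: cls_add)
    show "?c (pscale c p) = scl (HH1 G) c (?c p)" for c p by (simp add: HH_def)
  qed
  then show ?thesis by simp
qed

text \<open>The class of a relation is 0 times a class, and a letter of this form is a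
  multilinearity relation.\<close>

lemma gl_rel:
  assumes "gclosed (shift G)" "r \<in> multilin_rels (shift G) \<union> bat_rels (shift G)"
  shows "gl G r \<in> rel_space (HH1 G) R"
proof -
  obtain e where "r \<in> wspand (shift G) {1..} e" using rel_homogeneous[OF assms] by blast
  then have r: "r \<in> wspand (shift G) {1..} ((e - 1) + 1)" by simp
  let ?c = "cls (shift G) (bat_rels (shift G))"
  have "?c r = ?c 0" using rel_space_base[OF assms(2)] by (simp add: cls_eq_iff)
  then have "?c r = scl (HH1 G) 0 (?c 0)" by (simp add: HH_def)
  moreover have "?c 0 \<in> gcomp (HH1 G) (e - 1)"
    unfolding gcomp_shift HH_def gcomp_tensor_quotient by (intro imageI free.subspace_0[OF subspace_wspand])
  ultimately have "sing [(e - 1, ?c r)] \<in> rel_space (HH1 G) R"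
    using sing_zero_letter[of "[]" "HH1 G" "[]" "?c 0" "e - 1" R] by simp
  from rel_space_add[OF gl_cls[OF r] this] show ?thesis by simp
qed

subsection \<open>Sorting the letters by tensor factors\<close>

definition slotw :: "nat \<Rightarrow> 'g slotted list \<Rightarrow> (int \<times> 'g) list list" where
  "slotw i L = map snd (filter (\<lambda>x. fst x = i) L)"

text \<open>The Koszul sign of the stable sort by tensor factors: a letter is exchanged with exactly
  those later letters whose factor is strictly smaller.\<close>

fun ssgn :: "'g slotted list \<Rightarrow> 'k::field" where
  "ssgn [] = 1"
| "ssgn (x # L) = sg (ldeg x * (\<Sum>y\<leftarrow>L. if fst y < fst x then ldeg y else 0)) * ssgn L"

text \<open>Equality with \<open>{..<n}\<close> excludes both letters outside the first
  \<open>n\<close> factors and empty factors.\<close>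

definition okw :: "('k, 'g) gspace \<Rightarrow> nat \<Rightarrow> 'g slotted list \<Rightarrow> bool" where
  "okw G n L \<longleftrightarrow> fst ` set L = {..<n} \<and> (\<forall>x\<in>set L. valid G (snd x))"

definition nlet :: "('k::field, 'g::plus) gspace \<Rightarrow> 'g slotted list \<Rightarrow> nat \<Rightarrow> int \<times> ('k, ('k, 'g) tensor) tensor" where
  "nlet G L i = (mdeg (slotw i L), mcls G (slotw i L))"

text \<open>The map \<open>nu\<close> drops words with an empty tensor factor, since \<open>S\<^sup>+(\<H>[1])\<close> has no unit.\<close>

definition nu :: "('k::field, 'g::plus) gspace \<Rightarrow> nat \<Rightarrow> ('g slotted list \<Rightarrow>\<^sub>0 'k) \<Rightarrow> ((int \<times> ('k, ('k, 'g) tensor) tensor) list \<Rightarrow>\<^sub>0 'k)" where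
  "nu G n = lext (\<lambda>L. if okw G n L then Poly_Mapping.single (map (nlet G L) [0..<n]) (ssgn L) else 0)"

lemma plinear_nu: "plinear (nu G n)"
  unfolding nu_def by (rule plinear_lext)

lemma nu_single: "nu G n (Poly_Mapping.single L c) = pscale c (if okw G n L then Poly_Mapping.single (map (nlet G L) [0..<n]) (ssgn L) else 0)"
  by (simp add: nu_def)

lemma slotw_simps [simp]: "slotw i [] = []" "slotw i (x # L) = (if fst x = i then snd x # slotw i L else slotw i L)"
  "slotw i (L @ L') = slotw i L @ slotw i L'"
  by (simp_all add: slotw_def)

lemma slotw_valid: "okw G n L \<Longrightarrow> w \<in> set (slotw i L) \<Longrightarrow> valid G w"
  by (auto simp: okw_def slotw_def)

lemma slotw_nonempty: "okw G n L \<Longrightarrow> i < n \<Longrightarrow> slotw i L \<noteq> []"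
  by (auto simp: okw_def slotw_def filter_empty_conv) (metis imageE lessThan_iff)

lemma nlet_gcomp: "okw G n L \<Longrightarrow> i < n \<Longrightarrow> nlet G L i \<in> {(d, v). v \<in> gcomp (SH G) d}"
  unfolding nlet_def by (auto intro!: mcls_gcomp dest: slotw_valid slotw_nonempty)

lemma nlets_words: "okw G n L \<Longrightarrow> set is \<subseteq> {..<n} \<Longrightarrow> map (nlet G L) is \<in> words (SH G)"
  using nlet_gcomp[of G n L] by (fastforce simp: words_def)

lemma nu_wspan: "nu G n p \<in> wspan (SH G) {n}"
  unfolding nu_def
  by (rule lext_in_subspace[OF subspace_wspan])
    (auto intro!: wspan_single nlets_words free.subspace_0[OF subspace_wspan])

text \<open>The letters of \<open>L\<close> see what follows only through the total degree below
  each factor.\<close>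

lemma ssgn_append_cong:
  assumes "ssgn M = (c :: 'k::field) * ssgn M'"
    "\<And>i. (\<Sum>y\<leftarrow>M. if fst y < i then ldeg y else 0) = (\<Sum>y\<leftarrow>M'. if fst y < i then ldeg y else 0)"
  shows "ssgn (L @ M) = c * ssgn (L @ M')"
  by (induction L) (simp_all add: assms)

lemma okw_swap: "okw G n (L1 @ x # y # L2) = okw G n (L1 @ y # x # L2)"
  unfolding okw_def by (auto simp: insert_commute)

lemma upt_split: "i < n \<Longrightarrow> [0..<n] = [0..<i] @ i # [Suc i..<n]"
  using upt_add_eq_append[of 0 i "n - i"] by (simp add: upt_conv_Cons)

lemma mcls_swap:
  assumes "\<forall>w\<in>set (A @ u # v # B). valid G w"
  shows "mcls G (A @ u # v # B) = scl (SH G) (sg (xdeg u * xdeg v)) (mcls G (A @ v # u # B))"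
proof -
  have "sing (gw G A @ [(xdeg u, xcls G u), (xdeg v, xcls G v)] @ gw G B)
      - Poly_Mapping.single (gw G A @ [(xdeg v, xcls G v), (xdeg u, xcls G u)] @ gw G B) ((-1) powi (xdeg u * xdeg v)) \<in> comm_rels (HH1 G)"
    using assms by (intro comm_relI) (auto simp: gw_words xcls_gcomp)
  then have "sing (gw G (A @ u # v # B)) - pscale (sg (xdeg u * xdeg v)) (sing (gw G (A @ v # u # B))) \<in> Crel G"
    by (intro rel_space_base) (simp add: sg_power_int)
  then show ?thesis by (simp add: mcls_gw SH_eq cls_eq_iff del: pscale_single)
qed

text \<open>The sign has two sources. For letters of different factors it is the change of
  \<open>ssgn\<close>; for letters of the same factor \<open>ssgn\<close> is unchanged and the sign
  comes from commutativity inside \<open>SH G\<close>, then leaves the letter by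
  multilinearity.\<close>

lemma nu_swap:
  fixes G :: "('k::field, 'g::plus) gspace"
  shows "nu G n (sing (L1 @ x # y # L2)) - sg (ldeg x * ldeg y) * nu G n (sing (L1 @ y # x # L2)) \<in> Srel G"
proof (cases "okw G n (L1 @ x # y # L2)")
  case False
  then show ?thesis by (simp add: nu_single okw_swap[of G n L1 x y])
next
  case ok: True
  then have ok': "okw G n (L1 @ y # x # L2)" by (simp add: okw_swap)
  let ?L = "L1 @ x # y # L2" and ?L' = "L1 @ y # x # L2"
  show ?thesis
  proof (cases "fst x = fst y")
    case False
    have "ssgn ?L = (sg (ldeg x * ldeg y) :: 'k) * ssgn ?L'"
      by (rule ssgn_append_cong) (use False in \<open>auto simp: sg_def algebra_simps\<close>)
    moreover have "nlet G ?L = nlet G ?L'"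
      using False by (auto simp: nlet_def fun_eq_iff)
    ultimately have "nu G n (sing ?L) = sg (ldeg x * ldeg y) * nu G n (sing ?L')"
      using ok ok' by (simp add: nu_single flip: pscale_sg)
    then show ?thesis by simp
  next
    case True
    have s: "ssgn ?L = (1 :: 'k) * ssgn ?L'"
      by (rule ssgn_append_cong) (use True in \<open>auto simp: sg_def algebra_simps\<close>)
    let ?i = "fst x" and ?s = "sg (ldeg x * ldeg y) :: 'k"
    have i: "?i < n" using ok by (auto simp: okw_def)
    let ?P = "map (nlet G ?L') [0..<?i]" and ?Q = "map (nlet G ?L') [Suc ?i..<n]" and ?d = "mdeg (slotw ?i ?L')"
    have "map (nlet G ?L) [0..<n] = ?P @ (?d, scl (SH G) ?s (mcls G (slotw ?i ?L'))) # ?Q"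
    proof -
      have "nlet G ?L k = nlet G ?L' k" if "k \<noteq> ?i" for k
        using that True by (simp add: nlet_def)
      moreover have "mcls G (slotw ?i ?L) = scl (SH G) ?s (mcls G (slotw ?i ?L'))"
        using True mcls_swap[of "slotw ?i L1" "snd x" "snd y" "slotw ?i L2" G] slotw_valid[OF ok, of _ ?i]
        by (auto simp: ldeg_def)
      moreover have "mdeg (slotw ?i ?L) = ?d" using True by (simp add: mdeg_def)
      ultimately show ?thesis using i by (simp add: upt_split nlet_def)
    qed
    moreover have "map (nlet G ?L') [0..<n] = ?P @ (?d, mcls G (slotw ?i ?L')) # ?Q"
      using i by (simp add: upt_split nlet_def)
    ultimately have *: "nu G n (sing ?L) - sg (ldeg x * ldeg y) * nu G n (sing ?L') =
      pscale (ssgn ?L') (sing (?P @ (?d, scl (SH G) ?s (mcls G (slotw ?i ?L'))) # ?Q) - pscale ?s (sing (?P @ (?d, mcls G (slotw ?i ?L')) # ?Q)))"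
      using ok ok' s by (simp add: nu_single free.scale_right_diff_distrib mult.commute flip: pscale_sg)
    have **: "sing (?P @ (?d, scl (SH G) ?s (mcls G (slotw ?i ?L'))) # ?Q) - pscale ?s (sing (?P @ (?d, mcls G (slotw ?i ?L')) # ?Q)) \<in> multilin_rels (SH G)"
    proof (rule multilin_scale)
      show "?P \<in> words (SH G)" "?Q \<in> words (SH G)" by (rule nlets_words[OF ok']; use i in auto)+
      show "mcls G (slotw ?i ?L') \<in> gcomp (SH G) ?d" using nlet_gcomp[OF ok' i] by (simp add: nlet_def)
    qed
    show ?thesis unfolding * by (intro rel_space_scale rel_space_base UnI1 **)
  qed
qed

text \<open>In a fixed context only the letter of factor \<open>i\<close> varies, and it depends
  linearly on \<open>r\<close>. Since \<open>r\<close> is homogeneous, the sorting sign is the same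
  for all its words, so everything reduces to the vanishing of one class.\<close>

lemma nu_iota:
  assumes G: "gclosed (shift G)" and r: "r \<in> multilin_rels (shift G) \<union> bat_rels (shift G)"
  shows "nu G n (sing L1 * iota i r * sing L2) \<in> Srel G"
proof -
  obtain e where e: "r \<in> wspand (shift G) {1..} e" using rel_homogeneous[OF assms] by blast
  let ?B = "{sing w |w. w \<in> words (shift G) \<and> length w \<in> {1..} \<and> wdeg w = e} :: ((int \<times> 'b) list \<Rightarrow>\<^sub>0 'a) set"
  let ?L = "\<lambda>w. L1 @ (i, w) # L2"
  define F where "F p = nu G n (sing L1 * iota i p * sing L2)" for p
  have F: "plinear F"
    unfolding F_def by (intro plinear_compose[OF plinear_nu] plinear_mult_left plinear_mult_right plinear_iota)
  have F_sing: "F (sing w) = nu G n (sing (?L w))" for w by (simp add: F_def lt_def sing_mult)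
  show ?thesis
  \<comment> \<open>If no word completes the context, \<open>nu\<close> is zero on all of them;
    otherwise one completing word fixes the letters of the other factors.\<close>
  proof (cases "\<exists>w. okw G n (?L w)")
    case False
    have "F r \<in> {0}"
      by (rule plinear_span[OF F free.subspace_single_0 _ e[unfolded wspand_def]]) (use False in \<open>auto simp: F_sing nu_single\<close>)
    then show ?thesis by (simp add: F_def)
  next
    case True
    then obtain w0 where w0: "okw G n (?L w0)" by blast
    have ok: "okw G n (?L w)" if "valid G w" for w using w0 that by (auto simp: okw_def)
    have i: "i < n" using w0 by (auto simp: okw_def)
    \<comment> \<open>Only the degree of the inserted word enters the sign, so a one-letter word of
      degree \<open>e\<close> serves as a model.\<close>
    define s :: 'a where "s = ssgn (L1 @ (i, replicate 1 (e, undefined)) # L2)"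
    have s: "ssgn (?L w) = s" if "wdeg w = e" for w
    proof -
      have "ssgn (?L w) = 1 * s"
        unfolding s_def by (rule ssgn_append_cong) (use that in \<open>auto simp: ldeg_def xdeg_def\<close>)
      then show ?thesis by simp
    qed
    have s2: "s * s = 1"
    proof -
      have "ssgn L * ssgn L = (1 :: 'a)" for L :: "'b slotted list"
        by (induction L) (simp_all add: sg_def)
      then show ?thesis unfolding s_def .
    qed
    let ?A = "slotw i L1" and ?C = "slotw i L2"
    let ?d = "mdeg ?A + (e - 1) + mdeg ?C"
    let ?P = "map (nlet G (?L w0)) [0..<i]" and ?Q = "map (nlet G (?L w0)) [Suc i..<n]"
    have PQ: "?P \<in> words (SH G)" "?Q \<in> words (SH G)" by (rule nlets_words[OF w0]; use i in auto)+
    define H where "H p = sing (gw G ?A) * gl G p * sing (gw G ?C)" for p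
    have H: "plinear H" unfolding H_def by (intro plinear_mult_left plinear_mult_right plinear_gl)
    define h where "h p = cls (HH1 G) (comm_rels (HH1 G)) (H p)" for p
    have AC: "gw G ?A \<in> words (HH1 G)" "gw G ?C \<in> words (HH1 G)"
      using slotw_valid[OF w0, of _ i] by (auto intro!: gw_words)
    have letters: "map (nlet G (?L w)) [0..<n] = ?P @ (?d, h (sing w)) # ?Q" if "wdeg w = e" for w
    proof -
      have "nlet G (?L w) k = nlet G (?L w0) k" if "k \<noteq> i" for k using that by (simp add: nlet_def)
      moreover have "nlet G (?L w) i = (?d, h (sing w))"
        using that by (simp add: nlet_def h_def H_def gl_sing sing_mult mcls_gw mdeg_def xdeg_def)
      ultimately show ?thesis using i by (simp add: upt_split)
    qed
    have Hspan: "H p \<in> wspand (HH1 G) {1..} ?d" if "p \<in> free.span ?B" for p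
    proof (rule plinear_span[OF H subspace_wspand _ that])
      fix x assume "x \<in> ?B"
      then obtain w where w: "x = sing w" "valid G w" "wdeg w = e" by (rule valid_generatorE)
      show "H x \<in> wspand (HH1 G) {1..} ?d"
        using AC w xcls_gcomp[OF w(2)]
        by (auto simp: H_def w(1) gl_sing sing_mult wdeg_gw xdeg_def intro!: wspand_single)
    qed
    have "pscale s (F r) - sing (?P @ (?d, h r) # ?Q) \<in> Srel G"
    proof (rule single_linear_letter[OF plinear_pscale[OF F] PQ, where h = h])
      show "r \<in> free.span ?B" using e by (simp add: wspand_def)
      show "h p \<in> gcomp (SH G) ?d" if "p \<in> free.span ?B" for p
        using Hspan[OF that] unfolding h_def SH_eq gcomp_tensor_quotient by (rule imageI)
      show "h (p + q) = h p + h q" for p q by (simp add: h_def cls_add plinear_add[OF H])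
      show "h (pscale c p) = scl (SH G) c (h p)" for c p by (simp add: h_def SH_eq plinear_scale[OF H])
      fix b assume "b \<in> ?B"
      then obtain w where w: "b = sing w" "valid G w" "wdeg w = e" by (rule valid_generatorE)
      show "pscale s (F b) - sing (?P @ (?d, h b) # ?Q) \<in> Srel G"
        using ok[OF w(2)] s[OF w(3)] letters[OF w(3)] by (simp add: w(1) F_sing nu_single s2)
    qed
    \<comment> \<open>The class in factor \<open>i\<close> is zero, and a zero letter makes the
      whole tensor a relation.\<close>
    moreover have "sing (?P @ (?d, h r) # ?Q) \<in> Srel G"
    proof -
      have "H r \<in> Crel G"
        unfolding H_def by (intro rel_space_mult_words word_stable_comm_rels AC gl_rel[OF G r])
      then have "h r = cls (HH1 G) (comm_rels (HH1 G)) 0" by (simp add: h_def cls_eq_iff)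
      then have "h r = scl (SH G) 0 (h 0)" by (simp add: h_def SH_eq plinear_0[OF H])
      moreover have "h 0 \<in> gcomp (SH G) ?d"
        unfolding h_def SH_eq gcomp_tensor_quotient using Hspan[OF free.span_zero] by (rule imageI)
      ultimately show ?thesis using sing_zero_letter[OF PQ] by metis
    qed
    ultimately have "pscale s (F r) \<in> Srel G" using rel_space_add by fastforce
    then have "pscale s (pscale s (F r)) \<in> Srel G" by (rule rel_space_scale)
    then show ?thesis by (simp add: s2 F_def)
  qed
qed

lemma nu_rel_ideal:
  assumes "gclosed (shift G)" "p \<in> rel_ideal G" shows "nu G n p \<in> Srel G"
proof (rule plinear_span[OF plinear_nu subspace_rel_space _ assms(2)[unfolded rel_ideal_def ideal_def]])
  fix x assume "x \<in> {sing u * r * sing w |u r w. r \<in> xrels G}"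
  then obtain L1 r L2 where x: "x = sing L1 * r * sing L2" and "r \<in> xrels G" by blast
  from this(2) show "nu G n x \<in> Srel G"
  proof (cases rule: rel_ideal_cases)
    case (1 i j u v)
    have "x = sing (L1 @ (i, u) # (j, v) # L2) - sg (xdeg u * xdeg v) * sing (L1 @ (j, v) # (i, u) # L2)"
      unfolding x 1 lt_def by (simp add: sing_mult sg_def left_diff_distrib right_diff_distrib distrib_left distrib_right)
    then show ?thesis
      using nu_swap[of G n L1 "(i, u)" "(j, v)" L2]
      by (simp add: plinear_diff[OF plinear_nu] plinear_sg[OF plinear_nu] ldeg_def)
  next
    case (2 i r')
    then show ?thesis unfolding x by (simp only: nu_iota assms(1))
  next
    case (3 i w)
    then show ?thesis by (simp add: x lt_def sing_mult nu_single okw_def)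
  qed
qed

subsection \<open>Reduction to words sorted by tensor factors\<close>

lemma rel_ideal_swap: "sing (L1 @ x # y # L2) - sg (ldeg x * ldeg y) * sing (L1 @ y # x # L2) \<in> rel_ideal G"
proof -
  have "sing L1 * (lt (fst x) (snd x) * lt (fst y) (snd y)
      - sg (xdeg (snd x) * xdeg (snd y)) * (lt (fst y) (snd y) * lt (fst x) (snd x))) * sing L2 \<in> rel_ideal G"
    by (intro rel_ideal_mult_left rel_ideal_mult_right rel_ideal_comm)
  also have "sing L1 * (lt (fst x) (snd x) * lt (fst y) (snd y)
      - sg (xdeg (snd x) * xdeg (snd y)) * (lt (fst y) (snd y) * lt (fst x) (snd x))) * sing L2
    = sing (L1 @ x # y # L2) - sg (ldeg x * ldeg y) * sing (L1 @ y # x # L2)"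
    by (simp add: lt_def ldeg_def sing_mult left_diff_distrib right_diff_distrib distrib_left distrib_right sg_def)
  finally show ?thesis .
qed

lemma rel_ideal_insort:
  assumes "sorted (map fst L)"
  shows "\<exists>L' n. sorted (map fst L') \<and> fst ` set L' = insert (fst x) (fst ` set L) \<and> sing (x # L) - sg n * sing L' \<in> rel_ideal G"
  using assms
proof (induction L)
  case Nil
  show ?case by (rule exI[of _ "[x]"], rule exI[of _ 0]) simp
next
  case (Cons y L)
  show ?case
  proof (cases "fst x \<le> fst y")
    case True
    with Cons.prems show ?thesis
      by (intro exI[of _ "x # y # L"] exI[of _ 0]) auto
  next
    case False
    obtain L' n where L': "sorted (map fst L')" "fst ` set L' = insert (fst x) (fst ` set L)"
      "sing (x # L) - sg n * sing L' \<in> rel_ideal G"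
      using Cons by auto
    have "sing (x # y # L) - sg (ldeg x * ldeg y + n) * sing (y # L')
        = (sing (x # y # L) - sg (ldeg x * ldeg y) * sing (y # x # L))
          + sg (ldeg x * ldeg y) * (sing [y] * (sing (x # L) - sg n * sing L'))"
      by (simp add: sg_def sing_mult distrib_left right_diff_distrib)
    also have "\<dots> \<in> rel_ideal G"
      using rel_ideal_swap[of "[]" x y L G] L'(3) by (intro rel_ideal_add rel_ideal_mult_left) simp_all
    finally show ?thesis
      using L'(1,2) False Cons.prems
      by (intro exI[of _ "y # L'"] exI[of _ "ldeg x * ldeg y + n"]) auto
  qed
qed

lemma rel_ideal_sort: "\<exists>L' n. sorted (map fst L') \<and> sing L - sg n * sing L' \<in> rel_ideal G"
proof (induction L)
  case Nil
  show ?case by (rule exI[of _ "[]"], rule exI[of _ 0]) simp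
next
  case (Cons x L)
  obtain L' n where L': "sorted (map fst L')" "sing L - sg n * sing L' \<in> rel_ideal G"
    using Cons by blast
  obtain L'' m where L'': "sorted (map fst L'')" "sing (x # L') - sg m * sing L'' \<in> rel_ideal G"
    using rel_ideal_insort[OF L'(1)] by blast
  have "sing (x # L) - sg (n + m) * sing L''
      = sing [x] * (sing L - sg n * sing L') + sg n * (sing (x # L') - sg m * sing L'')"
    by (simp add: sg_def sing_mult right_diff_distrib distrib_left)
  also have "\<dots> \<in> rel_ideal G" using L'(2) L''(2) by (intro rel_ideal_add rel_ideal_mult_left)
  finally show ?case using L''(1) by blast
qed

text \<open>Modulo the ideal every word is a signed sorted word, and on sorted words
  \<open>nu\<close> has no sign. Linear statements compatible with the ideal are therefore checked
  on sorted words only.\<close>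

lemma sorted_reduction:
  assumes "plinear T" "free.subspace S" "\<And>p. p \<in> rel_ideal G \<Longrightarrow> T p \<in> S" "\<And>L. sorted (map fst L) \<Longrightarrow> T (sing L) \<in> S"
  shows "T p \<in> S"
proof -
  have "T (sing L) \<in> S" for L
  proof -
    obtain L' n where L': "sorted (map fst L')" "sing L - sg n * sing L' \<in> rel_ideal G" using rel_ideal_sort by blast
    have "T (sing L) = T (sing L - sg n * sing L') + pscale (sg n) (T (sing L'))"
      by (simp add: plinear_diff[OF assms(1)] plinear_scale[OF assms(1)] flip: pscale_sg del: pscale_single)
    then show ?thesis using L' assms by (simp add: free.subspace_add free.subspace_scale)
  qed
  then have "lext (\<lambda>L. T (sing L)) p \<in> S" by (intro lext_in_subspace assms(2))
  then show ?thesis using plinear_lext_eq[OF assms(1)] by metis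
qed

definition slots :: "nat \<Rightarrow> (int \<times> 'g) list list \<Rightarrow> 'g slotted list" where
  "slots i P = map (Pair i) P"

lemma slots_simps [simp]: "slots i [] = []" "slots i (w # P) = (i, w) # slots i P" "slots i (P @ Q) = slots i P @ slots i Q"
  "fst ` set (slots i P) = (if P = [] then {} else {i})" "snd ` set (slots i P) = set P"
  by (cases P; auto simp: slots_def image_image)+

lemma slotw_slots [simp]: "slotw i (slots j P) = (if i = j then P else [])"
  by (induction P) auto

lemma slotw_eq_Nil: "slotw i L = [] \<longleftrightarrow> i \<notin> fst ` set L"
  by (auto simp: slotw_def filter_empty_conv)

lemma sorted_split_slots:
  "sorted (map fst L) \<Longrightarrow> fst ` set L \<subseteq> {..<n} \<Longrightarrow> L = concat (map (\<lambda>i. slots i (slotw i L)) [0..<n])"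
proof (induction n arbitrary: L)
  case 0
  then show ?case by simp
next
  case (Suc n)
  let ?A = "filter (\<lambda>x. fst x < n) L" and ?B = "filter (\<lambda>x. \<not> fst x < n) L"
  have "L = ?A @ ?B"
    using Suc.prems(1)
  proof (induction L)
    case (Cons x L)
    show ?case
    proof (cases "fst x < n")
      case False
      then have "filter (\<lambda>x. fst x < n) L = []" "filter (\<lambda>x. \<not> fst x < n) L = L"
        using Cons.prems by (auto simp: filter_empty_conv filter_id_conv)
      then show ?thesis using False by simp
    qed (use Cons in simp)
  qed simp
  moreover have "?B = slots n (slotw n L)"
    using Suc.prems(2)
  proof (induction L)
    case (Cons x L)
    then show ?case by (cases x) auto
  qed simp
  moreover have "?A = concat (map (\<lambda>i. slots i (slotw i ?A)) [0..<n])"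
    by (rule Suc.IH) (use Suc.prems(1) sorted_filter[of fst L] in auto)
  moreover have "slotw i ?A = slotw i L" if "i < n" for i
    using that by (auto simp: slotw_def intro!: arg_cong[of _ _ "map snd"] filter_cong)
  ultimately have "L = concat (map (\<lambda>i. slots i (slotw i L)) [0..<n]) @ slots n (slotw n L)"
    by (metis (no_types, lifting) atLeastLessThan_iff map_cong set_upt)
  then show ?case by simp
qed

subsection \<open>Support\<close>

text \<open>Tracks which tensor factors can occur, in order to recognise what \<open>nu\<close>
  discards.\<close>

definition lsp :: "nat set \<Rightarrow> ('g slotted list \<Rightarrow>\<^sub>0 'k::field) set" where
  "lsp S = free.span {sing L | L. fst ` set L \<subseteq> S}"

lemma subspace_lsp: "free.subspace (lsp S)"
  unfolding lsp_def by (rule free.subspace_span)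

lemma lsp_sing: "fst ` set L \<subseteq> S \<Longrightarrow> sing L \<in> lsp S"
  unfolding lsp_def by (rule free.span_base) blast

lemma lsp_plinear:
  assumes "plinear F" "free.subspace T" "\<And>L. fst ` set L \<subseteq> S \<Longrightarrow> F (sing L) \<in> T" "p \<in> lsp S"
  shows "F p \<in> T"
  by (rule plinear_span[OF assms(1,2) _ assms(4)[unfolded lsp_def]]) (use assms(3) in blast)

lemma lsp_mult: "p \<in> lsp S \<Longrightarrow> q \<in> lsp S \<Longrightarrow> p * q \<in> lsp S"
proof -
  assume p: "p \<in> lsp S" and q: "q \<in> lsp S"
  have "sing L * q \<in> lsp S" if "fst ` set L \<subseteq> S" for L
    by (rule lsp_plinear[OF plinear_mult_right[OF plinear_id] subspace_lsp _ q])
      (use that in \<open>simp add: sing_mult lsp_sing image_Un\<close>)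
  then show ?thesis
    by (rule lsp_plinear[OF plinear_mult_left[OF plinear_id] subspace_lsp _ p])
qed

lemma lsp_sg: "p \<in> lsp S \<Longrightarrow> sg n * p \<in> lsp S"
  using free.subspace_scale[OF subspace_lsp] by (metis pscale_sg)

lemma lsp_sum_list: "(\<And>i. i \<in> set xs \<Longrightarrow> f i \<in> lsp S) \<Longrightarrow> (\<Sum>i\<leftarrow>xs. f i) \<in> lsp S"
  by (induction xs) (auto intro: free.subspace_add[OF subspace_lsp] free.subspace_0[OF subspace_lsp])

lemma lsp_lt: "i \<in> S \<Longrightarrow> lt i w \<in> lsp S"
  unfolding lt_def by (rule lsp_sing) simp

lemma lsp_cobr: "i \<in> S \<Longrightarrow> j \<in> S \<Longrightarrow> cobr i j w \<in> lsp S"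
  unfolding cobr_def
  by (intro free.subspace_sum[OF subspace_lsp] lsp_sg free.subspace_add[OF subspace_lsp] lsp_mult lsp_lt)

lemma lsp_dlt: "set (E (fst x)) \<subseteq> S \<Longrightarrow> dlt E x \<in> lsp S"
  unfolding dlt_def by (intro lsp_sum_list lsp_lt) auto

lemma lsp_klt: "set (K (fst x)) \<subseteq> S \<times> S \<Longrightarrow> klt K x \<in> lsp S"
  unfolding klt_def by (rule lsp_sum_list) (auto intro!: lsp_cobr)

lemma lsp_shom: "(\<And>i. i \<in> fst ` set L \<Longrightarrow> set (E i) \<subseteq> S) \<Longrightarrow> shom E (sing L) \<in> lsp S"
proof (induction L)
  case Nil
  then show ?case by (simp add: hom_sing one_eq_sing lsp_sing)
next
  case (Cons x L)
  then show ?case by (auto simp: hom_sing intro!: lsp_mult lsp_dlt)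
qed

lemma lsp_sder:
  fixes L :: "'g slotted list"
  assumes "\<And>i. i \<in> fst ` set L \<Longrightarrow> set (E i) \<subseteq> S \<and> set (K i) \<subseteq> S \<times> S"
  shows "(sder K E (sing L) :: 'g slotted list \<Rightarrow>\<^sub>0 'k::field) \<in> lsp S"
  using assms
proof (induction L)
  case Nil
  then show ?case by (simp add: der_sing free.subspace_0[OF subspace_lsp])
next
  case (Cons x L)
  let ?T = "lsp S :: ('g slotted list \<Rightarrow>\<^sub>0 'k) set"
  have "sder K E (sing L) \<in> ?T" by (rule Cons.IH) (use Cons.prems in auto)
  then have "klt K x * shom E (sing L) \<in> ?T" "dlt E x * sder K E (sing L) \<in> ?T"
    using Cons.prems by (auto intro!: lsp_mult lsp_klt lsp_shom lsp_dlt)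
  then show ?case
    by (simp add: der_sing mult.assoc free.subspace_add[OF subspace_lsp] lsp_sg)
qed

lemma nu_lsp_0: "p \<in> lsp S \<Longrightarrow> \<not> {..<n} \<subseteq> S \<Longrightarrow> nu G n p = 0"
proof -
  assume p: "p \<in> lsp S" "\<not> {..<n} \<subseteq> S"
  have "nu G n p \<in> {0}"
    by (rule lsp_plinear[OF plinear_nu free.subspace_single_0 _ p(1)]) (use p(2) in \<open>auto simp: nu_single okw_def\<close>)
  then show ?thesis by simp
qed

lemma shom_eq_0: "x \<in> set L \<Longrightarrow> E (fst x) = [] \<Longrightarrow> shom E (sing L) = 0"
  by (induction L) (auto simp: hom_sing dlt_def)

lemma sder_eq_0: "x \<in> set L \<Longrightarrow> E (fst x) = [] \<Longrightarrow> K (fst x) = [] \<Longrightarrow> sder K E (sing L) = 0"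
proof (induction L)
  case (Cons y L)
  show ?case
  proof (cases "x = y")
    case True
    then show ?thesis using Cons.prems by (simp add: der_sing dlt_def klt_def)
  next
    case False
    then have "x \<in> set L" using Cons.prems by simp
    then show ?thesis using Cons by (simp add: der_sing shom_eq_0)
  qed
qed simp

lemma sder_eq_0': "(\<And>x. x \<in> set L \<Longrightarrow> K (fst x) = []) \<Longrightarrow> sder K E (sing L) = 0"
  by (induction L) (auto simp: der_sing klt_def)

lemma derw_cong:
  assumes "\<And>x. x \<in> set w \<Longrightarrow> k x = k' x \<and> d x = d' x"
  shows "derw deg k d w = derw deg k' d' w" "hom d (sing w) = hom d' (sing w)"
  using assms by (induction w) (auto simp: hom_sing)

lemma shom_slots: "shom E (sing (slots i P)) = sing (slots j P)" if "E i = [j]"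
  using that by (induction P) (auto simp: hom_sing dlt_def lt_def sing_mult simp flip: one_eq_sing)

lemma sing_rel_ideal_invalid:
  fixes G :: "('k::field, 'g::plus) gspace"
  assumes "x \<in> set L" "\<not> valid G (snd x)" shows "sing L \<in> rel_ideal G"
proof -
  obtain L1 L2 where "L = L1 @ x # L2" using assms(1) split_list by fastforce
  then have "sing L = sing L1 * (lt (fst x) (snd x) * (sing L2 :: 'g slotted list \<Rightarrow>\<^sub>0 'k))" by (simp add: lt_def sing_mult)
  moreover have "\<dots> \<in> rel_ideal G" by (intro rel_ideal_mult_left[of "_ * _"] rel_ideal_mult_right rel_ideal_invalid assms(2))
  ultimately show ?thesis by simp
qed

lemma mdeg_slots: "(\<Sum>x\<leftarrow>slots i P. ldeg x) = mdeg P"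
  by (induction P) (auto simp: mdeg_def ldeg_def)

lemma ssgn_sorted: "sorted (map fst L) \<Longrightarrow> ssgn L = 1"
proof (induction L)
  case (Cons x L)
  then have "(\<Sum>y\<leftarrow>L. if fst y < fst x then ldeg y else 0) = (\<Sum>y\<leftarrow>L. 0)"
    by (intro arg_cong[of _ _ sum_list] map_cong) auto
  then show ?case using Cons by simp
qed simp

lemma sorted_slots: "sorted (map fst (slots n Q))"
  by (induction Q) (auto simp: slots_def)

text \<open>Letters of the highest factor standing at the right end are already in place, so no sign
  arises.\<close>

lemma nu_mult_slots:
  fixes G :: "('k::field, 'g::plus) gspace"
  assumes "p \<in> lsp {..<n}" "Q \<noteq> []" "\<forall>w\<in>set Q. valid G w"
  shows "nu G (Suc n) (p * sing (slots n Q)) = nu G n p * sing [(mdeg Q, mcls G Q)]"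
proof -
  have "nu G (Suc n) (p * sing (slots n Q)) - nu G n p * sing [(mdeg Q, mcls G Q)] \<in> {0}"
  proof (rule lsp_plinear[OF _ free.subspace_single_0 _ assms(1)])
    show "plinear (\<lambda>p. nu G (Suc n) (p * sing (slots n Q)) - nu G n p * sing [(mdeg Q, mcls G Q)])"
      by (intro plinear_minus plinear_compose[OF plinear_nu plinear_mult_left[OF plinear_id]] plinear_mult_left[OF plinear_nu])
    fix L :: "'g slotted list" assume L: "fst ` set L \<subseteq> {..<n}"
    have "n \<notin> fst ` set L" using L by auto
    then have "insert n (fst ` set L) = {..<Suc n} \<longleftrightarrow> fst ` set L = {..<n}"
      unfolding lessThan_Suc by (simp add: insert_ident)
    moreover have "fst ` set (L @ slots n Q) = insert n (fst ` set L)"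
      using assms(2) by (simp add: image_Un)
    moreover have "(\<forall>x\<in>set (L @ slots n Q). valid G (snd x)) \<longleftrightarrow> (\<forall>x\<in>set L. valid G (snd x))"
      using assms(3) by (simp add: slots_def ball_Un)
    ultimately have "okw G (Suc n) (L @ slots n Q) \<longleftrightarrow> okw G n L"
      by (simp only: okw_def)
    moreover have "ssgn (L @ slots n Q) = (ssgn L :: 'k)"
      using L
    proof (induction L)
      case Nil
      then show ?case by (simp add: ssgn_sorted sorted_slots)
    next
      case (Cons x L)
      have "(\<Sum>y\<leftarrow>slots n Q. if fst y < fst x then ldeg y else 0) = 0"
        using Cons.prems by (simp add: slots_def comp_def)
      then show ?case using Cons by simp
    qed
    moreover have "map (nlet G (L @ slots n Q)) [0..<Suc n] = map (nlet G L) [0..<n] @ [(mdeg Q, mcls G Q)]"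
      using \<open>n \<notin> fst ` set L\<close> slotw_eq_Nil[of n L] by (simp add: nlet_def)
    ultimately show "nu G (Suc n) (sing L * sing (slots n Q)) - nu G n (sing L) * sing [(mdeg Q, mcls G Q)] \<in> {0}"
      by (simp add: sing_mult nu_single del: upt_Suc)
  qed
  then show ?thesis by simp
qed

definition up :: "'g slotted list \<Rightarrow> 'g slotted list" where
  "up L = map (\<lambda>x. (Suc (fst x), snd x)) L"

lemma shom_up: "shom (\<lambda>i. [Suc i]) (sing L) = sing (up L)"
  by (induction L) (auto simp: up_def hom_sing dlt_def lt_def sing_mult simp flip: one_eq_sing)

lemma slotw_up [simp]: "slotw (Suc i) (up L) = slotw i L" "slotw 0 (up L) = []"
  by (induction L) (auto simp: up_def)

lemma ssgn_up: "ssgn (slots 0 P @ up L) = (ssgn L :: 'k::field)"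
proof -
  have "ssgn (up L) = (ssgn L :: 'k)"
    by (induction L) (simp_all add: up_def comp_def ldeg_def cong: if_cong)
  moreover have "ssgn (slots 0 P @ up L) = (ssgn (up L) :: 'k)"
    by (induction P) (simp_all add: comp_def)
  ultimately show ?thesis by simp
qed

lemma okw_up:
  assumes "P \<noteq> []" "\<forall>w\<in>set P. valid G w"
  shows "okw G (Suc n) (slots 0 P @ up L) \<longleftrightarrow> okw G n L"
proof -
  have "fst ` set (slots 0 P @ up L) = insert 0 (Suc ` fst ` set L)"
    using assms(1) by (simp add: image_Un image_image up_def)
  moreover have "insert 0 (Suc ` A) = {..<Suc n} \<longleftrightarrow> A = {..<n}" for A
    unfolding lessThan_Suc_eq_insert_0 by (metis Zero_not_Suc image_iff inj_Suc inj_image_eq_iff insert_ident)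
  moreover have "(\<forall>x\<in>set (slots 0 P @ up L). valid G (snd x)) \<longleftrightarrow> (\<forall>x\<in>set L. valid G (snd x))"
    using assms(2) by (simp add: slots_def up_def ball_Un)
  ultimately show ?thesis by (simp only: okw_def)
qed

text \<open>The mirror image: with all other labels raised by one, the letters of factor 0 at the
  left end are in place.\<close>

lemma nu_slots_mult:
  fixes G :: "('k::field, 'g::plus) gspace"
  assumes "P \<noteq> []" "\<forall>w\<in>set P. valid G w"
  shows "nu G (Suc n) (sing (slots 0 P) * shom (\<lambda>i. [Suc i]) p) = sing [(mdeg P, mcls G P)] * nu G n p"
proof (rule plinear_eqI[where F = "\<lambda>p. nu G (Suc n) (sing (slots 0 P) * shom (\<lambda>i. [Suc i]) p)"
      and H = "\<lambda>p. sing [(mdeg P, mcls G P)] * nu G n p"])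
  show "plinear (\<lambda>p. nu G (Suc n) (sing (slots 0 P) * shom (\<lambda>i. [Suc i]) p))"
    by (rule plinear_compose[OF plinear_nu plinear_mult_right[OF plinear_hom]])
  show "plinear (\<lambda>p. sing [(mdeg P, mcls G P)] * nu G n p)"
    by (rule plinear_mult_right[OF plinear_nu])
  fix L :: "'g slotted list"
  have "map (nlet G (slots 0 P @ up L)) [0..<Suc n] = (mdeg P, mcls G P) # map (nlet G L) [0..<n]"
    by (simp add: upt_conv_Cons[OF zero_less_Suc] nlet_def comp_def del: upt_Suc flip: map_Suc_upt)
  then show "nu G (Suc n) (sing (slots 0 P) * shom (\<lambda>i. [Suc i]) (sing L)) = sing [(mdeg P, mcls G P)] * nu G n (sing L)"
    by (auto simp: shom_up sing_mult nu_single okw_up[OF assms] ssgn_up simp del: upt_Suc)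
qed

section \<open>The coproduct and the cobracket on \<open>S\<^sup>+(\<H>[1])\<close>\<close>

lemma plinear_rel_space:
  assumes "plinear F" "free.subspace T" "\<And>r. r \<in> multilin_rels V \<Longrightarrow> F r \<in> T" "\<And>r. r \<in> R \<Longrightarrow> F r \<in> T"
    and "p \<in> rel_space V R"
  shows "F p \<in> T"
  by (rule plinear_span[OF assms(1,2) _ assms(5)[unfolded rel_space_def]]) (use assms(3,4) in blast)

lemma iota_rel: "p \<in> rel_space (shift G) (bat_rels (shift G)) \<Longrightarrow> iota i p \<in> rel_ideal G"
  by (rule plinear_rel_space[OF plinear_iota subspace_rel_ideal]) (auto intro: rel_ideal_iota)

lemma supercomm_iota:
  fixes G :: "('k::field, 'g::plus) gspace"
  assumes "p \<in> wspand (shift G) {1..} (a + 1)" "q \<in> wspand (shift G) {1..} (b + 1)"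
  shows "supercomm G a b (iota i p) (iota j q)"
proof -
  have "iota i p * lt j v - sg (a * b) * (lt j v * iota i p) \<in> rel_ideal G" if v: "wdeg v = b + 1" for v
  proof (rule plinear_span[OF _ subspace_rel_ideal _ assms(1)[unfolded wspand_def]])
    show "plinear (\<lambda>p. iota i p * lt j v - sg (a * b) * (lt j v * iota i p))"
      by (intro plinear_minus plinear_mult_left plinear_mult_right plinear_iota)
    fix x :: "(int \<times> 'g) list \<Rightarrow>\<^sub>0 'k" assume "x \<in> {sing w |w. w \<in> words (shift G) \<and> length w \<in> {1..} \<and> wdeg w = a + 1}"
    then obtain u where "x = sing u" "wdeg u = a + 1" by (rule valid_generatorE)
    then show "iota i x * lt j v - sg (a * b) * (lt j v * iota i x) \<in> rel_ideal G"
      using supercomm_lt[of G u v i j] v by (simp add: supercomm_def xdeg_def)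
  qed
  note * = this
  have "iota i p * iota j q - sg (a * b) * (iota j q * iota i p) \<in> rel_ideal G"
  proof (rule plinear_span[OF _ subspace_rel_ideal _ assms(2)[unfolded wspand_def]])
    show "plinear (\<lambda>q. iota i p * iota j q - sg (a * b) * (iota j q * iota i p))"
      by (intro plinear_minus plinear_mult_left plinear_mult_right plinear_iota)
    fix x :: "(int \<times> 'g) list \<Rightarrow>\<^sub>0 'k" assume "x \<in> {sing w |w. w \<in> words (shift G) \<and> length w \<in> {1..} \<and> wdeg w = b + 1}"
    then obtain v where "x = sing v" "wdeg v = b + 1" by (rule valid_generatorE)
    then show "iota i p * iota j x - sg (a * b) * (iota j x * iota i p) \<in> rel_ideal G"
      using * by simp
  qed
  then show ?thesis by (simp add: supercomm_def)
qed

section \<open>Lifting from S^+ to the free algebra\<close>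

definition rep :: "('k::field, 'g::plus) gspace \<Rightarrow> int \<Rightarrow> ('k, 'g) tensor \<Rightarrow> ((int \<times> 'g) list \<Rightarrow>\<^sub>0 'k)" where
  "rep G d v = (SOME p. p \<in> wspand (shift G) {1..} (d + 1) \<and> v = cls (shift G) (bat_rels (shift G)) p)"

lemma rep:
  assumes "v \<in> gcomp (HH1 G) d"
  shows "rep G d v \<in> wspand (shift G) {1..} (d + 1)" "cls (shift G) (bat_rels (shift G)) (rep G d v) = v"
proof -
  have "\<exists>p. p \<in> wspand (shift G) {1..} (d + 1) \<and> v = cls (shift G) (bat_rels (shift G)) p"
    using assms unfolding gcomp_shift HH_def gcomp_tensor_quotient by blast
  from someI_ex[OF this] show "rep G d v \<in> wspand (shift G) {1..} (d + 1)"
    "cls (shift G) (bat_rels (shift G)) (rep G d v) = v"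
    unfolding rep_def by auto
qed

definition lift :: "('k::field, 'g::plus) gspace \<Rightarrow> ((int \<times> ('k, 'g) tensor) list \<Rightarrow>\<^sub>0 'k) \<Rightarrow> ('g slotted list \<Rightarrow>\<^sub>0 'k)" where
  "lift G = hom (\<lambda>(d, v). iota 0 (rep G d v))"

lemma plinear_lift: "plinear (lift G)"
  unfolding lift_def by (rule plinear_hom)

lemma lift_mult: "lift G (p * q) = lift G p * lift G q"
  unfolding lift_def by (rule hom_mult)

lemma lift_letter [simp]: "lift G (sing [(d, v)]) = iota 0 (rep G d v)"
  by (simp add: lift_def)

text \<open>The choices made by \<open>rep\<close> are not linear, but two representatives of the
  same class differ by relations, which \<open>iota\<close> sends into the ideal.\<close>

lemma lift_rel: 
  assumes p: "p \<in> Crel G" shows "lift G p \<in> rel_ideal G"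
proof (rule plinear_rel_space[OF plinear_lift subspace_rel_ideal _ _ p])
  let ?c = "cls (shift G) (bat_rels (shift G))"
  have iota_eq: "iota 0 q - iota 0 q' \<in> rel_ideal G" if "?c q = ?c q'" for q q'
    using that iota_rel[of "q - q'" G 0] by (simp add: cls_eq_iff plinear_diff[OF plinear_iota])
  fix r assume "r \<in> multilin_rels (HH1 G)"
  then show "lift G r \<in> rel_ideal G"
  proof (cases rule: multilin_rels_cases)
    case (add u w d x y)
    have xy: "x + y \<in> gcomp (HH1 G) d" using gclosedD(1)[OF gclosed_HH1] add by blast
    have r: "r = sing u * (sing [(d, x + y)] - sing [(d, x)] - sing [(d, y)]) * sing w"
      by (simp add: add(1) left_diff_distrib right_diff_distrib sing_mult)
    have "?c (rep G d (x + y)) = ?c (rep G d x + rep G d y)"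
      using rep[OF xy] rep[OF add(4)] rep[OF add(5)] by (simp flip: cls_add)
    from iota_eq[OF this] have "lift G (sing [(d, x + y)] - sing [(d, x)] - sing [(d, y)]) \<in> rel_ideal G"
      by (simp add: plinear_diff[OF plinear_lift] plinear_add[OF plinear_lift] plinear_add[OF plinear_iota] diff_diff_eq)
    then show ?thesis unfolding r lift_mult by (intro rel_ideal_mult_left rel_ideal_mult_right)
  next
    case (scale u w d x c)
    have cx: "scl (HH1 G) c x \<in> gcomp (HH1 G) d" using gclosedD(2)[OF gclosed_HH1] scale by blast
    have r: "r = sing u * (sing [(d, scl (HH1 G) c x)] - pscale c (sing [(d, x)])) * sing w"
      by (simp add: scale(1) left_diff_distrib right_diff_distrib sing_mult)
    have "?c (rep G d (scl (HH1 G) c x)) = scl (HH1 G) c (?c (rep G d x))"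
      using rep(2)[OF cx] rep(2)[OF scale(4)] by simp
    also have "\<dots> = ?c (pscale c (rep G d x))" by (simp add: HH_def)
    finally have "?c (rep G d (scl (HH1 G) c x)) = ?c (pscale c (rep G d x))" .
    from iota_eq[OF this] have "lift G (sing [(d, scl (HH1 G) c x)] - pscale c (sing [(d, x)])) \<in> rel_ideal G"
      by (simp add: plinear_diff[OF plinear_lift] plinear_scale[OF plinear_lift] plinear_scale[OF plinear_iota] del: pscale_single)
    then show ?thesis unfolding r lift_mult by (intro rel_ideal_mult_left rel_ideal_mult_right)
  qed
next
  fix r assume "r \<in> comm_rels (HH1 G)"
  then obtain u w a x b y where r: "r = sing (u @ [(a, x), (b, y)] @ w)
        - Poly_Mapping.single (u @ [(b, y), (a, x)] @ w) ((-1) powi (a * b))"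
      "u \<in> words (HH1 G)" "w \<in> words (HH1 G)" "x \<in> gcomp (HH1 G) a" "y \<in> gcomp (HH1 G) b"
    unfolding comm_rels_def by blast
  have "r = sing u * (sing [(a, x)] * sing [(b, y)] - pscale (sg (a * b)) (sing [(b, y)] * sing [(a, x)])) * sing w"
    by (simp add: r(1) left_diff_distrib right_diff_distrib sing_mult sg_power_int)
  moreover have "lift G (sing [(a, x)] * sing [(b, y)] - pscale (sg (a * b)) (sing [(b, y)] * sing [(a, x)])) \<in> rel_ideal G"
    using supercomm_iota[OF rep(1)[OF r(4)] rep(1)[OF r(5)], of 0 0]
    by (simp only: supercomm_def plinear_diff[OF plinear_lift] plinear_scale[OF plinear_lift] lift_mult lift_letter pscale_sg[symmetric])
  ultimately show "lift G r \<in> rel_ideal G" by (simp only: lift_mult rel_ideal_mult_left rel_ideal_mult_right)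
qed

text \<open>The word itself and the representative chosen for its class differ by relations, letter
  by letter.\<close>

lemma lift_gw:
  fixes G :: "('k::field, 'g::plus) gspace"
  assumes "\<forall>w\<in>set ws. valid G w" shows "lift G (sing (gw G ws)) - sing (slots 0 ws) \<in> rel_ideal G"
proof -
  have *: "lift G (sing (gw G ws)) = hom (\<lambda>w. iota 0 (rep G (xdeg w) (xcls G w))) (sing ws)"
    by (simp add: lift_def hom_sing gw_def comp_def)
  have **: "(sing (slots 0 ws) :: 'g slotted list \<Rightarrow>\<^sub>0 'k) = hom (lt 0) (sing ws)"
  proof (induction ws)
    case (Cons w ws)
    then show ?case
      unfolding slots_simps sing_Cons[of "(0, w)" "slots 0 ws"] by (simp add: hom_sing lt_def)
  qed (simp add: hom_sing one_eq_sing)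
  have "iota 0 (rep G (xdeg w) (xcls G w)) - lt 0 w \<in> ideal (xrels G)" if "w \<in> set ws" for w
  proof -
    have "rep G (xdeg w) (xcls G w) - sing w \<in> rel_space (shift G) (bat_rels (shift G))"
      using rep(2)[OF xcls_gcomp[of G w]] assms that by (simp add: xcls_def cls_eq_iff)
    from iota_rel[OF this, of 0] show ?thesis by (simp add: plinear_diff[OF plinear_iota] rel_ideal_def)
  qed
  then show ?thesis
    unfolding * ** rel_ideal_def by (rule hom_cong_ideal)
qed

lemma monomials_iff: "ws \<in> monomials G \<longleftrightarrow> ws \<noteq> [] \<and> (\<forall>w\<in>set ws. valid G w)"
  by (auto simp: monomials_def valid_def)

lemma gw_wspan: "(\<forall>w\<in>set ws. valid G w) \<Longrightarrow> sing (gw G ws) \<in> wspan (HH1 G) {length ws}"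
  by (intro wspan_base gw_words) simp_all

lemma gl_wspan: "p \<in> wspand (shift G) {1..} (d + 1) \<Longrightarrow> gl G p \<in> wspan (HH1 G) {1}"
  unfolding wspand_def
  by (erule plinear_span[OF plinear_gl subspace_wspan, rotated])
    (erule valid_generatorE, auto simp: gl_sing xcls_gcomp intro!: wspan_base)

text \<open>A homogeneous class over \<open>HH G\<close> is a combination of classes of single
  words, and multilinearity expands each letter accordingly. This gives uniqueness for maps
  prescribed on monomials.\<close>

lemma words_by_monomials:
  fixes G :: "('k::field, 'g::plus) gspace"
  assumes "w \<in> words (HH1 G)"
  shows "\<exists>q \<in> free.span {sing (gw G ws) |ws. (\<forall>x\<in>set ws. valid G x) \<and> length ws = length w}. sing w - q \<in> Crel G"
  using assms
proof (induction w)
  case Nil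
  have *: "sing [] \<in> free.span {sing (gw G ws) |ws. (\<forall>x\<in>set ws. valid G x) \<and> length ws = length []}"
    by (rule free.span_base) simp
  show ?case by (rule bexI[OF _ *]) simp
next
  case (Cons a w)
  obtain d v where a: "a = (d, v)" by (cases a)
  let ?S = "\<lambda>n. {sing (gw G ws) |ws. (\<forall>x\<in>set ws. valid G x) \<and> length ws = n} :: ((int \<times> ('k, 'g) tensor) list \<Rightarrow>\<^sub>0 'k) set"
  have v: "v \<in> gcomp (HH1 G) d" and w: "w \<in> words (HH1 G)" using Cons.prems by (simp_all add: a)
  obtain q where q: "q \<in> free.span (?S (length w))" "sing w - q \<in> Crel G" using Cons.IH w by blast
  let ?g = "gl G (rep G d v)"
  have "?g * q \<in> free.span (?S (length (a # w)))"
  proof (rule plinear_span[OF plinear_mult_left[OF plinear_gl] free.subspace_span _ rep(1)[OF v, unfolded wspand_def]])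
    fix x :: "(int \<times> 'g) list \<Rightarrow>\<^sub>0 'k"
    assume "x \<in> {sing w |w. w \<in> words (shift G) \<and> length w \<in> {1..} \<and> wdeg w = d + 1}"
    then obtain u where u: "x = sing u" "valid G u" by (rule valid_generatorE)
    show "gl G x * q \<in> free.span (?S (length (a # w)))"
    proof (rule plinear_span[OF plinear_mult_right[OF plinear_id] free.subspace_span _ q(1)])
      fix y :: "(int \<times> ('k, 'g) tensor) list \<Rightarrow>\<^sub>0 'k" assume "y \<in> ?S (length w)"
      then obtain ws where "y = sing (gw G ws)" "\<forall>x\<in>set ws. valid G x" "length ws = length w" by blast
      then show "gl G x * y \<in> free.span (?S (length (a # w)))"
        by (intro free.span_base) (auto simp: u gl_sing sing_mult intro!: exI[of _ "u # ws"])
    qed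
  qed
  moreover have "sing (a # w) - ?g * q \<in> Crel G"
  proof -
    \<comment> \<open>Telescoping: the tail is replaced first, then the head letter.\<close>
    have "sing (a # w) - ?g * q = ?g * (sing w - q) - (?g - sing [(d, v)]) * sing w"
      by (simp add: a algebra_simps sing_mult)
    moreover have "?g * (sing w - q) \<in> Crel G"
      by (rule rel_space_mult_left[OF word_stable_comm_rels q(2)])
        (rule gl_wspan[OF rep(1)[OF v]])
    moreover have "(?g - sing [(d, v)]) * sing w \<in> Crel G"
      using gl_cls[OF rep(1)[OF v]] rep(2)[OF v] w
      by (intro rel_space_mult_right[OF word_stable_comm_rels, where L = UNIV] wspan_base) simp_all
    ultimately show ?thesis by (simp only: rel_space_diff)
  qed
  ultimately show ?case by blast
qed

lemma wspan_by_monomials: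
  assumes "p \<in> wspan (HH1 G) {1..}"
  shows "\<exists>q \<in> free.span ((\<lambda>ws. sing (gw G ws)) ` monomials G). p - q \<in> Crel G"
proof -
  let ?S = "free.span ((\<lambda>ws. sing (gw G ws)) ` monomials G)"
  have "p \<in> {p. \<exists>q \<in> ?S. p - q \<in> Crel G}"
  proof (rule plinear_wspan[OF plinear_id _ _ assms])
    show "free.subspace {p. \<exists>q \<in> ?S. p - q \<in> Crel G}"
    proof (rule free.subspaceI)
      show "0 \<in> {p. \<exists>q \<in> ?S. p - q \<in> Crel G}" by (auto intro: bexI[of _ 0] free.span_zero)
    next
      fix x y assume "x \<in> {p. \<exists>q \<in> ?S. p - q \<in> Crel G}" "y \<in> {p. \<exists>q \<in> ?S. p - q \<in> Crel G}"
      then obtain q q' where "q \<in> ?S" "x - q \<in> Crel G" "q' \<in> ?S" "y - q' \<in> Crel G" by blast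
      moreover have "x + y - (q + q') = (x - q) + (y - q')" by simp
      ultimately show "x + y \<in> {p. \<exists>q \<in> ?S. p - q \<in> Crel G}"
        using free.span_add rel_space_add by (metis (mono_tags, lifting) mem_Collect_eq)
    next
      fix c x assume "x \<in> {p. \<exists>q \<in> ?S. p - q \<in> Crel G}"
      then obtain q where "q \<in> ?S" "x - q \<in> Crel G" by blast
      then show "pscale c x \<in> {p. \<exists>q \<in> ?S. p - q \<in> Crel G}"
        using free.span_scale rel_space_scale
        by (metis (mono_tags, lifting) free.scale_right_diff_distrib mem_Collect_eq)
    qed
    fix w assume w: "w \<in> words (HH1 G)" "length w \<in> {1..}"
    obtain q where q: "q \<in> free.span {sing (gw G ws) |ws. (\<forall>x\<in>set ws. valid G x) \<and> length ws = length w}"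
      "sing w - q \<in> Crel G"
      using words_by_monomials[OF w(1)] by blast
    have "{sing (gw G ws) |ws. (\<forall>x\<in>set ws. valid G x) \<and> length ws = length w} \<subseteq> (\<lambda>ws. sing (gw G ws)) ` monomials G"
      using w(2) by (fastforce simp: monomials_iff)
    then have "q \<in> ?S" using q(1) free.span_mono by blast
    then show "sing w \<in> {p. \<exists>q \<in> ?S. p - q \<in> Crel G}" using q(2) by blast
  qed
  then show ?thesis by blast
qed

text \<open>Identifies a map prescribed on monomials with the one induced by \<open>D\<close> on the
  free algebra. The hypothesis on \<open>h\<close> is the comparison of signs, which the last
  section supplies for \<Delta> and \<kappa>.\<close>

lemma SH_extension:
  assumes G: "gclosed (shift G)"
    and D: "plinear D" "\<And>p. p \<in> rel_ideal G \<Longrightarrow> D p \<in> rel_ideal G"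
    and h: "\<And>ws. ws \<in> monomials G \<Longrightarrow> nu G 2 (D (sing (slots 0 ws))) - h ws \<in> Srel G"
  defines "f \<equiv> linear_extension (SH G) (tensor_power (SH G) 2) {(mcls G ws, cls (SH G) {} (h ws)) | ws. ws \<in> monomials G}"
  shows "p \<in> wspan (HH1 G) {1..} \<Longrightarrow> f (cls (HH1 G) (comm_rels (HH1 G)) p) = cls (SH G) {} (nu G 2 (D (lift G p)))"
    and "glinear (SH G) (tensor_power (SH G) 2) f"
    and "ws \<in> monomials G \<Longrightarrow> f (mcls G ws) = cls (SH G) {} (nu G 2 (D (sing (slots 0 ws))))"
proof -
  let ?\<Gamma> = "{(mcls G ws, cls (SH G) {} (h ws)) | ws. ws \<in> monomials G}"
  have \<Gamma>: "?\<Gamma> = (\<lambda>ws. (cls (HH1 G) (comm_rels (HH1 G)) (sing (gw G ws)), cls (SH G) {} (h ws))) ` monomials G"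
    by (auto simp: mcls_gw)
  have F: "plinear (\<lambda>p. nu G 2 (D (lift G p)))"
    by (rule plinear_compose[OF plinear_nu plinear_compose[OF D(1) plinear_lift]])
  have lift_eq: "nu G 2 (D (lift G (sing (gw G ws)))) - nu G 2 (D (sing (slots 0 ws))) \<in> Srel G"
    if "ws \<in> monomials G" for ws
    using nu_rel_ideal[OF G D(2)[OF lift_gw[of ws G]], of 2] that
    by (simp add: monomials_iff plinear_diff[OF plinear_nu] plinear_diff[OF D(1)])
  note ext = linear_extension_cls[OF F _ _ _ _ _ \<Gamma>, where L = "{1..}" and L' = "{2}", folded SH_eq]
  have rel: "nu G 2 (D (lift G p)) \<in> Srel G" if "p \<in> Crel G" for p
    by (intro nu_rel_ideal G D(2) lift_rel that)
  have gen: "sing (gw G ws) \<in> wspan (HH1 G) {1..}" if "ws \<in> monomials G" for ws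
    using that wspan_mono[of "{length ws}" "{1..}"] gw_wspan[of ws G] by (auto simp: monomials_iff Suc_le_eq)
  have gh: "nu G 2 (D (lift G (sing (gw G ws)))) - h ws \<in> Srel G" if "ws \<in> monomials G" for ws
    using rel_space_trans[OF lift_eq[OF that] h[OF that]] .
  show 1: "f (cls (HH1 G) (comm_rels (HH1 G)) p) = cls (SH G) {} (nu G 2 (D (lift G p)))" if "p \<in> wspan (HH1 G) {1..}" for p
    unfolding f_def by (rule ext(1)) (use rel gen gh wspan_by_monomials that nu_wspan in auto)
  show "glinear (SH G) (tensor_power (SH G) 2) f"
    unfolding f_def by (rule ext(2)) (use rel gen gh wspan_by_monomials nu_wspan in auto)
  show "f (mcls G ws) = cls (SH G) {} (nu G 2 (D (sing (slots 0 ws))))" if "ws \<in> monomials G"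
    unfolding mcls_gw 1[OF gen[OF that]] using lift_eq[OF that] by (simp add: cls_eq_iff)
qed

section \<open>Operations on tensor powers\<close>

text \<open>In a tensor power the words are themselves the generators, so an assignment on words
  descends as soon as it is multilinear modulo relations.\<close>

lemma tensor_extension:
  fixes V :: "('k::field, 'v::plus) gspace"
  assumes V: "gclosed V"
    and span: "\<And>w. w \<in> words V \<Longrightarrow> length w = n \<Longrightarrow> \<Phi> w \<in> wspan V {m}"
    and add: "\<And>u w d x y. u \<in> words V \<Longrightarrow> w \<in> words V \<Longrightarrow> x \<in> gcomp V d \<Longrightarrow> y \<in> gcomp V d \<Longrightarrow> Suc (length u + length w) = n \<Longrightarrow>
      \<Phi> (u @ (d, x + y) # w) - \<Phi> (u @ (d, x) # w) - \<Phi> (u @ (d, y) # w) \<in> rel_space V {}"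
    and scale: "\<And>u w d x c. u \<in> words V \<Longrightarrow> w \<in> words V \<Longrightarrow> x \<in> gcomp V d \<Longrightarrow> Suc (length u + length w) = n \<Longrightarrow>
      \<Phi> (u @ (d, scl V c x) # w) - pscale c (\<Phi> (u @ (d, x) # w)) \<in> rel_space V {}"
    and \<Gamma>: "\<Gamma> = {(tensor_cls V w, cls V {} (\<Phi> w)) | w. w \<in> words V \<and> length w = n}"
  obtains F where "plinear F" "\<And>p. p \<in> rel_space V {} \<Longrightarrow> F p \<in> rel_space V {}"
    "\<And>w. w \<in> words V \<Longrightarrow> length w = n \<Longrightarrow> F (sing w) = \<Phi> w"
    "\<And>p. p \<in> wspan V {n} \<Longrightarrow> linear_extension (tensor_power V n) (tensor_power V m) \<Gamma> (cls V {} p) = cls V {} (F p)"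
proof -
  define F where "F = lext (\<lambda>w. if w \<in> words V \<and> length w = n then \<Phi> w else 0)"
  have F: "plinear F" unfolding F_def by (rule plinear_lext)
  have F_sing: "F (sing w) = (if w \<in> words V \<and> length w = n then \<Phi> w else 0)" for w
    by (simp add: F_def)
  have F_rel: "F p \<in> rel_space V {}" if "p \<in> rel_space V {}" for p
  proof (rule plinear_rel_space[OF F subspace_rel_space _ _ that])
    fix r assume "r \<in> multilin_rels V"
    then show "F r \<in> rel_space V {}"
    proof (cases rule: multilin_rels_cases)
      case (add u w d x y)
      then show ?thesis
        using assms(3)[of u w x d y] gclosedD(1)[OF V add(4,5)]
        by (auto simp: plinear_diff[OF F] F_sing)
    next
      case (scale u w d x c)
      then show ?thesis
        using assms(4)[of u w x d c] gclosedD(2)[OF V scale(4)]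
        by (auto simp: plinear_diff[OF F] plinear_scale[OF F] F_sing simp del: pscale_single)
    qed
  qed simp
  have "linear_extension (tensor_power V n) (tensor_power V m) \<Gamma> (cls V {} p) = cls V {} (F p)" if p: "p \<in> wspan V {n}" for p
  proof (rule linear_extension_cls(1)[OF F F_rel, where g = sing and h = \<Phi> and I = "{w. w \<in> words V \<and> length w = n}"])
    show "F p \<in> wspan V {m}" if "p \<in> wspan V {n}" for p
      by (rule plinear_wspan[OF F subspace_wspan _ that]) (simp add: F_sing span)
    show "\<exists>q\<in>free.span (sing ` {w \<in> words V. length w = n}). p - q \<in> rel_space V {}" if "p \<in> wspan V {n}" for p
    proof (rule bexI)
      have "free.span (sing ` {w \<in> words V. length w = n}) = wspan V {n}"
        unfolding wspan_def by (rule arg_cong[where f = free.span]) auto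
      then show "p \<in> free.span (sing ` {w \<in> words V. length w = n})"
        using that by simp
    qed simp
  qed (use p \<Gamma> in \<open>auto simp: F_sing intro!: wspan_base\<close>)
  then show ?thesis using that F F_rel F_sing by simp
qed

lemma gcomp_total: "x \<in> gcomp V d \<Longrightarrow> x \<in> total V"
  by (rule total.intros(1))

lemma length_2_split:
  assumes "Suc (length u + length w) = 2"
  obtains z where "u = []" "w = [z]" | z where "u = [z]" "w = []"
  using assms by (cases u; cases w) auto

text \<open>The values of \<open>f\<close> are cosets; a chosen representative makes them available
  to products of polynomials and is linear in \<open>u\<close> modulo relations.\<close>

definition krep :: "('k::field, 'v::plus) gspace \<Rightarrow> ('v \<Rightarrow> ('k, 'v) tensor) \<Rightarrow> 'v \<Rightarrow> ((int \<times> 'v) list \<Rightarrow>\<^sub>0 'k)" where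
  "krep V f u = (SOME q. q \<in> wspan V {2} \<and> f u = cls V {} q)"

lemma krep:
  assumes "glinear V (tensor_power V 2) f" "u \<in> total V"
  shows "krep V f u \<in> wspan V {2}" "f u = cls V {} (krep V f u)"
proof -
  have "f u \<in> total (tensor_power V 2)" using assms unfolding glinear_def by blast
  then have "\<exists>q. q \<in> wspan V {2} \<and> f u = cls V {} q" unfolding total_tensor_quotient by blast
  from someI_ex[OF this] show "krep V f u \<in> wspan V {2}" "f u = cls V {} (krep V f u)"
    unfolding krep_def by auto
qed

lemma krep_linear:
  assumes V: "gclosed V" and f: "glinear V (tensor_power V 2) f" and x: "x \<in> gcomp V d"
  shows "y \<in> gcomp V d \<Longrightarrow> krep V f (x + y) - krep V f x - krep V f y \<in> rel_space V {}"
    "krep V f (scl V c x) - pscale c (krep V f x) \<in> rel_space V {}"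
proof -
  note tot = gcomp_total[of _ V d]
  {
    assume y: "y \<in> gcomp V d"
    have "f (x + y) = f x + f y" using f x y tot unfolding glinear_def by blast
    then have "cls V {} (krep V f (x + y)) = cls V {} (krep V f x + krep V f y)"
      using krep(2)[OF f tot[OF gclosedD(1)[OF V x y]]] krep(2)[OF f tot[OF x]] krep(2)[OF f tot[OF y]]
      by (simp flip: cls_add)
    then show "krep V f (x + y) - krep V f x - krep V f y \<in> rel_space V {}"
      by (simp add: cls_eq_iff diff_diff_eq)
  }
  have "f (scl V c x) = scl (tensor_power V 2) c (f x)" using f x tot unfolding glinear_def by blast
  then have "cls V {} (krep V f (scl V c x)) = cls V {} (pscale c (krep V f x))"
    using krep(2)[OF f tot[OF gclosedD(2)[OF V x]]] krep(2)[OF f tot[OF x]] by simp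
  then show "krep V f (scl V c x) - pscale c (krep V f x) \<in> rel_space V {}"
    by (simp add: cls_eq_iff)
qed

lemma tensor_id_extension:
  assumes V: "gclosed V" and f: "glinear V (tensor_power V 2) f"
  obtains F where "plinear F" "\<And>p. p \<in> rel_space V {} \<Longrightarrow> F p \<in> rel_space V {}"
    "\<And>a u b v. u \<in> gcomp V a \<Longrightarrow> v \<in> gcomp V b \<Longrightarrow> F (sing [(a, u), (b, v)]) = krep V f u * sing [(b, v)]"
    "\<And>p. p \<in> wspan V {2} \<Longrightarrow> tensor_id V f (cls V {} p) = cls V {} (F p)"
proof -
  define \<Phi> where "\<Phi> w = krep V f (snd (w ! 0)) * sing [w ! 1]" for w
  note lin = krep_linear[OF V f] and mem = krep(1)[OF f gcomp_total]
  have add: "\<Phi> (u @ (d, x + y) # w) - \<Phi> (u @ (d, x) # w) - \<Phi> (u @ (d, y) # w) \<in> rel_space V {}"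
    if a: "u \<in> words V" "w \<in> words V" "x \<in> gcomp V d" "y \<in> gcomp V d" "Suc (length u + length w) = 2" for u w d x y
    using a(5)
  proof (cases rule: length_2_split)
    case (1 z)
    have "(krep V f (x + y) - krep V f x - krep V f y) * sing [z] \<in> rel_space V {}"
      using a 1 by (intro rel_space_mult_right[OF word_stable_empty lin(1), where L = UNIV] wspan_base) auto
    then show ?thesis by (simp add: 1 \<Phi>_def left_diff_distrib)
  next
    case (2 z)
    obtain b v where z: "z = (b, v)" by (cases z)
    have "krep V f v * (sing [(d, x + y)] - sing [(d, x)] - sing [(d, y)]) \<in> rel_space V {}"
      using a 2 z multilin_add[of "[]" V "[]" x d y]
      by (intro rel_space_mult_left[OF word_stable_empty _ mem] rel_space_base) auto
    then show ?thesis by (simp add: 2 z \<Phi>_def right_diff_distrib)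
  qed
  have scale: "\<Phi> (u @ (d, scl V c x) # w) - pscale c (\<Phi> (u @ (d, x) # w)) \<in> rel_space V {}"
    if a: "u \<in> words V" "w \<in> words V" "x \<in> gcomp V d" "Suc (length u + length w) = 2" for u w d x c
    using a(4)
  proof (cases rule: length_2_split)
    case (1 z)
    have "(krep V f (scl V c x) - pscale c (krep V f x)) * sing [z] \<in> rel_space V {}"
      using a 1 by (intro rel_space_mult_right[OF word_stable_empty lin(2), where L = UNIV] wspan_base) auto
    then show ?thesis by (simp add: 1 \<Phi>_def left_diff_distrib pscale_mult_left)
  next
    case (2 z)
    obtain b v where z: "z = (b, v)" by (cases z)
    have "krep V f v * (sing [(d, scl V c x)] - pscale c (sing [(d, x)])) \<in> rel_space V {}"
      using a 2 z multilin_scale[of "[]" V "[]" x d c]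
      by (intro rel_space_mult_left[OF word_stable_empty _ mem] rel_space_base) auto
    then show ?thesis by (simp add: 2 z \<Phi>_def right_diff_distrib pscale_mult_right del: pscale_single)
  qed
  have span: "\<Phi> w \<in> wspan V {3}" if ww: "w \<in> words V" "length w = 2" for w
  proof -
    obtain a u b v where w: "w = [(a, u), (b, v)]" using ww(2) by (cases w; cases "tl w") auto
    show ?thesis using ww unfolding w
      by (auto simp: \<Phi>_def intro!: wspan_mult[where L = "{2}" and L' = "{1}"] mem wspan_base)
  qed
  have "{(tensor_cls V [(a, u), (b, v)], tensor_mult V (f u) (tensor_cls V [(b, v)])) | a u b v. u \<in> gcomp V a \<and> v \<in> gcomp V b}
    = {(tensor_cls V w, cls V {} (\<Phi> w)) | w. w \<in> words V \<and> length w = 2}" (is "?A = ?B")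
  proof -
    have eq: "tensor_mult V (f u) (tensor_cls V [(b, v)]) = cls V {} (\<Phi> [(a, u), (b, v)])"
      if "u \<in> gcomp V a" "v \<in> gcomp V b" for a u b v
      using that krep(2)[OF f gcomp_total[OF that(1)]]
      by (simp add: \<Phi>_def) (rule tensor_mult_cls[OF V mem wspan_base[where L = UNIV]]; simp)
    show ?thesis
    proof (intro set_eqI iffI)
      fix p assume "p \<in> ?A"
      then obtain a u b v where p: "p = (tensor_cls V [(a, u), (b, v)], tensor_mult V (f u) (tensor_cls V [(b, v)]))"
        "u \<in> gcomp V a" "v \<in> gcomp V b" by blast
      then show "p \<in> ?B" using eq by (auto intro!: exI[of _ "[(a, u), (b, v)]"])
    next
      fix p assume "p \<in> ?B"
      then obtain w where w: "p = (tensor_cls V w, cls V {} (\<Phi> w))" "w \<in> words V" "length w = 2" by blast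
      obtain a u b v where w': "w = [(a, u), (b, v)]" using w(3) by (cases w; cases "tl w") auto
      then have "u \<in> gcomp V a" "v \<in> gcomp V b" using w by auto
      then show "p \<in> ?A" using eq w(1) w' by blast
    qed
  qed
  note \<Gamma> = this
  show ?thesis
  proof (rule tensor_extension[OF V span add scale \<Gamma>, folded tensor_id_def])
    fix F assume F: "plinear F" "\<And>p. p \<in> rel_space V {} \<Longrightarrow> F p \<in> rel_space V {}"
      "\<And>w. w \<in> words V \<Longrightarrow> length w = 2 \<Longrightarrow> F (sing w) = \<Phi> w"
      "\<And>p. p \<in> wspan V {2} \<Longrightarrow> tensor_id V f (cls V {} p) = cls V {} (F p)"
    have "F (sing [(a, u), (b, v)]) = krep V f u * sing [(b, v)]" if "u \<in> gcomp V a" "v \<in> gcomp V b" for a u b v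
      using F(3)[of "[(a, u), (b, v)]"] that by (simp add: \<Phi>_def pscale_sg)
    note F3 = this
    show ?thesis by (rule that[OF F(1,2) F3 F(4)])
  qed
qed

lemma id_tensor_extension:
  assumes V: "gclosed V" and f: "glinear V (tensor_power V 2) f"
  obtains F where "plinear F" "\<And>p. p \<in> rel_space V {} \<Longrightarrow> F p \<in> rel_space V {}"
    "\<And>a u b v. u \<in> gcomp V a \<Longrightarrow> v \<in> gcomp V b \<Longrightarrow> F (sing [(a, u), (b, v)]) = sg (e * a) * (sing [(a, u)] * krep V f v)"
    "\<And>p. p \<in> wspan V {2} \<Longrightarrow> id_tensor V e f (cls V {} p) = cls V {} (F p)"
proof -
  \<comment> \<open>The sign depends on the degree of the first letter only, hence stays fixed when
    either vector is varied within its degree.\<close>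
  define \<Phi> where "\<Phi> w = pscale (sg (e * fst (w ! 0))) (sing [w ! 0] * krep V f (snd (w ! 1)))" for w
  note lin = krep_linear[OF V f] and mem = krep(1)[OF f gcomp_total]
  have add: "\<Phi> (u @ (d, x + y) # w) - \<Phi> (u @ (d, x) # w) - \<Phi> (u @ (d, y) # w) \<in> rel_space V {}"
    if a: "u \<in> words V" "w \<in> words V" "x \<in> gcomp V d" "y \<in> gcomp V d" "Suc (length u + length w) = 2" for u w d x y
    using a(5)
  proof (cases rule: length_2_split)
    case (2 z)
    have "pscale (sg (e * fst z)) (sing [z] * (krep V f (x + y) - krep V f x - krep V f y)) \<in> rel_space V {}"
      using a 2 by (intro rel_space_scale rel_space_mult_left[OF word_stable_empty lin(1), where L = UNIV] wspan_base) auto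
    then show ?thesis by (simp add: 2 \<Phi>_def right_diff_distrib free.scale_right_diff_distrib)
  next
    case (1 z)
    obtain b v where z: "z = (b, v)" by (cases z)
    have "pscale (sg (e * d)) ((sing [(d, x + y)] - sing [(d, x)] - sing [(d, y)]) * krep V f v) \<in> rel_space V {}"
      using a 1 z multilin_add[of "[]" V "[]" x d y]
      by (intro rel_space_scale rel_space_mult_right[OF word_stable_empty _ mem] rel_space_base) auto
    then show ?thesis by (simp add: 1 z \<Phi>_def left_diff_distrib free.scale_right_diff_distrib)
  qed
  have scale: "\<Phi> (u @ (d, scl V c x) # w) - pscale c (\<Phi> (u @ (d, x) # w)) \<in> rel_space V {}"
    if a: "u \<in> words V" "w \<in> words V" "x \<in> gcomp V d" "Suc (length u + length w) = 2" for u w d x c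
    using a(4)
  proof (cases rule: length_2_split)
    case (2 z)
    have "pscale (sg (e * fst z)) (sing [z] * (krep V f (scl V c x) - pscale c (krep V f x))) \<in> rel_space V {}"
      using a 2 by (intro rel_space_scale rel_space_mult_left[OF word_stable_empty lin(2), where L = UNIV] wspan_base) auto
    then show ?thesis by (simp add: 2 \<Phi>_def right_diff_distrib free.scale_right_diff_distrib pscale_mult_right mult.commute)
  next
    case (1 z)
    obtain b v where z: "z = (b, v)" by (cases z)
    have "pscale (sg (e * d)) ((sing [(d, scl V c x)] - pscale c (sing [(d, x)])) * krep V f v) \<in> rel_space V {}"
      using a 1 z multilin_scale[of "[]" V "[]" x d c]
      by (intro rel_space_scale rel_space_mult_right[OF word_stable_empty _ mem] rel_space_base) auto
    then show ?thesis
      by (simp add: 1 z \<Phi>_def left_diff_distrib free.scale_right_diff_distrib pscale_mult_left mult.commute del: pscale_single)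
  qed
  have span: "\<Phi> w \<in> wspan V {3}" if ww: "w \<in> words V" "length w = 2" for w
  proof -
    obtain a u b v where w: "w = [(a, u), (b, v)]" using ww(2) by (cases w; cases "tl w") auto
    show ?thesis using ww unfolding w
      by (auto simp: \<Phi>_def intro!: free.subspace_scale[OF subspace_wspan] wspan_mult[where L = "{1}" and L' = "{2}"] mem wspan_base)
  qed
  have "{(tensor_cls V [(a, u), (b, v)],
       scl (tensor_power V 3) ((-1) powi (e * a)) (tensor_mult V (tensor_cls V [(a, u)]) (f v)))
      | a u b v. u \<in> gcomp V a \<and> v \<in> gcomp V b}
    = {(tensor_cls V w, cls V {} (\<Phi> w)) | w. w \<in> words V \<and> length w = 2}" (is "?A = ?B")
  proof -
    have eq: "scl (tensor_power V 3) ((-1) powi (e * a)) (tensor_mult V (tensor_cls V [(a, u)]) (f v)) = cls V {} (\<Phi> [(a, u), (b, v)])"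
      if "u \<in> gcomp V a" "v \<in> gcomp V b" for a u b v
    proof -
      have "tensor_mult V (tensor_cls V [(a, u)]) (f v) = cls V {} (sing [(a, u)] * krep V f v)"
        unfolding krep(2)[OF f gcomp_total[OF that(2)]]
        by (rule tensor_mult_cls[OF V wspan_base[where L = UNIV] mem[OF that(2)]]) (use that in auto)
      then show ?thesis by (simp add: \<Phi>_def sg_power_int)
    qed
    show ?thesis
    proof (intro set_eqI iffI)
      fix p assume "p \<in> ?A"
      then obtain a u b v where p: "p = (tensor_cls V [(a, u), (b, v)],
          scl (tensor_power V 3) ((-1) powi (e * a)) (tensor_mult V (tensor_cls V [(a, u)]) (f v)))"
        "u \<in> gcomp V a" "v \<in> gcomp V b" by blast
      then show "p \<in> ?B" using eq by (auto intro!: exI[of _ "[(a, u), (b, v)]"])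
    next
      fix p assume "p \<in> ?B"
      then obtain w where w: "p = (tensor_cls V w, cls V {} (\<Phi> w))" "w \<in> words V" "length w = 2" by blast
      obtain a u b v where w': "w = [(a, u), (b, v)]" using w(3) by (cases w; cases "tl w") auto
      then have "u \<in> gcomp V a" "v \<in> gcomp V b" using w by auto
      then show "p \<in> ?A" using eq w(1) w' by blast
    qed
  qed
  note \<Gamma> = this
  show ?thesis
  proof (rule tensor_extension[OF V span add scale \<Gamma>, folded id_tensor_def])
    fix F assume F: "plinear F" "\<And>p. p \<in> rel_space V {} \<Longrightarrow> F p \<in> rel_space V {}"
      "\<And>w. w \<in> words V \<Longrightarrow> length w = 2 \<Longrightarrow> F (sing w) = \<Phi> w"
      "\<And>p. p \<in> wspan V {2} \<Longrightarrow> id_tensor V e f (cls V {} p) = cls V {} (F p)"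
    have "F (sing [(a, u), (b, v)]) = sg (e * a) * (sing [(a, u)] * krep V f v)" if "u \<in> gcomp V a" "v \<in> gcomp V b" for a u b v
      using F(3)[of "[(a, u), (b, v)]"] that by (simp add: \<Phi>_def pscale_sg)
    note F3 = this
    show ?thesis by (rule that[OF F(1,2) F3 F(4)])
  qed
qed

section \<open>Flips on the third tensor power\<close>

lemma length_3_split:
  assumes "Suc (length u + length w) = 3"
  obtains y z where "u = []" "w = [y, z]" | y z where "u = [y]" "w = [z]" | y z where "u = [y, z]" "w = []"
  using assms by (cases u; cases w; cases "tl u"; cases "tl w") auto

text \<open>A common form for both flips: \<open>i = 0\<close> gives the first one,
  \<open>i = 1\<close> the second.\<close>

definition flip :: "nat \<Rightarrow> (int \<times> 'v) list \<Rightarrow> ((int \<times> 'v) list \<Rightarrow>\<^sub>0 'k::field)" where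
  "flip i w = Poly_Mapping.single (take i w @ [w ! Suc i, w ! i] @ drop (Suc (Suc i)) w) (sg (fst (w ! i) * fst (w ! Suc i)))"

text \<open>A flip moves the varying letter into another fixed context, with a sign that depends on
  degrees only; multilinearity is therefore inherited.\<close>

lemma flip_letter:
  assumes i: "i < 2" and uw: "u \<in> words V" "w \<in> words V" "Suc (length u + length w) = 3"
  obtains u' w' n where "u' \<in> words V" "w' \<in> words V"
    "\<And>x. flip i (u @ (d, x) # w) = pscale (sg n :: 'k::field) (sing (u' @ (d, x) # w'))"
proof -
  note result = that
  have i: "i = 0 \<or> i = 1" using i by auto
  show ?thesis
    using uw(3)
  proof (cases rule: length_3_split)
    case (1 y z)
    obtain a v b t where yz: "y = (a, v)" "z = (b, t)" by (cases y; cases z)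
    show ?thesis
      using i
    proof
      assume "i = 0" then show ?thesis
        using uw by (intro result[of "[y]" "[z]" "d * a"]) (simp_all add: 1 yz flip_def)
    next
      assume "i = 1" then show ?thesis
        using uw by (intro result[of "[]" "[z, y]" "a * b"]) (simp_all add: 1 yz flip_def)
    qed
  next
    case (2 y z)
    obtain a v b t where yz: "y = (a, v)" "z = (b, t)" by (cases y; cases z)
    show ?thesis
      using i
    proof
      assume "i = 0" then show ?thesis
        using uw by (intro result[of "[]" "[y, z]" "a * d"]) (simp_all add: 2 yz flip_def)
    next
      assume "i = 1" then show ?thesis
        using uw by (intro result[of "[y, z]" "[]" "d * b"]) (simp_all add: 2 yz flip_def)
    qed
  next
    case (3 y z)
    obtain a v b t where yz: "y = (a, v)" "z = (b, t)" by (cases y; cases z)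
    show ?thesis
      using i
    proof
      assume "i = 0" then show ?thesis
        using uw by (intro result[of "[z, y]" "[]" "a * b"]) (simp_all add: 3 yz flip_def)
    next
      assume "i = 1" then show ?thesis
        using uw by (intro result[of "[y]" "[z]" "b * d"]) (simp_all add: 3 yz flip_def)
    qed
  qed
qed

lemma flip_extension:
  fixes V :: "('k::field, 'v::plus) gspace"
  assumes V: "gclosed V" and i: "i < 2"
    and \<Gamma>: "\<Gamma> = {(tensor_cls V w, cls V {} (flip i w)) | w. w \<in> words V \<and> length w = 3}"
  obtains F where "plinear F" "\<And>p. p \<in> rel_space V {} \<Longrightarrow> F p \<in> rel_space V {}"
    "\<And>w. w \<in> words V \<Longrightarrow> length w = 3 \<Longrightarrow> F (sing w) = flip i w"
    "\<And>p. p \<in> wspan V {3} \<Longrightarrow> linear_extension (tensor_power V 3) (tensor_power V 3) \<Gamma> (cls V {} p) = cls V {} (F p)"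
proof (rule tensor_extension[OF V _ _ _ \<Gamma>])
  fix u w :: "(int \<times> 'v) list" and d x
  assume a: "u \<in> words V" "w \<in> words V" "x \<in> gcomp V d" "Suc (length u + length w) = 3"
  obtain u' w' n where *: "u' \<in> words V" "w' \<in> words V"
    "\<And>x. flip i (u @ (d, x) # w) = pscale (sg n :: 'k) (sing (u' @ (d, x) # w'))"
    using flip_letter[OF i a(1,2,4)] by metis
  show "flip i (u @ (d, x + y) # w) - flip i (u @ (d, x) # w) - flip i (u @ (d, y) # w) \<in> rel_space V {}"
    if "y \<in> gcomp V d" for y
    unfolding *(3) free.scale_right_diff_distrib[symmetric]
    by (intro rel_space_scale rel_space_base UnI1 multilin_add * a that)
  have "pscale (sg n) (sing (u' @ (d, scl V c x) # w') - pscale c (sing (u' @ (d, x) # w'))) \<in> rel_space V {}" for c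
    by (intro rel_space_scale rel_space_base UnI1 multilin_scale * a)
  then show "flip i (u @ (d, scl V c x) # w) - pscale c (flip i (u @ (d, x) # w)) \<in> rel_space V {}" for c
    unfolding *(3) free.scale_right_diff_distrib by (simp add: mult.commute)
next
  fix w assume w: "w \<in> words V" "length w = 3"
  show "flip i w \<in> wspan V {3}"
  proof -
    have m: "mset (take i w @ [w ! Suc i, w ! i] @ drop (Suc (Suc i)) w) = mset w"
    proof -
      have "w = take i w @ [w ! i, w ! Suc i] @ drop (Suc (Suc i)) w"
        using i w(2) by (simp add: Cons_nth_drop_Suc)
      then have "mset w = mset (take i w @ [w ! i, w ! Suc i] @ drop (Suc (Suc i)) w)" by (rule arg_cong)
      then show ?thesis by simp
    qed
    have "take i w @ [w ! Suc i, w ! i] @ drop (Suc (Suc i)) w \<in> words V"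
      using words_mset[OF m] w(1) by blast
    then show ?thesis
      unfolding flip_def by (rule wspan_single) (use mset_eq_length[OF m] w(2) in simp)
  qed
qed (use that in blast)

section \<open>Tensor operations induced by operations on the free algebra\<close>

lemma sing_append: "sing (u @ w) = sing u * (sing w :: 'x list \<Rightarrow>\<^sub>0 'k::field)"
  by (simp add: sing_mult)

lemma slots_split_2:
  assumes "sorted (map fst L)" "fst ` set L = {..<2}"
  obtains P Q where "L = slots 0 P @ slots 1 Q" "P \<noteq> []" "Q \<noteq> []"
proof -
  have "[0..<2] = [0, 1::nat]" by (simp add: upt_rec)
  then have "L = slots 0 (slotw 0 L) @ slots 1 (slotw 1 L)"
    using sorted_split_slots[OF assms(1), of 2] assms(2) by simp
  moreover have "slotw 0 L \<noteq> []" "slotw 1 L \<noteq> []" unfolding slotw_eq_Nil assms(2) by auto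
  ultimately show ?thesis using that by metis
qed

lemma slots_split_3:
  assumes "sorted (map fst L)" "fst ` set L = {..<3}"
  obtains P Q R where "L = slots 0 P @ slots 1 Q @ slots 2 R" "P \<noteq> []" "Q \<noteq> []" "R \<noteq> []"
proof -
  have "[0..<3] = [0, 1, 2::nat]" by (simp add: upt_rec)
  then have "L = slots 0 (slotw 0 L) @ slots 1 (slotw 1 L) @ slots 2 (slotw 2 L)"
    using sorted_split_slots[OF assms(1), of 3] assms(2) by simp
  moreover have "slotw 0 L \<noteq> []" "slotw 1 L \<noteq> []" "slotw 2 L \<noteq> []" unfolding slotw_eq_Nil assms(2) by auto
  ultimately show ?thesis using that by metis
qed

lemma ball_slots [simp]: "(\<forall>x\<in>set (slots i P). Q (snd x)) \<longleftrightarrow> (\<forall>w\<in>set P. Q w)"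
  by (simp add: slots_def)

lemma nu_slots_2:
  assumes "P \<noteq> []" "Q \<noteq> []" "\<forall>w\<in>set P. valid G w" "\<forall>w\<in>set Q. valid G w"
  shows "nu G 2 (sing (slots 0 P @ slots 1 Q)) = sing [(mdeg P, mcls G P), (mdeg Q, mcls G Q)]"
proof -
  have "{..<2} = {1, 0::nat}" by auto
  then have "okw G 2 (slots 0 P @ slots 1 Q)"
    using assms by (simp add: okw_def image_Un ball_Un)
  moreover have "sorted (map fst (slots 0 P @ slots 1 Q))"
    using assms by (simp add: sorted_append sorted_slots)
  moreover have "[0..<2] = [0, 1::nat]" by (simp add: upt_rec)
  ultimately show ?thesis by (simp add: nu_single ssgn_sorted nlet_def)
qed

lemma nu_slots_3:
  assumes "P \<noteq> []" "Q \<noteq> []" "R \<noteq> []" "\<forall>w\<in>set P. valid G w" "\<forall>w\<in>set Q. valid G w" "\<forall>w\<in>set R. valid G w"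
  shows "nu G 3 (sing (slots 0 P @ slots 1 Q @ slots 2 R)) = sing [(mdeg P, mcls G P), (mdeg Q, mcls G Q), (mdeg R, mcls G R)]"
proof -
  have "{..<3} = {2, 1, 0::nat}" by auto
  then have "okw G 3 (slots 0 P @ slots 1 Q @ slots 2 R)"
    using assms by (simp add: okw_def image_Un ball_Un)
  moreover have "sorted (map fst (slots 0 P @ slots 1 Q @ slots 2 R))"
    using assms by (simp add: sorted_append sorted_slots image_Un ball_Un)
  moreover have "[0..<3] = [0, 1, 2::nat]" by (simp add: upt_rec)
  ultimately show ?thesis by (simp add: nu_single ssgn_sorted nlet_def)
qed

text \<open>The comparison principle for all operations on tensor powers. The hypothesis
  \<open>other\<close> ensures that words discarded before applying \<open>D\<close> contribute
  nothing afterwards.\<close>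

lemma agree_on_sorted:
  fixes G :: "('k::field, 'g::plus) gspace"
  assumes G: "gclosed (shift G)"
    and F: "plinear F" "\<And>p. p \<in> Srel G \<Longrightarrow> F p \<in> Srel G"
    and D: "plinear D" "\<And>p. p \<in> rel_ideal G \<Longrightarrow> D p \<in> rel_ideal G"
    and other: "\<And>L. fst ` set L \<noteq> {..<n} \<Longrightarrow> nu G m (D (sing L)) = 0"
    and sorted: "\<And>L. sorted (map fst L) \<Longrightarrow> fst ` set L = {..<n} \<Longrightarrow> \<forall>x\<in>set L. valid G (snd x) \<Longrightarrow>
      F (nu G n (sing L)) - nu G m (D (sing L)) \<in> Srel G"
  shows "F (nu G n p) - nu G m (D p) \<in> Srel G"
proof (rule sorted_reduction[of "\<lambda>p. F (nu G n p) - nu G m (D p)" _ G])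
  show "plinear (\<lambda>p. F (nu G n p) - nu G m (D p))"
    by (rule plinear_minus[OF plinear_compose[OF F(1) plinear_nu] plinear_compose[OF plinear_nu D(1)]])
  show "free.subspace (Srel G)" by (rule subspace_rel_space)
  show "F (nu G n p) - nu G m (D p) \<in> Srel G" if "p \<in> rel_ideal G" for p
    by (intro rel_space_diff F(2) nu_rel_ideal[OF G] D(2) that)
  fix L :: "'g slotted list" assume L: "sorted (map fst L)"
  show "F (nu G n (sing L)) - nu G m (D (sing L)) \<in> Srel G"
  proof (cases "\<exists>x\<in>set L. \<not> valid G (snd x)")
    case True
    then have "sing L \<in> rel_ideal G" using sing_rel_ideal_invalid by blast
    then show ?thesis by (intro rel_space_diff F(2) nu_rel_ideal[OF G] D(2))
  next
    case False
    show ?thesis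
    proof (cases "fst ` set L = {..<n}")
      case True
      then show ?thesis using sorted[OF L] False by blast
    next
      case False
      then show ?thesis using other[OF False] by (simp add: nu_single okw_def plinear_0[OF F(1)])
    qed
  qed
qed

lemma slots_gcomp: "P \<noteq> [] \<Longrightarrow> \<forall>w\<in>set P. valid G w \<Longrightarrow> mcls G P \<in> gcomp (SH G) (mdeg P)"
  by (simp add: mcls_gcomp)

lemma krep_eq:
  assumes f: "glinear (SH G) (tensor_power (SH G) 2) f" and P: "P \<noteq> []" "\<forall>w\<in>set P. valid G w"
    and eq: "f (mcls G P) = cls (SH G) {} q"
  shows "krep (SH G) f (mcls G P) - q \<in> Srel G"
  using krep(2)[OF f gcomp_total[OF slots_gcomp[OF P]]] eq by (metis cls_eq_iff)

text \<open>The ways in which a word can fail to fill exactly two factors: a letter outside them,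
  factor 1 empty, or factor 0 empty.\<close>

lemma subset_two_cases:
  assumes "A \<noteq> {..<2::nat}"
  shows "(\<exists>a\<in>A. 2 \<le> a) \<or> A \<subseteq> {0} \<or> A \<subseteq> {1}"
proof (rule ccontr)
  assume *: "\<not> ?thesis"
  then obtain a b where "a \<in> A" "a \<noteq> 0" "b \<in> A" "b \<noteq> 1" by blast
  moreover have "\<forall>c\<in>A. c < 2" using * by force
  ultimately have "a = 1" "b = 0" by (auto simp: less_2_cases_iff)
  then have "A = {..<2}" using \<open>a \<in> A\<close> \<open>b \<in> A\<close> \<open>\<forall>c\<in>A. c < 2\<close> by (auto simp: less_2_cases_iff)
  then show False using assms by simp
qed

lemma tensor_id_nu:
  fixes G :: "('k::field, 'g::plus) gspace"
  assumes G: "gclosed (shift G)"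
    and f: "glinear (SH G) (tensor_power (SH G) 2) f"
    and f_mcls: "\<And>P. P \<in> monomials G \<Longrightarrow> f (mcls G P) = cls (SH G) {} (nu G 2 (sder K\<^sub>\<kappa> E\<^sub>\<Delta> (sing (slots 0 P))))"
  shows "tensor_id (SH G) f (cls (SH G) {} (nu G 2 p)) = cls (SH G) {} (nu G 3 (sder K\<^sub>l E\<^sub>l p))"
proof -
  obtain F where F: "plinear F" "\<And>p. p \<in> Srel G \<Longrightarrow> F p \<in> Srel G"
    "\<And>a u b v. u \<in> gcomp (SH G) a \<Longrightarrow> v \<in> gcomp (SH G) b \<Longrightarrow> F (sing [(a, u), (b, v)]) = krep (SH G) f u * sing [(b, v)]"
    "\<And>p. p \<in> wspan (SH G) {2} \<Longrightarrow> tensor_id (SH G) f (cls (SH G) {} p) = cls (SH G) {} (F p)"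
    by (rule tensor_id_extension[OF gclosed_SH f]) (rule that; simp)
  have "F (nu G 2 p) - nu G 3 (sder K\<^sub>l E\<^sub>l p) \<in> Srel G"
  proof (rule agree_on_sorted[OF G F(1,2) plinear_der sder_rel_ideal])
    fix L :: "'g slotted list" assume L: "fst ` set L \<noteq> {..<2}"
    consider x where "x \<in> set L" "fst x \<ge> 2" | "fst ` set L \<subseteq> {0}" | "fst ` set L \<subseteq> {1}"
      using subset_two_cases[OF L] by force
    \<comment> \<open>A letter beyond factor 1 is killed by the empty table entries; without letters
      in factor 1, factor 2 of the result stays empty; without letters in factor 0 there is nothing
      to cut.\<close>
    then show "nu G 3 (sder K\<^sub>l E\<^sub>l (sing L)) = 0"
    proof cases
      case 1
      then show ?thesis by (subst sder_eq_0[OF 1(1)]) (auto simp: plinear_0[OF plinear_nu])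
    next
      case 2
      then have "sder K\<^sub>l E\<^sub>l (sing L) \<in> lsp {0, 1}" by (intro lsp_sder) auto
      then show ?thesis by (rule nu_lsp_0) (simp add: subset_iff, rule exI[of _ 2], simp)
    next
      case 3
      then show ?thesis by (subst sder_eq_0') (auto simp: plinear_0[OF plinear_nu])
    qed
  next
    fix L :: "'g slotted list" assume L: "sorted (map fst L)" "fst ` set L = {..<2}" "\<forall>x\<in>set L. valid G (snd x)"
    obtain P Q where PQ: "L = slots 0 P @ slots 1 Q" "P \<noteq> []" "Q \<noteq> []" by (rule slots_split_2[OF L(1,2)])
    have v: "\<forall>w\<in>set P. valid G w" "\<forall>w\<in>set Q. valid G w" using L(3) by (simp_all add: PQ ball_Un)
    let ?m = "sder K\<^sub>\<kappa> E\<^sub>\<Delta> (sing (slots 0 P))"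
    have 1: "F (nu G 2 (sing L)) = krep (SH G) f (mcls G P) * sing [(mdeg Q, mcls G Q)]"
      unfolding PQ(1) nu_slots_2[OF PQ(2,3) v] by (intro F(3) slots_gcomp PQ v)
    have 2: "(krep (SH G) f (mcls G P) - nu G 2 ?m) * sing [(mdeg Q, mcls G Q)] \<in> Srel G"
      using PQ v f_mcls[of P]
      by (intro rel_space_mult_right[OF word_stable_empty krep_eq[OF f], where L = UNIV] wspan_base)
        (auto simp: monomials_iff slots_gcomp)
    \<comment> \<open>By the Leibniz rule only the part in factor 0 is cut, while the part in factor
      1 is relabelled 2 and stays at the right.\<close>
    have 3: "nu G 3 (sder K\<^sub>l E\<^sub>l (sing L)) = nu G 2 ?m * sing [(mdeg Q, mcls G Q)]"
    proof -
      have "sder K\<^sub>l E\<^sub>l (sing L) = sder K\<^sub>l E\<^sub>l (sing (slots 0 P)) * shom E\<^sub>l (sing (slots 1 Q))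
          + shom E\<^sub>l (hom (parity ldeg) (sing (slots 0 P))) * sder K\<^sub>l E\<^sub>l (sing (slots 1 Q))"
        unfolding PQ(1) by (simp only: sing_append der_mult)
      also have "shom E\<^sub>l (sing (slots 1 Q)) = sing (slots 2 Q)"
        by (rule shom_slots) simp
      also have "sder K\<^sub>l E\<^sub>l (sing (slots 1 Q)) = 0"
        by (rule sder_eq_0') (auto simp: slots_def)
      also have "sder K\<^sub>l E\<^sub>l (sing (slots 0 P)) = ?m"
        unfolding der_sing by (rule derw_cong) (auto simp: slots_def klt_def dlt_def)
      finally have *: "sder K\<^sub>l E\<^sub>l (sing L) = ?m * sing (slots 2 Q)" by (simp only: mult_zero_right add_0_right)
      have "{..<2} = {0, 1::nat}" by auto
      then have "?m \<in> lsp {..<2}" by (intro lsp_sder) auto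
      from nu_mult_slots[OF this PQ(3) v(2)] show ?thesis unfolding * by simp
    qed
    show "F (nu G 2 (sing L)) - nu G 3 (sder K\<^sub>l E\<^sub>l (sing L)) \<in> Srel G"
      using 2 unfolding 1 3 left_diff_distrib .
  qed
  then show ?thesis using F(4)[OF nu_wspan] by (simp add: cls_eq_iff)
qed

text \<open>Stated for a general \<open>D\<close>, since it serves \<Delta> with
  \<open>e = 0\<close> and \<kappa> with \<open>e = 1\<close>; the hypothesis \<open>split\<close>
  is the Koszul rule for id \<otimes> D in the free algebra.\<close>

lemma id_tensor_nu:
  fixes D' D :: "('g::plus slotted list \<Rightarrow>\<^sub>0 'k::field) \<Rightarrow> ('g slotted list \<Rightarrow>\<^sub>0 'k)"
  assumes G: "gclosed (shift G)"
    and f: "glinear (SH G) (tensor_power (SH G) 2) f"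
    and f_mcls: "\<And>P. P \<in> monomials G \<Longrightarrow> f (mcls G P) = cls (SH G) {} (nu G 2 (D (sing (slots 0 P))))"
    and D': "plinear D'" "\<And>p. p \<in> rel_ideal G \<Longrightarrow> D' p \<in> rel_ideal G"
    and other: "\<And>L. fst ` set L \<noteq> {..<2} \<Longrightarrow> nu G 3 (D' (sing L)) = 0"
    and split: "\<And>P Q. D' (sing (slots 0 P @ slots 1 Q)) = sg (e * mdeg P) * (sing (slots 0 P) * shom (\<lambda>i. [Suc i]) (D (sing (slots 0 Q))))"
  shows "id_tensor (SH G) e f (cls (SH G) {} (nu G 2 p)) = cls (SH G) {} (nu G 3 (D' p))"
proof -
  obtain F where F: "plinear F" "\<And>p. p \<in> Srel G \<Longrightarrow> F p \<in> Srel G"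
    "\<And>a u b v. u \<in> gcomp (SH G) a \<Longrightarrow> v \<in> gcomp (SH G) b \<Longrightarrow> F (sing [(a, u), (b, v)]) = sg (e * a) * (sing [(a, u)] * krep (SH G) f v)"
    "\<And>p. p \<in> wspan (SH G) {2} \<Longrightarrow> id_tensor (SH G) e f (cls (SH G) {} p) = cls (SH G) {} (F p)"
    by (rule id_tensor_extension[OF gclosed_SH f, where e = e]) (rule that; simp)
  have "F (nu G 2 p) - nu G 3 (D' p) \<in> Srel G"
  proof (rule agree_on_sorted[OF G F(1,2) D' other])
    fix L :: "'g slotted list" assume L: "sorted (map fst L)" "fst ` set L = {..<2}" "\<forall>x\<in>set L. valid G (snd x)"
    obtain P Q where PQ: "L = slots 0 P @ slots 1 Q" "P \<noteq> []" "Q \<noteq> []" by (rule slots_split_2[OF L(1,2)])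
    have v: "\<forall>w\<in>set P. valid G w" "\<forall>w\<in>set Q. valid G w" using L(3) by (simp_all add: PQ ball_Un)
    let ?m = "D (sing (slots 0 Q))"
    have 1: "F (nu G 2 (sing L)) = sg (e * mdeg P) * (sing [(mdeg P, mcls G P)] * krep (SH G) f (mcls G Q))"
      unfolding PQ(1) nu_slots_2[OF PQ(2,3) v] by (intro F(3) slots_gcomp PQ v)
    have 2: "sg (e * mdeg P) * (sing [(mdeg P, mcls G P)] * (krep (SH G) f (mcls G Q) - nu G 2 ?m)) \<in> Srel G"
      using PQ v f_mcls[of Q]
      by (intro rel_space_sg rel_space_mult_left[OF word_stable_empty krep_eq[OF f], where L = UNIV] wspan_base)
        (auto simp: monomials_iff slots_gcomp)
    have 3: "nu G 3 (D' (sing L)) = sg (e * mdeg P) * (sing [(mdeg P, mcls G P)] * nu G 2 ?m)"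
      using nu_slots_mult[OF PQ(2) v(1), of 2 ?m]
      unfolding PQ(1) split plinear_sg[OF plinear_nu] by simp
    show "F (nu G 2 (sing L)) - nu G 3 (D' (sing L)) \<in> Srel G"
      using 2 unfolding 1 3 right_diff_distrib .
  qed
  then show ?thesis using F(4)[OF nu_wspan] by (simp add: cls_eq_iff)
qed

lemma supercomm_slots: "supercomm G (mdeg X) (mdeg Y) (sing (slots k X)) (sing (slots l Y))"
proof -
  have one: "supercomm G 0 n 1 q" for n q by (simp add: supercomm_def)
  have slots_Cons: "sing (slots k (x # X)) = lt k x * sing (slots k X)" for k x X
    by (simp add: lt_def sing_mult)
  have lt: "supercomm G (xdeg x) (mdeg Y) (lt k x) (sing (slots l Y))" for x
  proof (rule supercomm_sym, induction Y)
    case Nil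
    then show ?case by (simp add: mdeg_def one flip: one_eq_sing)
  next
    case (Cons y Y)
    then show ?case
      unfolding slots_Cons using supercomm_mult[OF supercomm_lt[of G y x l k] Cons] by (simp add: mdeg_def)
  qed
  show ?thesis
  proof (induction X)
    case Nil
    then show ?case by (simp add: mdeg_def one flip: one_eq_sing)
  next
    case (Cons x X)
    then show ?case
      unfolding slots_Cons using supercomm_mult[OF lt Cons] by (simp add: mdeg_def)
  qed
qed

lemma rel_ideal_swap_slots:
  "sing (A @ slots k X @ slots l Y @ B) - sg (mdeg X * mdeg Y) * sing (A @ slots l Y @ slots k X @ B) \<in> rel_ideal G"
proof -
  have "sing A * (sing (slots k X) * sing (slots l Y) - sg (mdeg X * mdeg Y) * (sing (slots l Y) * sing (slots k X))) * sing B \<in> rel_ideal G"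
    using supercomm_slots[of G X Y k l] unfolding supercomm_def by (intro rel_ideal_mult_left rel_ideal_mult_right)
  also have "sing A * (sing (slots k X) * sing (slots l Y) - sg (mdeg X * mdeg Y) * (sing (slots l Y) * sing (slots k X))) * sing B
    = sing (A @ slots k X @ slots l Y @ B) - sg (mdeg X * mdeg Y) * sing (A @ slots l Y @ slots k X @ B)"
    by (simp add: sing_mult left_diff_distrib right_diff_distrib sg_def distrib_left distrib_right)
  finally show ?thesis .
qed

text \<open>Relabelling a sorted word makes two adjacent blocks unsorted; sorting them again costs
  exactly the Koszul sign of the flip.\<close>

lemma flip_nu:
  fixes G :: "('k::field, 'g::plus) gspace"
  assumes G: "gclosed (shift G)" and i: "i < 2"
    and \<Gamma>: "\<Gamma> = {(tensor_cls (SH G) w, cls (SH G) {} (flip i w)) | w. w \<in> words (SH G) \<and> length w = 3}"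
    and E: "E = (if i = 0 then T12 else T23)"
  shows "linear_extension (tensor_power (SH G) 3) (tensor_power (SH G) 3) \<Gamma> (cls (SH G) {} (nu G 3 p))
    = cls (SH G) {} (nu G 3 (shom E p))"
proof -
  obtain F where F: "plinear F" "\<And>p. p \<in> Srel G \<Longrightarrow> F p \<in> Srel G"
    "\<And>w. w \<in> words (SH G) \<Longrightarrow> length w = 3 \<Longrightarrow> F (sing w) = flip i w"
    "\<And>p. p \<in> wspan (SH G) {3} \<Longrightarrow> linear_extension (tensor_power (SH G) 3) (tensor_power (SH G) 3) \<Gamma> (cls (SH G) {} p) = cls (SH G) {} (F p)"
    by (rule flip_extension[OF gclosed_SH i \<Gamma>]) (rule that; simp)
  have "F (nu G 3 p) - nu G 3 (shom E p) \<in> Srel G"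
  proof (rule agree_on_sorted[OF G F(1,2) plinear_hom shom_rel_ideal])
    fix L :: "'g slotted list" assume L: "fst ` set L \<noteq> {..<3}"
    show "nu G 3 (shom E (sing L)) = 0"
    proof (cases "\<exists>x\<in>set L. fst x \<ge> 3")
      case True
      then obtain x where x: "x \<in> set L" "fst x \<ge> 3" by blast
      then have "E (fst x) = []" by (simp add: E)
      then show ?thesis by (simp only: shom_eq_0[OF x(1)] plinear_0[OF plinear_nu])
    next
      case False
      then have sub: "fst ` set L \<subseteq> {..<3}" by force
      then obtain k where k: "k < 3" "k \<notin> fst ` set L" using L by auto
      have k_cases: "k = 0 \<or> k = 1 \<or> k = 2" using k(1) by linarith
      \<comment> \<open>A flip is a permutation of the factors: if factor \<open>k\<close> is empty,
        then its image \<open>hd (E k)\<close> is empty afterwards.\<close>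
      have "set (E j) \<subseteq> {..<3} - {hd (E k)}" if "j \<in> fst ` set L" for j
      proof -
        have "j < 3" "j \<noteq> k" using that sub k(2) by auto
        then have "j = 0 \<or> j = 1 \<or> j = 2" by linarith
        then show ?thesis using k_cases \<open>j \<noteq> k\<close> by (elim disjE) (simp_all add: E)
      qed
      then have "shom E (sing L) \<in> lsp ({..<3} - {hd (E k)})" by (rule lsp_shom)
      moreover have "hd (E k) < 3" using k_cases by (elim disjE) (simp_all add: E)
      then have "\<not> {..<3} \<subseteq> {..<3} - {hd (E k)}" by blast
      ultimately show ?thesis by (rule nu_lsp_0)
    qed
  next
    fix L :: "'g slotted list" assume L: "sorted (map fst L)" "fst ` set L = {..<3}" "\<forall>x\<in>set L. valid G (snd x)"
    obtain P Q R where PQ: "L = slots 0 P @ slots 1 Q @ slots 2 R" "P \<noteq> []" "Q \<noteq> []" "R \<noteq> []" by (rule slots_split_3[OF L(1,2)])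
    have v: "\<forall>w\<in>set P. valid G w" "\<forall>w\<in>set Q. valid G w" "\<forall>w\<in>set R. valid G w"
      using L(3) by (simp_all add: PQ ball_Un)
    let ?p = "(mdeg P, mcls G P)" and ?q = "(mdeg Q, mcls G Q)" and ?r = "(mdeg R, mcls G R)"
    have L_nu: "F (nu G 3 (sing L)) = flip i [?p, ?q, ?r]"
      unfolding PQ(1) nu_slots_3[OF PQ(2,3,4) v] by (rule F(3)) (use PQ v in \<open>simp_all add: slots_gcomp\<close>)
    have nu_swap: "pscale (sg n) (nu G 3 q) - nu G 3 p \<in> Srel G" if "p - sg n * q \<in> rel_ideal G" for p q n
    proof (rule rel_space_minus_commute)
      show "nu G 3 p - pscale (sg n) (nu G 3 q) \<in> Srel G"
        using nu_rel_ideal[OF G that, of 3] by (simp add: plinear_diff[OF plinear_nu] plinear_sg[OF plinear_nu] pscale_sg)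
    qed
    consider "i = 0" | "i = 1" using i by linarith
    then show "F (nu G 3 (sing L)) - nu G 3 (shom E (sing L)) \<in> Srel G"
    proof cases
      case 1
      have "(shom E (sing L) :: 'g slotted list \<Rightarrow>\<^sub>0 'k) = sing (slots 1 P @ slots 0 Q @ slots 2 R)"
        unfolding PQ(1) sing_append hom_mult by (intro arg_cong2[of _ _ _ _ "(*)"] shom_slots) (simp_all add: 1 E)
      moreover have "flip i [?p, ?q, ?r] = pscale (sg (mdeg P * mdeg Q)) (nu G 3 (sing (slots 0 Q @ slots 1 P @ slots 2 R)))"
        unfolding nu_slots_3[OF PQ(3,2,4) v(2,1,3)] by (simp add: 1 flip_def)
      ultimately show ?thesis
        using nu_swap[OF rel_ideal_swap_slots[of "[]" 1 P 0 Q "slots 2 R"]] by (simp only: L_nu append_Nil)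
    next
      case 2
      have "(shom E (sing L) :: 'g slotted list \<Rightarrow>\<^sub>0 'k) = sing (slots 0 P @ slots 2 Q @ slots 1 R)"
        unfolding PQ(1) sing_append hom_mult by (intro arg_cong2[of _ _ _ _ "(*)"] shom_slots) (simp_all add: 2 E)
      moreover have "flip i [?p, ?q, ?r] = pscale (sg (mdeg Q * mdeg R)) (nu G 3 (sing (slots 0 P @ slots 1 R @ slots 2 Q)))"
        unfolding nu_slots_3[OF PQ(2,4,3) v(1,3,2)] by (simp add: 2 flip_def)
      ultimately show ?thesis
        using nu_swap[OF rel_ideal_swap_slots[of "slots 0 P" 2 Q 1 R "[]"]] by (simp only: L_nu append_Nil2)
    qed
  qed
  then show ?thesis using F(4)[OF nu_wspan] by (simp add: cls_eq_iff)
qed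

section \<open>The sums over subsets\<close>

text \<open>One step of insertion sort: \<open>x\<close> is moved past the smaller indices, and each
  exchange contributes the corresponding factor of the sign.\<close>

lemma rel_ideal_insort_koszul:
  fixes G :: "('k::field, 'g::plus) gspace"
  assumes "sorted s" "x \<notin> set s" "\<And>i. i \<in> insert x (set s) \<Longrightarrow> ds ! i = ldeg (h i)"
  shows "pscale (\<Prod>z\<leftarrow>s. if z < x then sg (ds ! x * ds ! z) else 1) (sing (h x # map h s)) - sing (map h (insort x s)) \<in> rel_ideal G"
  using assms
proof (induction s)
  case (Cons y s)
  let ?c = "\<lambda>s. (\<Prod>z\<leftarrow>s. if z < x then sg (ds ! x * ds ! z) else 1) :: 'k"
  show ?case
  proof (cases "x \<le> y")
    case True
    then have "?c (y # s) = (\<Prod>z\<leftarrow>y # s. 1)"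
      using Cons.prems by (intro arg_cong[of _ _ prod_list] map_cong) auto
    then have "?c (y # s) = 1" by (simp only: prod_list_const_1)
    then show ?thesis using True by (simp del: prod_list.Cons list.map(2)) simp
  next
    case False
    then have c: "?c (y # s) = sg (ldeg (h x) * ldeg (h y)) * ?c s"
      using Cons.prems(3)[of x] Cons.prems(3)[of y] by simp
    have IH: "pscale (?c s) (sing (h x # map h s)) - sing (map h (insort x s)) \<in> rel_ideal G"
      by (rule Cons.IH) (use Cons.prems in auto)
    define n where "n = ldeg (h x) * ldeg (h y)"
    define e where "e = ?c s"
    have ce: "?c (y # s) = sg n * e" unfolding c n_def e_def ..
    let ?X = "sing (h x # h y # map h s) :: 'g slotted list \<Rightarrow>\<^sub>0 'k" and ?Y = "sing (h y # h x # map h s) :: 'g slotted list \<Rightarrow>\<^sub>0 'k"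
      and ?Z = "sing (h y # map h (insort x s)) :: 'g slotted list \<Rightarrow>\<^sub>0 'k"
    have "pscale (sg n * e) (sg n * ?Y) = pscale (sg n * e) (pscale (sg n) ?Y)"
      by (simp only: pscale_sg)
    also have "\<dots> = pscale e ?Y" by (simp add: sg_def)
    finally have "pscale (sg n * e) ?X - ?Z = pscale (sg n * e) (?X - sg n * ?Y) + (pscale e ?Y - ?Z)"
      by (simp only: free.scale_right_diff_distrib) (simp only: add_diff_eq diff_add_cancel)
    also have "pscale e ?Y - ?Z = sing [h y] * (pscale e (sing (h x # map h s)) - sing (map h (insort x s)))"
      by (simp add: right_diff_distrib sing_mult)
    also have "pscale (sg n * e) (?X - sg n * ?Y) + \<dots> \<in> rel_ideal G"
      using rel_ideal_swap[of "[]" "h x" "h y" "map h s" G] IH[folded e_def]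
      by (intro rel_ideal_add rel_ideal_scale rel_ideal_mult_left) (simp_all add: n_def)
    finally have "pscale (?c (y # s)) (sing (h x # map h (y # s))) - sing (map h (insort x (y # s))) \<in> rel_ideal G"
      unfolding ce using False by (simp only: list.map insort_key.simps if_False)
    then show ?thesis .
  qed
qed simp

text \<open>Insertion sort realises the Koszul sign of the definitions by exchanges available in the
  ideal.\<close>

lemma rel_ideal_koszul:
  fixes G :: "('k::field, 'g::plus) gspace"
  assumes "distinct r" "\<And>i. i \<in> set r \<Longrightarrow> ds ! i = ldeg (h i)"
  shows "pscale (koszul ds r) (sing (map h r)) - sing (map h (sort r)) \<in> rel_ideal G"
  using assms
proof (induction r)
  case (Cons x r)
  let ?c = "\<lambda>s. (\<Prod>z\<leftarrow>s. if z < x then sg (ds ! x * ds ! z) else 1) :: 'k"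
  have c: "?c (sort r) = ?c r"
    unfolding prod_mset_prod_list[symmetric] mset_map mset_sort ..
  have 1: "pscale (koszul ds r) (sing (map h r)) - sing (map h (sort r)) \<in> rel_ideal G"
    using Cons by simp
  have 2: "pscale (?c r) (sing (h x # map h (sort r))) - sing (map h (insort x (sort r))) \<in> rel_ideal G"
    unfolding c[symmetric] by (rule rel_ideal_insort_koszul) (use Cons.prems in auto)
  have "pscale (koszul ds (x # r)) (sing (map h (x # r))) - sing (map h (sort (x # r)))
    = pscale (?c r) (sing [h x] * (pscale (koszul ds r) (sing (map h r)) - sing (map h (sort r))))
      + (pscale (?c r) (sing (h x # map h (sort r))) - sing (map h (insort x (sort r))))"
    by (simp add: koszul_Cons right_diff_distrib free.scale_right_diff_distrib sing_mult)
  also have "\<dots> \<in> rel_ideal G" using 1 2 by (intro rel_ideal_add rel_ideal_scale rel_ideal_mult_left)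
  finally show ?case .
qed simp

text \<open>Both sides represent the factors in their original order, each position labelled by its
  tensor factor. The lists \<open>p\<close> and \<open>q\<close> need not be sorted, as in the terms
  of the cobracket, where a piece of the cut is appended to a sorted list.\<close>

lemma split_term_nu:
  fixes G :: "('k::field, 'g::plus) gspace"
  assumes G: "gclosed (shift G)" and ys: "\<forall>y\<in>set ys. valid G y"
    and pq: "distinct (p @ q)" "set (p @ q) = {..<length ys}" "p \<noteq> []" "q \<noteq> []"
  shows "pscale c (nu G 2 (\<Prod>i\<leftarrow>[0..<length ys]. lt (if i \<in> set p then 0 else 1) (ys ! i))) - split_term G ys c p q \<in> Srel G"
proof -
  let ?h = "\<lambda>i. (if i \<in> set p then 0 else 1 :: nat, ys ! i)" and ?P = "map ((!) ys) p" and ?Q = "map ((!) ys) q"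
  have sing_map: "sing (map ?h is) = (\<Prod>i\<leftarrow>is. lt (if i \<in> set p then 0 else 1) (ys ! i) :: 'g slotted list \<Rightarrow>\<^sub>0 'k)" for "is"
  proof (induction "is")
    case (Cons a "is")
    then show ?case by (simp only: list.map prod_list.Cons sing_Cons[of "?h a" "map ?h is"] lt_def)
  qed (simp add: one_eq_sing)
  have sort: "sort (p @ q) = [0..<length ys]"
    by (rule sorted_distinct_set_unique) (use pq(1,2) in \<open>simp_all add: atLeast0LessThan\<close>)
  have "map ?h p = slots 0 ?P" by (simp add: slots_def)
  moreover have "map ?h q = slots 1 ?Q" using pq(1) by (auto simp: slots_def)
  ultimately have h: "map ?h (p @ q) = slots 0 ?P @ slots 1 ?Q" by simp
  have "valid G (ys ! i)" if "i \<in> set (p @ q)" for i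
    using that ys unfolding pq(2) by simp
  then have v: "\<forall>w\<in>set ?P. valid G w" "\<forall>w\<in>set ?Q. valid G w" by simp_all
  have n0: "?P \<noteq> []" "?Q \<noteq> []" using pq(3,4) by simp_all
  have split: "split_term G ys c p q = pscale c (pscale (koszul (map xdeg ys) (p @ q)) (nu G 2 (sing (map ?h (p @ q)))))"
    unfolding h nu_slots_2[OF n0 v] by (simp add: split_term_def Let_def)
  have "map xdeg ys ! i = ldeg (?h i)" if "i \<in> set (p @ q)" for i
    using that unfolding pq(2) by (simp add: ldeg_def)
  from rel_ideal_koszul[where h = ?h, OF pq(1) this]
  have "pscale (koszul (map xdeg ys) (p @ q)) (sing (map ?h (p @ q))) - sing (map ?h [0..<length ys]) \<in> rel_ideal G"
    unfolding sort .
  from nu_rel_ideal[OF G this, of 2]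
  have "pscale (koszul (map xdeg ys) (p @ q)) (nu G 2 (sing (map ?h (p @ q)))) - nu G 2 (sing (map ?h [0..<length ys])) \<in> Srel G"
    unfolding plinear_diff[OF plinear_nu] plinear_scale[OF plinear_nu] .
  from rel_space_scale[OF rel_space_minus_commute[OF this], of c]
  have "pscale c (nu G 2 (sing (map ?h [0..<length ys]))) - split_term G ys c p q \<in> Srel G"
    unfolding split free.scale_right_diff_distrib .
  then show ?thesis unfolding sing_map .
qed

text \<open>The distributive law for an ordered product. Positions outside \<open>N\<close> carry a
  prescribed factor; for the cobracket these are the two pieces of the cut.\<close>

lemma prod_list_sum_Pow:
  fixes a b c :: "'i \<Rightarrow> 'r::ring_1"
  assumes "distinct is"
  shows "(\<Prod>i\<leftarrow>is. if i \<in> N then a i + b i else c i)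
    = (\<Sum>I\<in>Pow (N \<inter> set is). \<Prod>i\<leftarrow>is. if i \<in> N then (if i \<in> I then a i else b i) else c i)"
  using assms
proof (induction "is")
  case (Cons x "is")
  let ?f = "\<lambda>I i. if i \<in> N then (if i \<in> I then a i else b i) else c i"
  have IH: "(\<Prod>i\<leftarrow>is. if i \<in> N then a i + b i else c i) = (\<Sum>I\<in>Pow (N \<inter> set is). \<Prod>i\<leftarrow>is. ?f I i)"
    using Cons by simp
  show ?case
  \<comment> \<open>Subsets containing \<open>x\<close> take \<open>a x\<close> from the first
    factor, the others take \<open>b x\<close>.\<close>
  proof (cases "x \<in> N")
    case True
    let ?M = "N \<inter> set is"
    have x: "x \<notin> ?M" using Cons.prems by simp
    have "N \<inter> set (x # is) = insert x ?M" using True by auto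
    then have "(\<Sum>I\<in>Pow (N \<inter> set (x # is)). \<Prod>i\<leftarrow>x # is. ?f I i)
      = (\<Sum>I\<in>Pow ?M. \<Prod>i\<leftarrow>x # is. ?f I i) + (\<Sum>I\<in>insert x ` Pow ?M. \<Prod>i\<leftarrow>x # is. ?f I i)"
      using x by (simp only: Pow_insert) (subst sum.union_disjoint; auto)
    also have "(\<Sum>I\<in>insert x ` Pow ?M. \<Prod>i\<leftarrow>x # is. ?f I i) = (\<Sum>I\<in>Pow ?M. \<Prod>i\<leftarrow>x # is. ?f (insert x I) i)"
      by (subst sum.reindex) (use x in \<open>auto simp: inj_on_def\<close>)
    also have "\<dots> = (\<Sum>I\<in>Pow ?M. a x * (\<Prod>i\<leftarrow>is. ?f I i))"
    proof (rule sum.cong[OF refl])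
      fix I
      have "(\<Prod>i\<leftarrow>is. ?f (insert x I) i) = (\<Prod>i\<leftarrow>is. ?f I i)"
        using Cons.prems by (intro arg_cong[of _ _ prod_list] map_cong) auto
      then show "(\<Prod>i\<leftarrow>x # is. ?f (insert x I) i) = a x * (\<Prod>i\<leftarrow>is. ?f I i)"
        using True by (simp only: list.map prod_list.Cons if_True insertI1)
    qed
    also have "(\<Sum>I\<in>Pow ?M. \<Prod>i\<leftarrow>x # is. ?f I i) = (\<Sum>I\<in>Pow ?M. b x * (\<Prod>i\<leftarrow>is. ?f I i))"
      by (rule sum.cong[OF refl]) (use True x in auto)
    finally show ?thesis
      using True by (simp add: IH distrib_right sum_distrib_left sum.distrib add.commute)
  next
    case False
    then have "N \<inter> set (x # is) = N \<inter> set is" by auto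
    then show ?thesis using False by (simp add: IH sum_distrib_left)
  qed
qed simp

lemma shom_slots_0: "shom E\<^sub>\<Delta> (sing (slots 0 ws)) = (\<Prod>w\<leftarrow>ws. lt 0 w + lt 1 w)"
  by (simp add: hom_sing slots_def dlt_def comp_def)

text \<open>The Leibniz rule expanded: the derivation acts at position \<open>s\<close> after
  passing the \<open>s\<close> letters before it.\<close>

lemma derw_sum:
  "derw deg k d w = (\<Sum>s<length w. sg (\<Sum>i<s. deg (w ! i)) *
     (hom d (sing (take s w)) * k (w ! s) * hom d (sing (drop (Suc s) w))))"
proof (induction w)
  case (Cons x w)
  have "sg (deg x) * d x * (sg n * (p * q * r)) = sg (deg x + n) * (d x * p * q * r)" for n p q r
    by (simp add: sg_def mult.assoc)
  then show ?case
    by (simp add: Cons sum.lessThan_Suc_shift hom_sing sum_distrib_left mult.assoc del: sum.lessThan_Suc)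
qed simp

lemma lsp_prod_lt: "(\<And>i. i \<in> set js \<Longrightarrow> f i = k) \<Longrightarrow> (\<Prod>i\<leftarrow>js. lt (f i) (w i)) \<in> lsp {k}"
  by (induction js) (simp_all add: one_eq_sing lsp_sing lsp_mult lsp_lt)

lemma coproduct_sum_nu:
  fixes G :: "('k::field, 'g::plus) gspace"
  assumes G: "gclosed (shift G)" and ws: "ws \<in> monomials G"
  shows "nu G 2 (shom E\<^sub>\<Delta> (sing (slots 0 ws))) - coproduct_sum G ws \<in> Srel G"
proof -
  let ?n = "length ws"
  let ?A = "{I. I \<subseteq> {..<?n} \<and> I \<noteq> {} \<and> {..<?n} - I \<noteq> {}}"
  let ?t = "\<lambda>I. \<Prod>i\<leftarrow>[0..<?n]. lt (if i \<in> I then 0 else 1) (ws ! i) :: 'g slotted list \<Rightarrow>\<^sub>0 'k"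
  have v: "\<forall>w\<in>set ws. valid G w" using ws by (simp add: monomials_iff)
  have "shom E\<^sub>\<Delta> (sing (slots 0 ws)) = (\<Prod>i\<leftarrow>[0..<?n]. lt 0 (ws ! i) + lt 1 (ws ! i) :: 'g slotted list \<Rightarrow>\<^sub>0 'k)"
    unfolding shom_slots_0 by (rule arg_cong[of _ _ prod_list]) (rule nth_equalityI; simp)
  also have "\<dots> = (\<Prod>i\<leftarrow>[0..<?n]. if i \<in> {..<?n} then lt 0 (ws ! i) + lt 1 (ws ! i) else 0)"
    by (intro arg_cong[of _ _ prod_list] map_cong) auto
  also have "\<dots> = (\<Sum>I\<in>Pow {..<?n}. \<Prod>i\<leftarrow>[0..<?n]. if i \<in> {..<?n} then (if i \<in> I then lt 0 (ws ! i) else lt 1 (ws ! i)) else 0)"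
    by (subst prod_list_sum_Pow) (simp_all add: atLeast0LessThan)
  also have "\<dots> = (\<Sum>I\<in>Pow {..<?n}. ?t I)"
    by (intro sum.cong refl arg_cong[of _ _ prod_list] map_cong) auto
  finally have 1: "nu G 2 (shom E\<^sub>\<Delta> (sing (slots 0 ws))) = (\<Sum>I\<in>Pow {..<?n}. nu G 2 (?t I))"
    by (simp add: plinear_sum[OF plinear_nu])
  \<comment> \<open>The empty and the full subset leave one tensor factor empty; \<open>nu\<close>
    drops these terms, as the reduced coproduct does.\<close>
  have zero: "nu G 2 (?t I) = 0" if "I \<in> Pow {..<?n} - ?A" for I
  proof -
    have "I = {} \<or> I = {..<?n}" using that by auto
    then obtain k :: nat where k: "k < 2" "\<And>i. i \<in> set [0..<?n] \<Longrightarrow> (if i \<in> I then 0 else 1) = k"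
    proof
      assume "I = {}" then show thesis using that[of 1] by simp
    next
      assume "I = {..<?n}" then show thesis using that[of 0] by simp
    qed
    have "\<not> {..<2} \<subseteq> {k}"
    proof
      assume "{..<2} \<subseteq> {k}"
      then have "0 \<in> {k}" "1 \<in> {k}" by (meson lessThan_iff subsetD zero_less_numeral one_less_numeral_iff semiring_norm(76))+
      then show False by simp
    qed
    moreover have "?t I \<in> lsp {k}" by (rule lsp_prod_lt) (rule k(2))
    ultimately show ?thesis using nu_lsp_0 by blast
  qed
  have 2: "(\<Sum>I\<in>Pow {..<?n}. nu G 2 (?t I)) = (\<Sum>I\<in>?A. nu G 2 (?t I))"
    by (rule sum.mono_neutral_right) (use zero in auto)
  have "nu G 2 (?t I) - split_term G ws 1 (sorted_list_of_set I) (sorted_list_of_set ({..<?n} - I)) \<in> Srel G" if I: "I \<in> ?A" for I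
  proof -
    have fin: "finite I" using I finite_subset by auto
    let ?p = "sorted_list_of_set I" and ?q = "sorted_list_of_set ({..<?n} - I)"
    have "distinct (?p @ ?q)" "set (?p @ ?q) = {..<?n}" "?p \<noteq> []" "?q \<noteq> []" using I fin by auto
    from split_term_nu[OF G v this, of 1] show ?thesis using fin by simp
  qed
  then have "(\<Sum>I\<in>?A. nu G 2 (?t I) - split_term G ws 1 (sorted_list_of_set I) (sorted_list_of_set ({..<?n} - I))) \<in> Srel G"
    by (rule rel_space_sum)
  then show ?thesis unfolding 1 2 coproduct_sum_def sum_subtractf .
qed

text \<open>The Leibniz expansion provides the sum over \<open>s\<close>, the cut of
  \<open>ws ! s\<close> the sum over \<open>j\<close>, and the distribution of the remaining factors
  over both sides the sum over \<open>I\<close>.\<close>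

lemma cobracket_sum_nu:
  fixes G :: "('k::field, 'g::plus) gspace"
  assumes G: "gclosed (shift G)" and ws: "ws \<in> monomials G"
  shows "nu G 2 (sder K\<^sub>\<kappa> E\<^sub>\<Delta> (sing (slots 0 ws))) - cobracket_sum G ws \<in> Srel G"
proof -
  let ?n = "length ws" and ?d = "\<lambda>ws. (\<Prod>w\<leftarrow>ws. lt 0 w + lt 1 w) :: 'g slotted list \<Rightarrow>\<^sub>0 'k"
  define U V where "U s j = take j (ws ! s)" and "V s j = drop j (ws ! s)" for s j
  define ys where "ys s j = take s ws @ [U s j, V s j] @ drop (Suc s) ws" for s j
  define N where "N s = {..<Suc ?n} - {s, Suc s}" for s
  define c :: "nat \<Rightarrow> nat \<Rightarrow> 'k" where "c s j = (-1) powi (\<Sum>i < s. xdeg (ws ! i)) * (-1) powi (xdeg (U s j) + 1)" for s j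
  \<comment> \<open>The exponent u + 1 of the definition is the unshifted degree of the left
    piece.\<close>
  have c: "c s j = sg (\<Sum>i < s. xdeg (ws ! i)) * sg (wdeg (U s j))" for s j
    by (simp add: c_def sg_power_int xdeg_def)
  have v: "\<forall>w\<in>set ws. valid G w" using ws by (simp add: monomials_iff)
  define T where "T s j p q = ?d (take s ws) * (lt p (U s j) * lt q (V s j)) * ?d (drop (Suc s) ws)" for s j p q
  have "sder K\<^sub>\<kappa> E\<^sub>\<Delta> (sing (slots 0 ws)) = (\<Sum>s<?n. sg (\<Sum>i<s. xdeg (ws ! i)) *
      (?d (take s ws) * cobr 0 1 (ws ! s) * ?d (drop (Suc s) ws)))"
    unfolding der_sing derw_sum
  proof (rule sum.cong)
    show "{..<length (slots 0 ws)} = {..<?n}" by (simp add: slots_def)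
    fix s assume s: "s \<in> {..<?n}"
    have "(\<Sum>i<s. ldeg (slots 0 ws ! i)) = (\<Sum>i<s. xdeg (ws ! i))"
      using s by (intro sum.cong) (simp_all add: slots_def ldeg_def)
    moreover have "klt K\<^sub>\<kappa> (slots 0 ws ! s) = (cobr 0 1 (ws ! s) :: 'g slotted list \<Rightarrow>\<^sub>0 'k)"
      using s by (simp add: slots_def klt_def)
    moreover have "take s (slots 0 ws) = slots 0 (take s ws)" "drop (Suc s) (slots 0 ws) = slots 0 (drop (Suc s) ws)"
      by (simp_all add: slots_def take_map drop_map)
    ultimately show "sg (\<Sum>i<s. ldeg (slots 0 ws ! i)) *
        (shom E\<^sub>\<Delta> (sing (take s (slots 0 ws))) * klt K\<^sub>\<kappa> (slots 0 ws ! s) * shom E\<^sub>\<Delta> (sing (drop (Suc s) (slots 0 ws))))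
      = sg (\<Sum>i<s. xdeg (ws ! i)) * (?d (take s ws) * cobr 0 1 (ws ! s) * ?d (drop (Suc s) ws))"
      by (simp only: shom_slots_0)
  qed
  also have "\<dots> = (\<Sum>s<?n. \<Sum>j\<in>{0<..<length (ws ! s)}. pscale (c s j) (T s j 0 1 + T s j 1 0))"
  proof (rule sum.cong[OF refl])
    fix s
    have "sg n * (a * (sg m * (x + y)) * b) = pscale (sg n * sg m) (a * x * b + a * y * b)"
      for n m and a b x y :: "'g slotted list \<Rightarrow>\<^sub>0 'k"
      by (simp add: sg_def distrib_left distrib_right)
    then show "sg (\<Sum>i<s. xdeg (ws ! i)) * (?d (take s ws) * cobr 0 1 (ws ! s) * ?d (drop (Suc s) ws))
      = (\<Sum>j\<in>{0<..<length (ws ! s)}. pscale (c s j) (T s j 0 1 + T s j 1 0))"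
      unfolding cobr_def c T_def U_def V_def by (simp only: sum_distrib_left sum_distrib_right)
  qed
  finally have 1: "nu G 2 (sder K\<^sub>\<kappa> E\<^sub>\<Delta> (sing (slots 0 ws)))
    = (\<Sum>s<?n. \<Sum>j\<in>{0<..<length (ws ! s)}. pscale (c s j) (nu G 2 (T s j 0 1)) + pscale (c s j) (nu G 2 (T s j 1 0)))"
    by (simp add: plinear_sum[OF plinear_nu] plinear_scale[OF plinear_nu] plinear_add[OF plinear_nu] free.scale_right_distrib)
  have 2: "cobracket_sum G ws = (\<Sum>s<?n. \<Sum>j\<in>{0<..<length (ws ! s)}.
      (\<Sum>I\<in>Pow (N s). split_term G (ys s j) (c s j) (sorted_list_of_set I @ [s]) (Suc s # sorted_list_of_set (N s - I)))
      + (\<Sum>I\<in>Pow (N s). split_term G (ys s j) (c s j) (sorted_list_of_set I @ [Suc s]) (s # sorted_list_of_set (N s - I))))"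
    unfolding cobracket_sum_def Let_def
  proof (intro sum.cong refl)
    fix s j assume s: "s \<in> {..<?n}"
    then have len: "length (take s ws @ [take j (ws ! s), drop j (ws ! s)] @ drop (Suc s) ws) = Suc ?n" by simp
    show "(\<Sum>I\<in>Pow ({..<length (take s ws @ [take j (ws ! s), drop j (ws ! s)] @ drop (Suc s) ws)} - {s, Suc s}).
          split_term G (take s ws @ [take j (ws ! s), drop j (ws ! s)] @ drop (Suc s) ws)
            ((-1) powi (\<Sum>i < s. xdeg (ws ! i)) * (-1) powi (xdeg (take j (ws ! s)) + 1))
            (sorted_list_of_set I @ [s])
            (Suc s # sorted_list_of_set ({..<length (take s ws @ [take j (ws ! s), drop j (ws ! s)] @ drop (Suc s) ws)} - {s, Suc s} - I))
        + split_term G (take s ws @ [take j (ws ! s), drop j (ws ! s)] @ drop (Suc s) ws)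
            ((-1) powi (\<Sum>i < s. xdeg (ws ! i)) * (-1) powi (xdeg (take j (ws ! s)) + 1))
            (sorted_list_of_set I @ [Suc s])
            (s # sorted_list_of_set ({..<length (take s ws @ [take j (ws ! s), drop j (ws ! s)] @ drop (Suc s) ws)} - {s, Suc s} - I)))
      = (\<Sum>I\<in>Pow (N s). split_term G (ys s j) (c s j) (sorted_list_of_set I @ [s]) (Suc s # sorted_list_of_set (N s - I)))
      + (\<Sum>I\<in>Pow (N s). split_term G (ys s j) (c s j) (sorted_list_of_set I @ [Suc s]) (s # sorted_list_of_set (N s - I)))"
      unfolding len by (simp only: N_def ys_def c_def U_def V_def sum.distrib)
  qed
  \<comment> \<open>The alternatives are the two halves of the symmetrized cut; \<open>a\<close> is
    the position of the piece that lands in factor 0, \<open>b\<close> that of the piece in factor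
    1.\<close>
  have main: "pscale (c s j) (nu G 2 (T s j p q))
      - (\<Sum>I\<in>Pow (N s). split_term G (ys s j) (c s j) (sorted_list_of_set I @ [a]) (b # sorted_list_of_set (N s - I))) \<in> Srel G"
    if s: "s < ?n" and j: "j \<in> {0<..<length (ws ! s)}"
      and ab: "(p, q, a, b) = (0, 1, s, Suc s) \<or> (p, q, a, b) = (1, 0, Suc s, s)" for s j p q a b
  proof -
    let ?y = "ys s j"
    have len: "length ?y = Suc ?n" using s by (simp add: ys_def)
    have "ws ! s \<in> set ws" using s by simp
    then have "valid G (ws ! s)" using v by blast
    then have "U s j @ V s j \<in> words (shift G)" by (simp add: U_def V_def valid_def)
    moreover have "U s j \<noteq> []" "V s j \<noteq> []" using j by (auto simp: U_def V_def)
    ultimately have "valid G (U s j)" "valid G (V s j)" unfolding words_append valid_def by blast+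
    moreover have "\<forall>w\<in>set (take s ws). valid G w" "\<forall>w\<in>set (drop (Suc s) ws). valid G w"
      using v in_set_takeD in_set_dropD by fast+
    ultimately have vy: "\<forall>y\<in>set ?y. valid G y"
      by (simp add: ys_def ball_Un)
    \<comment> \<open>At positions \<open>s\<close> and \<open>Suc s\<close>, which hold the two
      pieces, the tensor factor is fixed; all other positions run over both factors.\<close>
    let ?c = "\<lambda>i. if i = s then lt p (?y ! i) else lt q (?y ! i) :: 'g slotted list \<Rightarrow>\<^sub>0 'k"
    have "map (\<lambda>i. if i \<in> N s then lt 0 (?y ! i) + lt 1 (?y ! i) else ?c i) [0..<Suc ?n]
      = map (\<lambda>w. lt 0 w + lt 1 w) (take s ws) @ [lt p (U s j), lt q (V s j)] @ map (\<lambda>w. lt 0 w + lt 1 w) (drop (Suc s) ws)"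
    proof (rule nth_equalityI)
      show "length (map (\<lambda>i. if i \<in> N s then lt 0 (?y ! i) + lt 1 (?y ! i) else ?c i) [0..<Suc ?n])
        = length (map (\<lambda>w. lt 0 w + lt 1 w) (take s ws) @ [lt p (U s j), lt q (V s j)] @ map (\<lambda>w. lt 0 w + lt 1 w) (drop (Suc s) ws))"
        using s by simp
      fix i assume "i < length (map (\<lambda>i. if i \<in> N s then lt 0 (?y ! i) + lt 1 (?y ! i) else ?c i) [0..<Suc ?n])"
      then have i: "i < Suc ?n" by simp
      have "i < s \<or> i = s \<or> i = Suc s \<or> Suc (Suc s) \<le> i" by linarith
      then consider "i < s" | "i = s" | "i = Suc s" | k where "i = Suc (Suc s) + k"
        using le_Suc_ex by blast
      then show "map (\<lambda>i. if i \<in> N s then lt 0 (?y ! i) + lt 1 (?y ! i) else ?c i) [0..<Suc ?n] ! i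
        = (map (\<lambda>w. lt 0 w + lt 1 w) (take s ws) @ [lt p (U s j), lt q (V s j)] @ map (\<lambda>w. lt 0 w + lt 1 w) (drop (Suc s) ws)) ! i"
        using s i by cases (simp_all add: N_def ys_def nth_append del: upt_Suc)
    qed
    then have "T s j p q = (\<Prod>i\<leftarrow>[0..<Suc ?n]. if i \<in> N s then lt 0 (?y ! i) + lt 1 (?y ! i) else ?c i)"
      by (simp only: T_def prod_list.append prod_list.Cons prod_list.Nil mult.assoc mult_1_right)
    also have "\<dots> = (\<Sum>I\<in>Pow (N s \<inter> set [0..<Suc ?n]). \<Prod>i\<leftarrow>[0..<Suc ?n]. if i \<in> N s then (if i \<in> I then lt 0 (?y ! i) else lt 1 (?y ! i)) else ?c i)"
      by (rule prod_list_sum_Pow) simp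
    also have "N s \<inter> set [0..<Suc ?n] = N s" by (auto simp: N_def)
    finally have T: "T s j p q = (\<Sum>I\<in>Pow (N s). \<Prod>i\<leftarrow>[0..<Suc ?n]. if i \<in> N s then (if i \<in> I then lt 0 (?y ! i) else lt 1 (?y ! i)) else ?c i)" .
    have "pscale (c s j) (nu G 2 (\<Prod>i\<leftarrow>[0..<Suc ?n]. if i \<in> N s then (if i \<in> I then lt 0 (?y ! i) else lt 1 (?y ! i)) else ?c i))
       - split_term G ?y (c s j) (sorted_list_of_set I @ [a]) (b # sorted_list_of_set (N s - I)) \<in> Srel G" if I: "I \<in> Pow (N s)" for I
    proof -
      let ?p = "sorted_list_of_set I @ [a]" and ?q = "b # sorted_list_of_set (N s - I)"
      have fin: "finite I" "finite (N s)" using I finite_subset[of I "N s"] by (auto simp: N_def)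
      have ab': "a \<noteq> b" "a \<notin> N s" "b \<notin> N s" "{a, b} \<union> N s = {..<Suc ?n}" using ab s by (auto simp: N_def)
      have "distinct (?p @ ?q)" using ab' I fin by auto
      moreover have "set (?p @ ?q) = {..<length ?y}" unfolding len ab'(4)[symmetric] using I fin by auto
      moreover have "map (\<lambda>i. if i \<in> N s then (if i \<in> I then lt 0 (?y ! i) else lt 1 (?y ! i)) else ?c i) [0..<Suc ?n]
          = map (\<lambda>i. lt (if i \<in> set ?p then 0 else 1) (?y ! i) :: 'g slotted list \<Rightarrow>\<^sub>0 'k) [0..<length ?y]"
        unfolding len
      proof (rule map_cong[OF refl])
        fix i assume "i \<in> set [0..<Suc ?n]"
        then show "(if i \<in> N s then (if i \<in> I then lt 0 (?y ! i) else lt 1 (?y ! i)) else ?c i)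
          = (lt (if i \<in> set ?p then 0 else 1) (?y ! i) :: 'g slotted list \<Rightarrow>\<^sub>0 'k)"
          using ab I fin by (auto simp: N_def)
      qed
      ultimately show ?thesis
        using split_term_nu[OF G vy, of ?p ?q "c s j"] by (simp only:) simp
    qed
    then have "(\<Sum>I\<in>Pow (N s). pscale (c s j) (nu G 2 (\<Prod>i\<leftarrow>[0..<Suc ?n]. if i \<in> N s then (if i \<in> I then lt 0 (?y ! i) else lt 1 (?y ! i)) else ?c i))
       - split_term G ?y (c s j) (sorted_list_of_set I @ [a]) (b # sorted_list_of_set (N s - I))) \<in> Srel G"
      by (rule rel_space_sum)
    then show ?thesis
      unfolding T plinear_sum[OF plinear_nu] free.scale_sum_right sum_subtractf .
  qed
  show ?thesis
    unfolding 1 2 sum_subtractf[symmetric]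
  proof (intro rel_space_sum)
    fix s j assume "s \<in> {..<?n}" and j: "j \<in> {0<..<length (ws ! s)}"
    then have s: "s < ?n" by simp
    have "(x - x') + (y - y') \<in> Srel G \<Longrightarrow> (x + y) - (x' + y') \<in> Srel G" for x y x' y' :: "(int \<times> ('k, ('k, 'g) tensor) tensor) list \<Rightarrow>\<^sub>0 'k"
      by (simp add: algebra_simps)
    then show "pscale (c s j) (nu G 2 (T s j 0 1)) + pscale (c s j) (nu G 2 (T s j 1 0))
      - ((\<Sum>I\<in>Pow (N s). split_term G (ys s j) (c s j) (sorted_list_of_set I @ [s]) (Suc s # sorted_list_of_set (N s - I)))
        + (\<Sum>I\<in>Pow (N s). split_term G (ys s j) (c s j) (sorted_list_of_set I @ [Suc s]) (s # sorted_list_of_set (N s - I)))) \<in> Srel G"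
      using rel_space_add[OF main[OF s j, of 0 1 s "Suc s"] main[OF s j, of 1 0 "Suc s" s]] by blast
  qed
qed

section \<open>The identities on S^+\<close>

lemma gclosed_graded_vector_space: "graded_vector_space G \<Longrightarrow> gclosed G"
proof -
  assume "graded_vector_space G"
  then interpret graded_vector_space G .
  show ?thesis
    using subspace_gcomp unfolding gclosed_def by (auto intro: subspace_add subspace_scale)
qed

theorem proposition6p1:
  fixes G :: "('k::field_char_0, 'g::ab_group_add) gspace"
    and mult bracket :: "'g \<Rightarrow> 'g \<Rightarrow> 'g"
  assumes "gerstenhaber_algebra G mult bracket"
  shows
    "(\<forall>x \<in> total (SH G).
        (tensor_id (SH G) (cobracket G) \<circ> cobracket G) x
        + (tau12 (SH G) \<circ> tau23 (SH G) \<circ> tensor_id (SH G) (cobracket G) \<circ> cobracket G) x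
        + (tau23 (SH G) \<circ> tau12 (SH G) \<circ> tensor_id (SH G) (cobracket G) \<circ> cobracket G) x
        = cls (SH G) {} 0) \<and>
     (\<forall>x \<in> total (SH G).
        (id_tensor (SH G) 0 (coproduct G) \<circ> cobracket G) x
        = (tensor_id (SH G) (cobracket G) \<circ> coproduct G) x
        + (tau12 (SH G) \<circ> id_tensor (SH G) 1 (cobracket G) \<circ> coproduct G) x)"
proof -
  let ?S = "SH G"
  have "graded_vector_space G" using assms by (simp add: gerstenhaber_algebra_def)
  then have G: "gclosed (shift G)" by (intro gclosed_shift gclosed_graded_vector_space)
  note \<kappa> = SH_extension[OF G plinear_der sder_rel_ideal cobracket_sum_nu[OF G], folded cobracket_def]
  note \<Delta> = SH_extension[OF G plinear_hom shom_rel_ideal coproduct_sum_nu[OF G], folded coproduct_def]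
  have \<kappa>_id: "tensor_id ?S (cobracket G) (cls ?S {} (nu G 2 p)) = cls ?S {} (nu G 3 (sder K\<^sub>l E\<^sub>l p))" for p
    by (rule tensor_id_nu[OF G \<kappa>(2,3)])
  have id_\<kappa>: "id_tensor ?S 1 (cobracket G) (cls ?S {} (nu G 2 p)) = cls ?S {} (nu G 3 (sder K\<^sub>r E\<^sub>r p))" for p
  proof (rule id_tensor_nu[OF G \<kappa>(2,3) plinear_der sder_rel_ideal])
    fix L :: "'g slotted list" assume L: "fst ` set L \<noteq> {..<2}"
    consider x where "x \<in> set L" "fst x \<ge> 2" | "fst ` set L \<subseteq> {0}" | "fst ` set L \<subseteq> {1}"
      using subset_two_cases[OF L] by force
    \<comment> \<open>Without letters in factor 1 there is nothing to cut, and without letters in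
      factor 0 that factor stays empty.\<close>
    then show "nu G 3 (sder K\<^sub>r E\<^sub>r (sing L)) = 0"
    proof cases
      case 1
      then show ?thesis by (subst sder_eq_0[OF 1(1)]) (auto simp: plinear_0[OF plinear_nu])
    next
      case 2
      then show ?thesis by (subst sder_eq_0') (auto simp: plinear_0[OF plinear_nu])
    next
      case 3
      then have "sder K\<^sub>r E\<^sub>r (sing L) \<in> lsp {1, 2}" by (intro lsp_sder) auto
      then show ?thesis by (rule nu_lsp_0) (simp add: subset_iff, rule exI[of _ 0], simp)
    qed
  next
    fix P Q :: "(int \<times> 'g) list list"
    let ?up = "\<lambda>i. [Suc i]" and ?Q = "sing (slots 0 Q) :: 'g slotted list \<Rightarrow>\<^sub>0 'k"
    have "sder K\<^sub>r E\<^sub>r (sing (slots 0 P @ slots 1 Q)) = sder K\<^sub>r E\<^sub>r (sing (slots 0 P)) * shom E\<^sub>r (sing (slots 1 Q))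
        + shom E\<^sub>r (hom (parity ldeg) (sing (slots 0 P))) * sder K\<^sub>r E\<^sub>r (sing (slots 1 Q) :: 'g slotted list \<Rightarrow>\<^sub>0 'k)"
      by (simp only: sing_append der_mult)
    also have "sder K\<^sub>r E\<^sub>r (sing (slots 0 P)) = (0 :: 'g slotted list \<Rightarrow>\<^sub>0 'k)"
      by (rule sder_eq_0') (auto simp: slots_def)
    \<comment> \<open>Passing the whole first tensor factor produces the Koszul sign of id \<otimes>
      \<kappa>.\<close>
    also have "shom E\<^sub>r (hom (parity ldeg) (sing (slots 0 P))) = sg (mdeg P) * shom E\<^sub>r (sing (slots 0 P))"
      unfolding hom_parity_sing mdeg_slots ..
    also have "shom E\<^sub>r (sing (slots 0 P)) = (sing (slots 0 P) :: 'g slotted list \<Rightarrow>\<^sub>0 'k)"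
      by (rule shom_slots) simp
    \<comment> \<open>A letter of factor 1 is a relabelled letter of factor 0, so cutting it amounts
      to applying \<kappa> in factor 0 and raising all labels by one.\<close>
    also have "sder K\<^sub>r E\<^sub>r (sing (slots 1 Q)) = shom ?up (sder K\<^sub>\<kappa> E\<^sub>\<Delta> ?Q)"
    proof -
      have "(sing (slots 1 Q) :: 'g slotted list \<Rightarrow>\<^sub>0 'k) = shom (\<lambda>_. [1]) ?Q" by (rule shom_slots[symmetric]) simp
      then have "(sder K\<^sub>r E\<^sub>r (sing (slots 1 Q)) :: 'g slotted list \<Rightarrow>\<^sub>0 'k) = derw ldeg (\<lambda>x. sder K\<^sub>r E\<^sub>r (dlt (\<lambda>_. [1]) x)) (\<lambda>x. shom E\<^sub>r (dlt (\<lambda>_. [1]) x)) (slots 0 Q)"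
        by (simp only: sder_shom) (simp only: der_sing)
      also have "\<dots> = derw ldeg (\<lambda>x. shom ?up (klt K\<^sub>\<kappa> x)) (\<lambda>x. shom ?up (dlt E\<^sub>\<Delta> x)) (slots 0 Q)"
      proof (rule derw_cong(1))
        fix x assume "x \<in> set (slots 0 Q)"
        then have "fst x = 0" by (auto simp: slots_def)
        then show "sder K\<^sub>r E\<^sub>r (dlt (\<lambda>_. [1]) x) = shom ?up (klt K\<^sub>\<kappa> x) \<and> shom E\<^sub>r (dlt (\<lambda>_. [1]) x) = shom ?up (dlt E\<^sub>\<Delta> x)"
          by (simp add: dlt_def klt_def shom_cobr hom_add eval_nat_numeral)
      qed
      also have "\<dots> = shom ?up (sder K\<^sub>\<kappa> E\<^sub>\<Delta> ?Q)" by (simp only: hom_der) (simp only: der_sing)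
      finally show ?thesis .
    qed
    finally show "sder K\<^sub>r E\<^sub>r (sing (slots 0 P @ slots 1 Q)) = sg (1 * mdeg P) * (sing (slots 0 P) * shom ?up (sder K\<^sub>\<kappa> E\<^sub>\<Delta> ?Q))"
      by (simp only: mult_zero_left add_0_left mult_1 mult.assoc)
  qed
  have id_\<Delta>: "id_tensor ?S 0 (coproduct G) (cls ?S {} (nu G 2 p)) = cls ?S {} (nu G 3 (shom E\<^sub>r p))" for p
  proof (rule id_tensor_nu[OF G \<Delta>(2,3) plinear_hom shom_rel_ideal])
    fix L :: "'g slotted list" assume L: "fst ` set L \<noteq> {..<2}"
    consider x where "x \<in> set L" "fst x \<ge> 2" | "fst ` set L \<subseteq> {0}" | "fst ` set L \<subseteq> {1}"
      using subset_two_cases[OF L] by force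
    then show "nu G 3 (shom E\<^sub>r (sing L)) = 0"
    proof cases
      case 1
      then show ?thesis by (subst shom_eq_0[OF 1(1)]) (auto simp: plinear_0[OF plinear_nu])
    next
      case 2
      then have "shom E\<^sub>r (sing L) \<in> lsp {0}" by (intro lsp_shom) auto
      then show ?thesis by (rule nu_lsp_0) (simp add: subset_iff, rule exI[of _ 1], simp)
    next
      case 3
      then have "shom E\<^sub>r (sing L) \<in> lsp {1, 2}" by (intro lsp_shom) auto
      then show ?thesis by (rule nu_lsp_0) (simp add: subset_iff, rule exI[of _ 0], simp)
    qed
  next
    fix P Q :: "(int \<times> 'g) list list"
    let ?up = "\<lambda>i. [Suc i]" and ?Q = "sing (slots 0 Q) :: 'g slotted list \<Rightarrow>\<^sub>0 'k"
    have "shom E\<^sub>r (sing (slots 0 P @ slots 1 Q)) = shom E\<^sub>r (sing (slots 0 P)) * shom E\<^sub>r (sing (slots 1 Q) :: 'g slotted list \<Rightarrow>\<^sub>0 'k)"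
      by (simp only: sing_append hom_mult)
    also have "shom E\<^sub>r (sing (slots 0 P)) = (sing (slots 0 P) :: 'g slotted list \<Rightarrow>\<^sub>0 'k)"
      by (rule shom_slots) simp
    also have "shom E\<^sub>r (sing (slots 1 Q)) = shom ?up (shom E\<^sub>\<Delta> ?Q)"
    proof -
      have "(sing (slots 1 Q) :: 'g slotted list \<Rightarrow>\<^sub>0 'k) = shom (\<lambda>_. [1]) ?Q" by (rule shom_slots[symmetric]) simp
      then have "(shom E\<^sub>r (sing (slots 1 Q)) :: 'g slotted list \<Rightarrow>\<^sub>0 'k) = hom (\<lambda>x. shom E\<^sub>r (dlt (\<lambda>_. [1]) x)) ?Q"
        by (simp only: hom_hom)
      also have "\<dots> = hom (\<lambda>x. shom ?up (dlt E\<^sub>\<Delta> x)) ?Q"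
      proof (rule derw_cong(2))
        fix x assume "x \<in> set (slots 0 Q)"
        then have "fst x = 0" by (auto simp: slots_def)
        \<comment> \<open>The first conjunct concerns the derivation data of
          \<open>derw_cong\<close>, which the claim about homomorphisms leaves arbitrary.\<close>
        then show "undefined x = undefined x \<and> shom E\<^sub>r (dlt (\<lambda>_. [1]) x) = shom ?up (dlt E\<^sub>\<Delta> x)"
          by (simp add: dlt_def hom_add eval_nat_numeral)
      qed
      also have "\<dots> = shom ?up (shom E\<^sub>\<Delta> ?Q)" unfolding hom_hom ..
      finally show ?thesis .
    qed
    finally show "shom E\<^sub>r (sing (slots 0 P @ slots 1 Q)) = sg (0 * mdeg P) * (sing (slots 0 P) * shom ?up (shom E\<^sub>\<Delta> ?Q))"
      by simp
  qed
  have flip12: "{(tensor_cls ?S [(a, u), (b, v), (c, w)], scl (tensor_power ?S 3) ((-1) powi (a * b)) (tensor_cls ?S [(b, v), (a, u), (c, w)]))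
      | a u b v c w. u \<in> gcomp ?S a \<and> v \<in> gcomp ?S b \<and> w \<in> gcomp ?S c}
    = {(tensor_cls ?S w, cls ?S {} (flip 0 w)) | w. w \<in> words ?S \<and> length w = 3}" (is "?A = ?B")
  proof (intro set_eqI iffI)
    fix p assume "p \<in> ?A"
    then obtain a u b v c w where "p = (tensor_cls ?S [(a, u), (b, v), (c, w)],
        scl (tensor_power ?S 3) ((-1) powi (a * b)) (tensor_cls ?S [(b, v), (a, u), (c, w)]))"
      "u \<in> gcomp ?S a" "v \<in> gcomp ?S b" "w \<in> gcomp ?S c" by blast
    then show "p \<in> ?B"
      by (auto simp: flip_def sg_power_int intro!: exI[of _ "[(a, u), (b, v), (c, w)]"])
  next
    fix p assume "p \<in> ?B"
    then obtain w where w: "p = (tensor_cls ?S w, cls ?S {} (flip 0 w))" "w \<in> words ?S" "length w = 3" by blast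
    then obtain a u b v c t where "w = [(a, u), (b, v), (c, t)]"
      by (cases w; cases "tl w"; cases "tl (tl w)") auto
    with w have "p = (tensor_cls ?S [(a, u), (b, v), (c, t)],
        scl (tensor_power ?S 3) ((-1) powi (a * b)) (tensor_cls ?S [(b, v), (a, u), (c, t)]))"
      "u \<in> gcomp ?S a" "v \<in> gcomp ?S b" "t \<in> gcomp ?S c"
      by (auto simp: flip_def sg_power_int)
    then show "p \<in> ?A" by blast
  qed
  have flip23: "{(tensor_cls ?S [(a, u), (b, v), (c, w)], scl (tensor_power ?S 3) ((-1) powi (b * c)) (tensor_cls ?S [(a, u), (c, w), (b, v)]))
      | a u b v c w. u \<in> gcomp ?S a \<and> v \<in> gcomp ?S b \<and> w \<in> gcomp ?S c}
    = {(tensor_cls ?S w, cls ?S {} (flip 1 w)) | w. w \<in> words ?S \<and> length w = 3}" (is "?A = ?B")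
  proof (intro set_eqI iffI)
    fix p assume "p \<in> ?A"
    then obtain a u b v c w where "p = (tensor_cls ?S [(a, u), (b, v), (c, w)],
        scl (tensor_power ?S 3) ((-1) powi (b * c)) (tensor_cls ?S [(a, u), (c, w), (b, v)]))"
      "u \<in> gcomp ?S a" "v \<in> gcomp ?S b" "w \<in> gcomp ?S c" by blast
    then show "p \<in> ?B"
      by (auto simp: flip_def sg_power_int intro!: exI[of _ "[(a, u), (b, v), (c, w)]"])
  next
    fix p assume "p \<in> ?B"
    then obtain w where w: "p = (tensor_cls ?S w, cls ?S {} (flip 1 w))" "w \<in> words ?S" "length w = 3" by blast
    then obtain a u b v c t where "w = [(a, u), (b, v), (c, t)]"
      by (cases w; cases "tl w"; cases "tl (tl w)") auto
    with w have "p = (tensor_cls ?S [(a, u), (b, v), (c, t)],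
        scl (tensor_power ?S 3) ((-1) powi (b * c)) (tensor_cls ?S [(a, u), (c, t), (b, v)]))"
      "u \<in> gcomp ?S a" "v \<in> gcomp ?S b" "t \<in> gcomp ?S c"
      by (auto simp: flip_def sg_power_int)
    then show "p \<in> ?A" by blast
  qed
  have \<tau>12: "tau12 ?S (cls ?S {} (nu G 3 p)) = cls ?S {} (nu G 3 (shom T12 p))" for p
    unfolding tau12_def by (rule flip_nu[OF G _ flip12]) simp_all
  have \<tau>23: "tau23 ?S (cls ?S {} (nu G 3 p)) = cls ?S {} (nu G 3 (shom T23 p))" for p
    unfolding tau23_def by (rule flip_nu[OF G _ flip23]) simp_all
  have main: "(tensor_id ?S (cobracket G) \<circ> cobracket G) x
        + (tau12 ?S \<circ> tau23 ?S \<circ> tensor_id ?S (cobracket G) \<circ> cobracket G) x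
        + (tau23 ?S \<circ> tau12 ?S \<circ> tensor_id ?S (cobracket G) \<circ> cobracket G) x
        = cls ?S {} 0 \<and>
     (id_tensor ?S 0 (coproduct G) \<circ> cobracket G) x
        = (tensor_id ?S (cobracket G) \<circ> coproduct G) x
        + (tau12 ?S \<circ> id_tensor ?S 1 (cobracket G) \<circ> coproduct G) x"
    if x: "x \<in> total ?S" for x
  proof -
    obtain q where q: "q \<in> wspan (HH1 G) {1..}" "x = cls (HH1 G) (comm_rels (HH1 G)) q"
      using x unfolding SH_eq total_tensor_quotient by blast
    have \<kappa>x: "cobracket G x = cls ?S {} (nu G 2 (sder K\<^sub>\<kappa> E\<^sub>\<Delta> (lift G q)))"
      unfolding q(2) by (rule \<kappa>(1)[OF _ _ q(1)])
    have \<Delta>x: "coproduct G x = cls ?S {} (nu G 2 (shom E\<^sub>\<Delta> (lift G q)))"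
      unfolding q(2) by (rule \<Delta>(1)[OF _ _ q(1)])
    show ?thesis
      unfolding comp_def \<kappa>x \<Delta>x \<kappa>_id id_\<kappa> id_\<Delta> \<tau>12 \<tau>23 cls_add plinear_add[OF plinear_nu, symmetric] coJacobi_free
        coLeibniz_free plinear_0[OF plinear_nu] by simp
  qed
  then show ?thesis by blast
qed

end
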